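(* Let $A\colon X\to Y$ be an operator between Banach spaces $X$ and $Y$. Then $A$ has asymptotic basic subtype if and only if $A^*$ has weak$^*$ asymptotic basic subcotype. Moreover, for $1\le p\le\infty$ and $q$ with $1/p+1/q=1$, $A$ has asymptotic basic type $p$ if and only if $A^*$ has weak$^*$ asymptotic basic cotype $q$.
   Context: Fix $\mathbb K\in\{\mathbb R,\mathbb C\}$. Banach spaces are over $\mathbb K$, operators are bounded and linear, $(e_i)_{i=1}^n$ is the canonical basis of $\mathbb K^n$. Conventions: $q=\infty$ if $p=1$ and $q=1$ if $p=\infty$. Trees: for a directed set $D$ put $D^{\le n}=\bigcup_{i=0}^n D^i$; for $t\in D^n$, $t|_i$ is the initial segment of $t$ of length $i$; $t\frown(u)$ is concatenation. A tree $(x_t)_{t\in D^{\le n}\setminus\{\varnothing\}}\subset X$ is normalized if $\|x_t\|=1$ for all $t$, and weakly null if for every $t\in D^{\le n-1}$ the net $(x_{t\frown(u)})_{u\in D}$ is weakly null. A tree in a dual space is weak$^*$-null if for every $t\in D^{\le n-1}$ the net $(x^*_{t\frown(u)})_{u\in D}$ is weak$^*$-null. Asymptotic structures: for an operator $A\colon X\to Y$ and $n\in\mathbb N$, $\{A\}_n=\varnothing$ if $\dim X<\infty$; otherwise $\{A\}_n$ is the set of all pairs $(r,\rho)$ with $r$ a norm and $\rho$ a seminorm on $\mathbb K^n$ such that $r(e_i)=1$ for all $i$; $r(\sum_{i=1}^m a_ie_i)\le r(\sum_{i=1}^n a_ie_i)$ and $\rho(\sum_{i=1}^m a_ie_i)\le\rho(\sum_{i=1}^n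 a_ie_i)$ for all $m\le n$ and all scalars; $\rho\le\|A\|r$; and for every $\delta>0$ there exist a directed set $D$ and a normalized weakly null tree $(x_t)_{t\in D^{\le n}\setminus\{\varnothing\}}\subset X$ such that for all $t\in D^n$ and all scalars with $\max_i|a_i|\le1$, $\bigl|\|\sum_i a_ix_{t|_i}\|-r(\sum_i a_ie_i)\bigr|<\delta$ and $\bigl|\|A\sum_i a_ix_{t|_i}\|-\rho(\sum_i a_ie_i)\bigr|<\delta$. The weak$^*$ asymptotic structure $\{A\}_n^*$ is empty if $\dim Y<\infty$; otherwise it is defined in the same way using normalized weak$^*$-null trees $(y_t^* )$ in $Y^*$ and $A^*$ in place of $(x_t)$ and $A$. $\alpha_{p,n}(A)$ is the infimum of $T>0$ such that $\rho(\sum_i a_ie_i)\le T\|(a_i)\|_{\ell_p^n}$ for all $(r,\rho)\in\{A\}_n$ and all scalars; $\theta_n(A)$ is the infimum of $T>0$ such that $\rho(\frac1n\sum_i a_ie_i)\le T\max_i|a_i|$ for all such $(r,\rho)$ and scalars. $\beta^*_{q,n}(A)$ is the infimum of $C>0$ such that $C\,r(\sum_i a_ie_i)\ge\|(a_i\rho(e_i))_{i=1}^n\|_{\ell_q^n}$ for all $(r,\rho)\in\{A\}^*_n$ and all scalars; $\upsilon^*_n(A)$ is the infimum of $C>0$ such that $C\,r(\sum_i a_ie_i)\ge\min_i|a_i\rho(e_i)|$ for all such $(r,\rho)$ and scalars. $A$ has asymptotic basic type $p$ if $\sup_n\alpha_{p,n}(A)<\infty$, and asymptotic basic subtype if $\theta_n(A)\to0$.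 $A^*$ has weak$^*$ asymptotic basic cotype $q$ if $\sup_n\beta^*_{q,n}(A)<\infty$, and weak$^*$ asymptotic basic subcotype if $\upsilon^*_n(A)\to0$. *)

theory Defs
  imports "HOL-Analysis.Analysis"
begin

section \<open>Scalar fields and Banach spaces\<close>

text \<open>The fields isometrically isomorphic to the reals or to the complex numbers; this renders
  ``\<open>\<K>\<close> is the real or the complex field''.\<close>

class real_or_complex = real_normed_field +
  assumes real_or_complex:
    "\<exists>\<iota> :: 'a \<Rightarrow> complex.
       (\<forall>x y. \<iota> (x + y) = \<iota> x + \<iota> y) \<and> (\<forall>x y. \<iota> (x * y) = \<iota> x * \<iota> y) \<and>
       (\<forall>c x. \<iota> (c *\<^sub>R x) = c *\<^sub>R \<iota> x) \<and> (\<forall>x. norm (\<iota> x) = norm x) \<and>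
       (range \<iota> = \<real> \<or> range \<iota> = UNIV)"

instance real :: real_or_complex
proof
  show "\<exists>\<iota> :: real \<Rightarrow> complex.
       (\<forall>x y. \<iota> (x + y) = \<iota> x + \<iota> y) \<and> (\<forall>x y. \<iota> (x * y) = \<iota> x * \<iota> y) \<and>
       (\<forall>c x. \<iota> (c *\<^sub>R x) = c *\<^sub>R \<iota> x) \<and> (\<forall>x. norm (\<iota> x) = norm x) \<and>
       (range \<iota> = \<real> \<or> range \<iota> = UNIV)"
    by (rule exI[of _ complex_of_real]) (auto simp: Reals_def scaleR_conv_of_real)
qed

instance complex :: real_or_complex
proof
  show "\<exists>\<iota> :: complex \<Rightarrow> complex.
       (\<forall>x y. \<iota> (x + y) = \<iota> x + \<iota> y) \<and> (\<forall>x y. \<iota> (x * y) = \<iota> x * \<iota> y) \<and>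
       (\<forall>c x. \<iota> (c *\<^sub>R x) = c *\<^sub>R \<iota> x) \<and> (\<forall>x. norm (\<iota> x) = norm x) \<and>
       (range \<iota> = \<real> \<or> range \<iota> = UNIV)"
    by (rule exI[of _ id]) auto
qed

text \<open>A Banach space over \<open>'k\<close> is a type of class \<^class>\<open>banach\<close> (which supplies the norm, completeness
  and the underlying real structure) together with a compatible scalar multiplication.\<close>

locale banach_over = vector_space smul
  for smul :: "'k::real_or_complex \<Rightarrow> 'v::banach \<Rightarrow> 'v" +
  assumes smul_of_real: "smul (of_real r) x = r *\<^sub>R x"
    and norm_smul: "norm (smul c x) = norm c * norm x"

definition finite_dim :: "('k::field \<Rightarrow> 'v::ab_group_add \<Rightarrow> 'v) \<Rightarrow> bool" where
  "finite_dim smul \<longleftrightarrow> (\<exists>B. finite B \<and> module.span smul B = UNIV)"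

text \<open>The type \<open>'v \<Rightarrow>\<^sub>L 'k\<close> consists of the bounded real-linear maps. The dual is the subspace of those
  which are linear over \<open>'k\<close>.\<close>

definition dual :: "('k::real_or_complex \<Rightarrow> 'v::real_normed_vector \<Rightarrow> 'v) \<Rightarrow> ('v \<Rightarrow>\<^sub>L 'k) set" where
  "dual smul = {f. \<forall>c x. blinfun_apply f (smul c x) = c * blinfun_apply f x}"

definition dual_scale :: "'k::real_or_complex \<Rightarrow> ('v::real_normed_vector \<Rightarrow>\<^sub>L 'k) \<Rightarrow> ('v \<Rightarrow>\<^sub>L 'k)" where
  "dual_scale c f = blinfun_mult_right c o\<^sub>L f"

definition linear_over ::
  "('k \<Rightarrow> 'x \<Rightarrow> 'x) \<Rightarrow> ('k \<Rightarrow> 'y \<Rightarrow> 'y) \<Rightarrow> ('x::real_normed_vector \<Rightarrow>\<^sub>L 'y::real_normed_vector) \<Rightarrow> bool"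
  where "linear_over scaleX scaleY A \<longleftrightarrow>
    (\<forall>c x. blinfun_apply A (scaleX c x) = scaleY c (blinfun_apply A x))"

definition adjoint_op ::
  "('x::real_normed_vector \<Rightarrow>\<^sub>L 'y::real_normed_vector) \<Rightarrow> ('y \<Rightarrow>\<^sub>L 'k::real_or_complex) \<Rightarrow> ('x \<Rightarrow>\<^sub>L 'k)" where
  "adjoint_op A f = f o\<^sub>L A"

text \<open>Operator norm of the restriction of \<open>T\<close> to a subspace \<open>S\<close>; for \<open>S = UNIV\<close> this is
  \<^const>\<open>onorm\<close>.\<close>

definition onorm_on :: "'v::real_normed_vector set \<Rightarrow> ('v \<Rightarrow> 'w::real_normed_vector) \<Rightarrow> real" where
  "onorm_on S T = (SUP x\<in>S. norm (T x) / norm x)"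

section \<open>Directed sets, nets and trees\<close>

definition directed :: "'d set \<Rightarrow> ('d \<Rightarrow> 'd \<Rightarrow> bool) \<Rightarrow> bool" where
  "directed D le \<longleftrightarrow> D \<noteq> {} \<and> (\<forall>u\<in>D. le u u) \<and>
     (\<forall>u\<in>D. \<forall>v\<in>D. \<forall>w\<in>D. le u v \<longrightarrow> le v w \<longrightarrow> le u w) \<and>
     (\<forall>u\<in>D. \<forall>v\<in>D. \<exists>w\<in>D. le u w \<and> le v w)"

definition net_filter :: "'d set \<Rightarrow> ('d \<Rightarrow> 'd \<Rightarrow> bool) \<Rightarrow> 'd filter" where
  "net_filter D le = (INF u\<in>D. principal {v\<in>D. le u v})"

text \<open>Convergence to 0 in the topology induced by a family \<open>\<Phi>\<close> of functionals.\<close>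

definition null_net :: "('v \<Rightarrow> 'k::real_normed_vector) set \<Rightarrow> 'd filter \<Rightarrow> ('d \<Rightarrow> 'v) \<Rightarrow> bool" where
  "null_net \<Phi> F x \<longleftrightarrow> (\<forall>\<phi>\<in>\<Phi>. ((\<lambda>u. \<phi> (x u)) \<longlongrightarrow> 0) F)"

definition weak_functionals ::
  "('k::real_or_complex \<Rightarrow> 'v::real_normed_vector \<Rightarrow> 'v) \<Rightarrow> ('v \<Rightarrow> 'k) set" where
  "weak_functionals smul = blinfun_apply ` dual smul"

definition weakstar_functionals :: "(('v::real_normed_vector \<Rightarrow>\<^sub>L 'k::real_normed_vector) \<Rightarrow> 'k) set" where
  "weakstar_functionals = range (\<lambda>v f. blinfun_apply f v)"

text \<open>A tree indexed by \<open>D\<^bsup>\<le>n\<^esup>\<close> without the empty sequence is a function on lists, of which only the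
  values at the lists over \<open>D\<close> of length between 1 and \<open>n\<close> matter.\<close>

definition normalized_tree ::
  "'v::real_normed_vector set \<Rightarrow> 'd set \<Rightarrow> nat \<Rightarrow> ('d list \<Rightarrow> 'v) \<Rightarrow> bool" where
  "normalized_tree S D n x \<longleftrightarrow>
     (\<forall>t\<in>lists D. 1 \<le> length t \<and> length t \<le> n \<longrightarrow> x t \<in> S \<and> norm (x t) = 1)"

definition null_tree ::
  "('v \<Rightarrow> 'k::real_normed_vector) set \<Rightarrow> 'd set \<Rightarrow> ('d \<Rightarrow> 'd \<Rightarrow> bool) \<Rightarrow> nat \<Rightarrow> ('d list \<Rightarrow> 'v) \<Rightarrow> bool" where
  "null_tree \<Phi> D le n x \<longleftrightarrow>
     (\<forall>t\<in>lists D. length t < n \<longrightarrow> null_net \<Phi> (net_filter D le) (\<lambda>u. x (t @ [u])))"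

section \<open>Norms on the coordinate spaces\<close>

text \<open>The elements of \<open>\<K>\<^sup>n\<close> are the functions \<open>nat \<Rightarrow> 'k\<close> vanishing outside \<open>{1..n}\<close>, so that
  \<open>\<K>\<^sup>m \<subseteq> \<K>\<^sup>n\<close> for \<open>m \<le> n\<close>.
  Below, \<open>basis_sum m a\<close> is \<open>\<Sum>\<^bsub>i\<le>m\<^esub> a\<^sub>i e\<^sub>i\<close>. Norms and seminorms on \<open>\<K>\<^sup>n\<close> are
  functions whose values outside \<open>\<K>\<^sup>n\<close> are irrelevant.\<close>

definition coord_space :: "nat \<Rightarrow> (nat \<Rightarrow> 'k::zero) set" where
  "coord_space n = {a. \<forall>i. i \<notin> {1..n} \<longrightarrow> a i = 0}"

definition basis_vec :: "nat \<Rightarrow> nat \<Rightarrow> 'k::zero_neq_one" where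
  "basis_vec i = (\<lambda>j. if j = i then 1 else 0)"

definition basis_sum :: "nat \<Rightarrow> (nat \<Rightarrow> 'k::comm_ring_1) \<Rightarrow> nat \<Rightarrow> 'k" where
  "basis_sum m a = (\<lambda>j. \<Sum>i=1..m. a i * basis_vec i j)"

definition seminorm_on_coord :: "nat \<Rightarrow> ((nat \<Rightarrow> 'k::real_normed_field) \<Rightarrow> real) \<Rightarrow> bool" where
  "seminorm_on_coord n \<rho> \<longleftrightarrow>
     (\<forall>a\<in>coord_space n. 0 \<le> \<rho> a) \<and>
     (\<forall>a\<in>coord_space n. \<forall>b\<in>coord_space n. \<rho> (\<lambda>i. a i + b i) \<le> \<rho> a + \<rho> b) \<and>
     (\<forall>c. \<forall>a\<in>coord_space n. \<rho> (\<lambda>i. c * a i) = norm c * \<rho> a)"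

definition norm_on_coord :: "nat \<Rightarrow> ((nat \<Rightarrow> 'k::real_normed_field) \<Rightarrow> real) \<Rightarrow> bool" where
  "norm_on_coord n r \<longleftrightarrow>
     seminorm_on_coord n r \<and> (\<forall>a\<in>coord_space n. r a = 0 \<longrightarrow> a = (\<lambda>_. 0))"

text \<open>The norm of \<open>\<ell>\<^sub>p\<^sup>n\<close>, for \<open>p \<in> [1, \<infinity>]\<close> and \<open>n \<ge> 1\<close>.\<close>

definition lp_norm :: "ennreal \<Rightarrow> nat \<Rightarrow> (nat \<Rightarrow> 'k::real_normed_vector) \<Rightarrow> real" where
  "lp_norm p n a =
     (if p = \<infinity> then MAX i\<in>{1..n}. norm (a i)
      else (\<Sum>i=1..n. norm (a i) powr enn2real p) powr (1 / enn2real p))"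

section \<open>Asymptotic structures\<close>

definition tree_approximates ::
  "('k::real_or_complex \<Rightarrow> 'v \<Rightarrow> 'v) \<Rightarrow> ('v::real_normed_vector \<Rightarrow> 'w::real_normed_vector) \<Rightarrow> 'd set \<Rightarrow> nat \<Rightarrow>
   real \<Rightarrow> ('d list \<Rightarrow> 'v) \<Rightarrow> ((nat \<Rightarrow> 'k) \<Rightarrow> real) \<Rightarrow> ((nat \<Rightarrow> 'k) \<Rightarrow> real) \<Rightarrow> bool" where
  "tree_approximates smul T D n \<delta> x r \<rho> \<longleftrightarrow>
     (\<forall>t\<in>lists D. length t = n \<longrightarrow> (\<forall>a. (\<forall>i\<in>{1..n}. norm (a i) \<le> 1) \<longrightarrow>
        \<bar>norm (\<Sum>i=1..n. smul (a i) (x (take i t))) - r (basis_sum n a)\<bar> < \<delta> \<and>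
        \<bar>norm (T (\<Sum>i=1..n. smul (a i) (x (take i t)))) - \<rho> (basis_sum n a)\<bar> < \<delta>))"

text \<open>The common part of the two asymptotic structures: \<open>S\<close> is the space in which the trees live,
  \<open>\<Phi>\<close> a family of functionals inducing the relevant topology on it, and \<open>T\<close> the operator.

  The definition quantifies over all directed sets, of any size, which has to be
  replaced by directed subsets of some type. The type \<open>'v set\<close> is large enough, as it contains
  a base of neighbourhoods of 0; lemma \<open>tree_on_arbitrary_directed_set\<close> below shows that
  trees over directed sets in other types lead to nothing new.\<close>

definition asymptotic_pairs ::
  "'v::real_normed_vector set \<Rightarrow> ('k::real_or_complex \<Rightarrow> 'v \<Rightarrow> 'v) \<Rightarrow> ('v \<Rightarrow> 'k) set \<Rightarrow>
   ('v \<Rightarrow> 'w::real_normed_vector) \<Rightarrow> nat \<Rightarrow> (((nat \<Rightarrow> 'k) \<Rightarrow> real) \<times> ((nat \<Rightarrow> 'k) \<Rightarrow> real)) set" where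
  "asymptotic_pairs S smul \<Phi> T n = {(r, \<rho>).
     norm_on_coord n r \<and> seminorm_on_coord n \<rho> \<and>
     (\<forall>i\<in>{1..n}. r (basis_vec i) = 1) \<and>
     (\<forall>a. \<forall>m\<le>n. r (basis_sum m a) \<le> r (basis_sum n a) \<and> \<rho> (basis_sum m a) \<le> \<rho> (basis_sum n a)) \<and>
     (\<forall>a\<in>coord_space n. \<rho> a \<le> onorm_on S T * r a) \<and>
     (\<forall>\<delta>>0. \<exists>(D :: 'v set set) le x. directed D le \<and>
        normalized_tree S D n x \<and> null_tree \<Phi> D le n x \<and> tree_approximates smul T D n \<delta> x r \<rho>)}"

lemma tree_on_arbitrary_directed_set:
  fixes D :: "'d set" and \<Phi> :: "('v::real_normed_vector \<Rightarrow> 'k::real_or_complex) set"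
  assumes dir: "directed D le" and norm: "normalized_tree S D n x"
    and null: "null_tree \<Phi> D le n x" and appr: "tree_approximates smul T D n \<delta> x r \<rho>"
  shows "\<exists>(D' :: 'v set set) le' x'. directed D' le' \<and>
    normalized_tree S D' n x' \<and> null_tree \<Phi> D' le' n x' \<and> tree_approximates smul T D' n \<delta> x' r \<rho>"
proof -
  define nb where "nb P \<epsilon> = {w. \<forall>\<phi>\<in>P. norm (\<phi> w) < \<epsilon>}" for P :: "('v \<Rightarrow> 'k) set" and \<epsilon> :: real
  define D' where "D' = {nb P \<epsilon> |P \<epsilon>. finite P \<and> P \<subseteq> \<Phi> \<and> \<epsilon> > 0}"
  define le' where "le' = (\<lambda>U V :: 'v set. V \<subseteq> U)"
  have dir': "directed D' le'"
    unfolding directed_def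
  proof (intro conjI ballI)
    have "nb {} 1 \<in> D'" unfolding D'_def by (blast intro: zero_less_one)
    then show "D' \<noteq> {}" by blast
  next
    fix U V assume "U \<in> D'" "V \<in> D'"
    then obtain P \<epsilon> Q \<delta> where *: "U = nb P \<epsilon>" "V = nb Q \<delta>" "finite P" "finite Q" "P \<subseteq> \<Phi>" "Q \<subseteq> \<Phi>" "\<epsilon> > 0" "\<delta> > 0"
      unfolding D'_def by blast
    have "nb (P \<union> Q) (min \<epsilon> \<delta>) \<in> D'"
      unfolding D'_def using * by (intro CollectI exI[of _ "P \<union> Q"] exI[of _ "min \<epsilon> \<delta>"]) auto
    moreover have "nb (P \<union> Q) (min \<epsilon> \<delta>) \<subseteq> U" "nb (P \<union> Q) (min \<epsilon> \<delta>) \<subseteq> V"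
      using * by (auto simp: nb_def)
    ultimately show "\<exists>W\<in>D'. le' U W \<and> le' V W" unfolding le'_def by blast
  qed (auto simp: le'_def)
  have ev_net: "eventually Q (net_filter E l) \<longleftrightarrow> (\<exists>u\<in>E. \<forall>v\<in>E. l u v \<longrightarrow> Q v)"
    if d: "directed E l" for E :: "'e set" and l Q
  proof -
    have "eventually Q (net_filter E l) \<longleftrightarrow> (\<exists>u\<in>E. eventually Q (principal {v\<in>E. l u v}))"
      unfolding net_filter_def
    proof (rule eventually_INF_base)
      show "E \<noteq> {}" using d by (simp add: directed_def)
      fix a b assume ab: "a \<in> E" "b \<in> E"
      then obtain w where w: "w \<in> E" "l a w" "l b w" using d unfolding directed_def by blast
      have "\<forall>v\<in>E. l w v \<longrightarrow> l a v \<and> l b v"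
        using d w ab unfolding directed_def by blast
      then show "\<exists>x\<in>E. principal {v \<in> E. l x v} \<le> inf (principal {v \<in> E. l a v}) (principal {v \<in> E. l b v})"
        using w by (intro bexI[of _ w]) (auto simp: inf_principal)
    qed
    then show ?thesis by (auto simp: eventually_principal)
  qed
  have ch: "\<exists>u\<in>D. length s < n \<longrightarrow> x (s @ [u]) \<in> U" if s: "s \<in> lists D" and U: "U \<in> D'" for s U
  proof (cases "length s < n")
    case True
    obtain P \<epsilon> where P: "U = nb P \<epsilon>" "finite P" "P \<subseteq> \<Phi>" "\<epsilon> > 0" using U unfolding D'_def by blast
    have "eventually (\<lambda>u. norm (\<phi> (x (s @ [u]))) < \<epsilon>) (net_filter D le)" if "\<phi> \<in> P" for \<phi>
    proof -
      have "((\<lambda>u. \<phi> (x (s @ [u]))) \<longlongrightarrow> 0) (net_filter D le)"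
        using null s True that P unfolding null_tree_def null_net_def by blast
      then show ?thesis using P(4) by (auto simp: tendsto_iff)
    qed
    then have "eventually (\<lambda>u. \<forall>\<phi>\<in>P. norm (\<phi> (x (s @ [u]))) < \<epsilon>) (net_filter D le)"
      using P(2) by (simp add: eventually_ball_finite_distrib)
    then obtain u where u: "u \<in> D" "\<forall>v\<in>D. le u v \<longrightarrow> (\<forall>\<phi>\<in>P. norm (\<phi> (x (s @ [v]))) < \<epsilon>)"
      using ev_net[OF dir] by auto
    have "le u u" using dir u(1) unfolding directed_def by blast
    then have "x (s @ [u]) \<in> U" using u by (simp add: P(1) nb_def)
    then show ?thesis using u(1) by blast
  next
    case False
    moreover have "D \<noteq> {}" using dir unfolding directed_def by blast
    ultimately show ?thesis by blast
  qed
  define c where "c s U = (SOME u. u \<in> D \<and> (length s < n \<longrightarrow> x (s @ [u]) \<in> U))" for s U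
  have c: "c s U \<in> D \<and> (length s < n \<longrightarrow> x (s @ [c s U]) \<in> U)" if "s \<in> lists D" "U \<in> D'" for s U
    unfolding c_def by (rule someI_ex) (use ch[OF that] in blast)
  define h where "h = foldl (\<lambda>s U. s @ [c s U]) []"
  have h_snoc: "h (t @ [U]) = h t @ [c (h t) U]" for t U by (simp add: h_def)
  have h_nil: "h [] = []" by (simp add: h_def)
  have h_len: "length (h t) = length t" for t
    by (induction t rule: rev_induct) (simp_all add: h_snoc h_nil)
  have h_in: "h t \<in> lists D" if "t \<in> lists D'" for t
    using that
  proof (induction t rule: rev_induct)
    case (snoc U t)
    then show ?case using c[of "h t" U] by (simp add: h_snoc)
  qed (simp add: h_nil)
  have h_take: "h (take i t) = take i (h t)" for i t
  proof (induction t rule: rev_induct)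
    case (snoc U t)
    then show ?case by (cases "i \<le> length t") (simp_all add: h_snoc h_len)
  qed (simp add: h_nil)
  define x' where "x' t = x (h t)" for t
  have "normalized_tree S D' n x'"
    using norm h_in unfolding normalized_tree_def x'_def by (simp add: h_len)
  moreover have "tree_approximates smul T D' n \<delta> x' r \<rho>"
    using appr h_in unfolding tree_approximates_def x'_def by (simp add: h_len h_take)
  moreover have "null_tree \<Phi> D' le' n x'"
    unfolding null_tree_def null_net_def tendsto_iff
  proof (intro ballI impI allI)
    fix t \<phi> and \<epsilon> :: real assume t: "t \<in> lists D'" "length t < n" and \<phi>: "\<phi> \<in> \<Phi>" and \<epsilon>: "0 < \<epsilon>"
    have nb: "nb {\<phi>} \<epsilon> \<in> D'" unfolding D'_def using \<phi> \<epsilon> by blast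
    have "norm (\<phi> (x' (t @ [V]))) < \<epsilon>" if "V \<in> D'" "V \<subseteq> nb {\<phi>} \<epsilon>" for V
    proof -
      have "x' (t @ [V]) \<in> V" using c[OF h_in[OF t(1)] that(1)] t(2) by (simp add: x'_def h_snoc h_len)
      then show ?thesis using that by (auto simp: nb_def)
    qed
    then show "eventually (\<lambda>u. dist (\<phi> (x' (t @ [u]))) 0 < \<epsilon>) (net_filter D' le')"
      using nb unfolding ev_net[OF dir'] by (intro bexI[of _ "nb {\<phi>} \<epsilon>"]) (auto simp: le'_def)
  qed
  ultimately show ?thesis using dir' by blast
qed

definition asymptotic_structure ::
  "('k::real_or_complex \<Rightarrow> 'x \<Rightarrow> 'x) \<Rightarrow> ('x::banach \<Rightarrow>\<^sub>L 'y::banach) \<Rightarrow> nat \<Rightarrow>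
   (((nat \<Rightarrow> 'k) \<Rightarrow> real) \<times> ((nat \<Rightarrow> 'k) \<Rightarrow> real)) set" where
  "asymptotic_structure scaleX A n =
     (if finite_dim scaleX then {}
      else asymptotic_pairs UNIV scaleX (weak_functionals scaleX) (blinfun_apply A) n)"

definition weakstar_asymptotic_structure ::
  "('k::real_or_complex \<Rightarrow> 'y \<Rightarrow> 'y) \<Rightarrow> ('x::banach \<Rightarrow>\<^sub>L 'y::banach) \<Rightarrow> nat \<Rightarrow>
   (((nat \<Rightarrow> 'k) \<Rightarrow> real) \<times> ((nat \<Rightarrow> 'k) \<Rightarrow> real)) set" where
  "weakstar_asymptotic_structure scaleY A n =
     (if finite_dim scaleY then {}
      else asymptotic_pairs (dual scaleY) dual_scale weakstar_functionals (adjoint_op A) n)"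

section \<open>Basic type, subtype, cotype and subcotype\<close>

definition alpha ::
  "('k::real_or_complex \<Rightarrow> 'x \<Rightarrow> 'x) \<Rightarrow> ennreal \<Rightarrow> nat \<Rightarrow> ('x::banach \<Rightarrow>\<^sub>L 'y::banach) \<Rightarrow> ennreal" where
  "alpha scaleX p n A = Inf {ennreal T | T. T > 0 \<and>
     (\<forall>(r, \<rho>) \<in> asymptotic_structure scaleX A n. \<forall>a. \<rho> (basis_sum n a) \<le> T * lp_norm p n a)}"

definition theta ::
  "('k::real_or_complex \<Rightarrow> 'x \<Rightarrow> 'x) \<Rightarrow> nat \<Rightarrow> ('x::banach \<Rightarrow>\<^sub>L 'y::banach) \<Rightarrow> ennreal" where
  "theta scaleX n A = Inf {ennreal T | T. T > 0 \<and>
     (\<forall>(r, \<rho>) \<in> asymptotic_structure scaleX A n. \<forall>a.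
        \<rho> (\<lambda>j. 1 / of_nat n * basis_sum n a j) \<le> T * (MAX i\<in>{1..n}. norm (a i)))}"

definition beta_star ::
  "('k::real_or_complex \<Rightarrow> 'y \<Rightarrow> 'y) \<Rightarrow> ennreal \<Rightarrow> nat \<Rightarrow> ('x::banach \<Rightarrow>\<^sub>L 'y::banach) \<Rightarrow> ennreal" where
  "beta_star scaleY q n A = Inf {ennreal C | C. C > 0 \<and>
     (\<forall>(r, \<rho>) \<in> weakstar_asymptotic_structure scaleY A n. \<forall>a.
        C * r (basis_sum n a) \<ge> lp_norm q n (\<lambda>i. a i * of_real (\<rho> (basis_vec i))))}"

definition upsilon_star ::
  "('k::real_or_complex \<Rightarrow> 'y \<Rightarrow> 'y) \<Rightarrow> nat \<Rightarrow> ('x::banach \<Rightarrow>\<^sub>L 'y::banach) \<Rightarrow> ennreal" where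
  "upsilon_star scaleY n A = Inf {ennreal C | C. C > 0 \<and>
     (\<forall>(r, \<rho>) \<in> weakstar_asymptotic_structure scaleY A n. \<forall>a.
        C * r (basis_sum n a) \<ge> (MIN i\<in>{1..n}. norm (a i * of_real (\<rho> (basis_vec i)))))}"

definition asymptotic_basic_type ::
  "('k::real_or_complex \<Rightarrow> 'x \<Rightarrow> 'x) \<Rightarrow> ennreal \<Rightarrow> ('x::banach \<Rightarrow>\<^sub>L 'y::banach) \<Rightarrow> bool" where
  "asymptotic_basic_type scaleX p A \<longleftrightarrow> (SUP n\<in>{1..}. alpha scaleX p n A) < \<infinity>"

definition asymptotic_basic_subtype ::
  "('k::real_or_complex \<Rightarrow> 'x \<Rightarrow> 'x) \<Rightarrow> ('x::banach \<Rightarrow>\<^sub>L 'y::banach) \<Rightarrow> bool" where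
  "asymptotic_basic_subtype scaleX A \<longleftrightarrow> (\<lambda>n. theta scaleX n A) \<longlonglongrightarrow> 0"

text \<open>The next two are properties of the adjoint of \<open>A\<close>, expressed in terms of \<open>A\<close>.\<close>

definition weakstar_asymptotic_basic_cotype ::
  "('k::real_or_complex \<Rightarrow> 'y \<Rightarrow> 'y) \<Rightarrow> ennreal \<Rightarrow> ('x::banach \<Rightarrow>\<^sub>L 'y::banach) \<Rightarrow> bool" where
  "weakstar_asymptotic_basic_cotype scaleY q A \<longleftrightarrow> (SUP n\<in>{1..}. beta_star scaleY q n A) < \<infinity>"

definition weakstar_asymptotic_basic_subcotype ::
  "('k::real_or_complex \<Rightarrow> 'y \<Rightarrow> 'y) \<Rightarrow> ('x::banach \<Rightarrow>\<^sub>L 'y::banach) \<Rightarrow> bool" where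
  "weakstar_asymptotic_basic_subcotype scaleY A \<longleftrightarrow> (\<lambda>n. upsilon_star scaleY n A) \<longlonglongrightarrow> 0"

end

theory Submission
  imports Defs
begin

text \<open>The two directions have the same shape. A finite sequence of vectors produced by one tree is
  matched with a finite sequence of functionals that is, up to small errors, biorthogonal to it through \<open>A\<close>;
  the matching sequence comes from a tree on the other side, and a compactness argument turns that tree into a
  member of the other asymptotic structure. The claimed inequalities then are Hoelder's inequality
  for a pairing \<open>\<langle>\<Sum>\<^sub>i a\<^sub>i f\<^sub>i, A \<Sum>\<^sub>i b\<^sub>i x\<^sub>i\<rangle>\<close>.

  Trees and directed sets enter only through iterated limits. Let \<open>G\<close> be the filter of
  neighbourhoods of 0 (weak or weak*) restricted to the unit sphere, and let \<open>tree_filter G n\<close> be its \<open>n\<close>-fold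
  iterate, a filter on lists of length \<open>n\<close>. A normalized null tree all of whose branches
  satisfy \<open>P\<close> exists if and only if \<open>P\<close> holds frequently in \<open>tree_filter G n\<close>
  (\<open>frequently_tree_filter_if_tree\<close>, \<open>tree_if_frequently_tree_filter\<close>). Frequently distributes over
  finite disjunctions, so passing to subtrees, stabilizing norms and colouring branches all reduce to
  compactness. In particular, whenever \<open>P\<close> holds frequently, some pair \<open>(r, \<rho>)\<close> of the asymptotic structure is
  approximated frequently along branches that satisfy \<open>P\<close> (\<open>asymptotic_pair_exists\<close>).

  From \<open>A\<close> to \<open>A*\<close>: let \<open>(r, \<rho>)\<close> be a weak* pair. Along a weak*-null tree \<open>(f\<^sub>i)\<close>
  one chooses unit vectors \<open>x\<^sub>i\<close>, weakly small, with \<open>\<bar>f\<^sub>i (A x\<^sub>i)\<bar>\<close> almost at least half of \<open>\<parallel>A* f\<^sub>i\<parallel>\<close> and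
  \<open>f\<^sub>i (A x\<^sub>j)\<close> small for \<open>i \<noteq> j\<close> (\<open>almost_norming_vector_step\<close>). Here \<open>x\<^sub>i\<close> is the normalized difference of a
  vector almost norming \<open>A* f\<^sub>i\<close> and of one of finitely many vectors fixed before \<open>f\<^sub>i\<close>; this difference costs the
  factor 2. The result is \<open>\<Sum>\<^sub>i \<bar>a\<^sub>i b\<^sub>i\<bar> \<rho>(e\<^sub>i) \<le> 2 r(a) \<rho>'(b') + \<eta>\<close> with \<open>(r', \<rho>')\<close> in the structure of \<open>A\<close>
  and \<open>\<bar>b'\<^sub>i\<bar> = \<bar>b\<^sub>i\<bar>\<close> (\<open>weakstar_pair_dominated\<close>).

  From \<open>A*\<close> to \<open>A\<close>: let \<open>(x\<^sub>i)\<close> be a branch of a weakly null tree and \<open>g\<close> a functional of norm at most 1 chosen for the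
  whole branch. The dual ball is weak* compact, so \<open>g\<close> has iterated cluster points \<open>g\<^sub>0, \<dots>, g\<^sub>n\<close>, where \<open>g\<^sub>i\<close> depends only
  on the first \<open>i\<close> vectors. The differences \<open>g\<^sub>i - g\<^bsub>i-1\<^esub>\<close> form a weak*-null tree, their sum has norm at most
  2, and \<open>g (A x\<^sub>i)\<close> is almost \<open>(g\<^sub>i - g\<^bsub>i-1\<^esub>) (A x\<^sub>i)\<close>. Writing the differences as \<open>l\<^sub>i w\<^sub>i\<close>
  with unit functionals \<open>w\<^sub>i\<close>, one obtains a weak* pair \<open>(r, \<rho>)\<close> with \<open>r(l) \<le> 3\<close> and
  \<open>\<bar>g (A x\<^sub>i)\<bar> \<le> \<bar>l\<^sub>i\<bar> \<rho>(e\<^sub>i) + \<eta>\<close> (\<open>weakstar_pair_from_functionals\<close>). With \<open>g\<close> norming the image of a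
  combination this gives the statement about type. For subtype, a large mean of the numbers \<open>\<bar>g (A x\<^sub>i)\<bar>\<close> forces
  a fixed proportion of them to be large, and the branch is cut down to the coordinates where they are.

  If \<open>X\<close> or \<open>Y\<close> is finite-dimensional, one structure is empty and in the other one \<open>\<rho>\<close> vanishes.\<close>

notation blinfun_apply (infixl "\<cdot>" 999)

section \<open>The scalar field\<close>

lemma scalar_rotation:
  fixes z :: "'k::real_normed_field"
  obtains c where "norm c = 1" "c * z = of_real (norm z)"
proof (cases "z = 0")
  case True
  then show ?thesis using that[of 1] by simp
next
  case False
  then show ?thesis using that[of "of_real (norm z) / z"] by (simp add: norm_divide)
qed

lemma scalar_embedding:
  obtains \<iota> :: "'k::real_or_complex \<Rightarrow> complex"
  where "\<And>x y. \<iota> (x + y) = \<iota> x + \<iota> y" "\<And>x y. \<iota> (x * y) = \<iota> x * \<iota> y"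
    "\<And>c. \<iota> (of_real c) = of_real c" "\<And>x. norm (\<iota> x) = norm x" "inj \<iota>"
    "range \<iota> = \<real> \<or> range \<iota> = UNIV"
proof -
  obtain \<iota> :: "'k \<Rightarrow> complex" where \<iota>: "\<And>x y. \<iota> (x + y) = \<iota> x + \<iota> y" "\<And>x y. \<iota> (x * y) = \<iota> x * \<iota> y"
    "\<And>c x. \<iota> (c *\<^sub>R x) = c *\<^sub>R \<iota> x" "\<And>x. norm (\<iota> x) = norm x" "range \<iota> = \<real> \<or> range \<iota> = UNIV"
    using real_or_complex[where 'a = 'k] by blast
  have "\<iota> 1 * \<iota> 1 = \<iota> 1 * 1" using \<iota>(2)[of 1 1] by simp
  moreover have "\<iota> 1 \<noteq> 0" using \<iota>(4)[of 1] by auto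
  ultimately have one: "\<iota> 1 = 1" by (metis mult_left_cancel)
  have real: "\<iota> (of_real c) = of_real c" for c
    using \<iota>(3)[of c 1] by (simp add: of_real_def one)
  have "inj \<iota>"
  proof (rule injI)
    fix x y assume "\<iota> x = \<iota> y"
    moreover have "\<iota> (x + (-1) *\<^sub>R y) = \<iota> x + (-1) *\<^sub>R \<iota> y" by (simp only: \<iota>(1,3))
    ultimately have "norm (\<iota> (x - y)) = 0" by simp
    then show "x = y" unfolding \<iota>(4) by simp
  qed
  then show ?thesis using that \<iota> real by blast
qed

text \<open>A complex Hahn--Banach extension is obtained from a real one with the help of an imaginary unit \<open>j\<close>. The third
  property of \<open>j\<close> says that the real part is dominated by the norm.\<close>

lemma scalar_cases:
  obtains (real) "\<And>c :: 'k::real_or_complex. \<exists>a. c = of_real a"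
  | (complex) j :: "'k::real_or_complex" where "j * j = -1" "\<And>c. \<exists>a b. c = of_real a + of_real b * j"
    "\<And>a b. \<bar>a\<bar> \<le> norm (of_real a + of_real b * j)"
proof -
  obtain \<iota> :: "'k \<Rightarrow> complex" where \<iota>: "\<And>x y. \<iota> (x + y) = \<iota> x + \<iota> y" "\<And>x y. \<iota> (x * y) = \<iota> x * \<iota> y"
    "\<And>c. \<iota> (of_real c) = of_real c" "\<And>x. norm (\<iota> x) = norm x" "inj \<iota>"
    "range \<iota> = \<real> \<or> range \<iota> = UNIV"
    by (rule scalar_embedding, rule that)
  from \<iota>(6) show ?thesis
  proof
    assume r: "range \<iota> = \<real>"
    have "\<exists>a. c = of_real a" for c :: 'k
    proof -
      have "\<iota> c \<in> \<real>" using r by blast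
      then obtain a where "\<iota> c = of_real a" by (auto elim: Reals_cases)
      then have "\<iota> c = \<iota> (of_real a)" by (simp add: \<iota>(3))
      then have "c = of_real a" using \<iota>(5) by (simp add: inj_eq)
      then show ?thesis by blast
    qed
    then show ?thesis by (rule real)
  next
    assume r: "range \<iota> = UNIV"
    then have "\<i> \<in> range \<iota>" by simp
    then obtain j where j: "\<iota> j = \<i>" by (metis imageE)
    have "\<iota> (j * j) = \<iota> (-1)" using j \<iota>(2)[of j j] \<iota>(3)[of "-1"] by simp
    then have "j * j = -1" using \<iota>(5) by (simp add: inj_eq)
    moreover have "\<exists>a b. c = of_real a + of_real b * j" for c
    proof -
      have "\<iota> (of_real (Re (\<iota> c)) + of_real (Im (\<iota> c)) * j) = \<iota> c"
        by (simp add: \<iota>(1-3) j complex_eq_iff)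
      then have "of_real (Re (\<iota> c)) + of_real (Im (\<iota> c)) * j = c" using \<iota>(5) by (simp add: inj_eq)
      then show ?thesis by metis
    qed
    moreover have "\<bar>a\<bar> \<le> norm (of_real a + of_real b * j)" for a b
    proof -
      have "norm (of_real a + of_real b * j) = norm (of_real a + of_real b * \<i>)"
        unfolding \<iota>(4)[symmetric, of "of_real a + of_real b * j"] by (simp add: \<iota>(1-3) j)
      then show ?thesis using abs_Re_le_cmod[of "of_real a + of_real b * \<i>"] by simp
    qed
    ultimately show ?thesis by (rule complex)
  qed
qed

lemma compact_scalar_cball: "compact (cball (0 :: 'k::real_or_complex) d)"
proof -
  obtain \<iota> :: "'k \<Rightarrow> complex" where \<iota>: "\<And>x y. \<iota> (x + y) = \<iota> x + \<iota> y" "\<And>x y. \<iota> (x * y) = \<iota> x * \<iota> y"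
    "\<And>c. \<iota> (of_real c) = of_real c" "\<And>x. norm (\<iota> x) = norm x" "inj \<iota>"
    "range \<iota> = \<real> \<or> range \<iota> = UNIV"
    by (rule scalar_embedding, rule that)
  have diff: "\<iota> (x - y) = \<iota> x - \<iota> y" for x y
    using \<iota>(1)[of "x - y" y] by simp
  have "closed (range \<iota>)" using \<iota>(6) closed_complex_Reals by auto
  then have "compact (cball 0 d \<inter> range \<iota>)" by (intro compact_Int_closed) auto
  also have "cball 0 d \<inter> range \<iota> = \<iota> ` cball 0 d" using \<iota>(4) by (auto simp: image_iff)
  finally have c: "compact (\<iota> ` cball 0 d)" .
  have "continuous_on (range \<iota>) (inv \<iota>)"
    unfolding continuous_on_iff
  proof (intro ballI allI impI)
    fix x and e :: real assume "x \<in> range \<iota>" "0 < e"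
    moreover have "dist (inv \<iota> y') (inv \<iota> x') = dist y' x'" if "y' \<in> range \<iota>" "x' \<in> range \<iota>" for x' y'
      using that \<iota>(4,5) by (auto simp: dist_norm inv_f_f diff[symmetric])
    ultimately show "\<exists>d>0. \<forall>x'\<in>range \<iota>. dist x' x < d \<longrightarrow> dist (inv \<iota> x') (inv \<iota> x) < e"
      by (intro exI[of _ e]) simp
  qed
  then have "continuous_on (\<iota> ` cball 0 d) (inv \<iota>)" by (rule continuous_on_subset) auto
  then have "compact (inv \<iota> ` (\<iota> ` cball 0 d))" using c by (rule compact_continuous_image)
  then show ?thesis using \<iota>(5) by (simp add: image_image inv_f_f)
qed

section \<open>Compactness\<close>

lemma compact_product:
  fixes X :: "'i \<Rightarrow> 'a::topological_space set"
  assumes "\<And>i. compact (X i)"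
  shows "compact {f. \<forall>i. f i \<in> X i}"
proof -
  have "compactin (product_topology (\<lambda>_. euclidean) UNIV) (PiE UNIV X)"
    using assms by (simp add: compactin_PiE)
  moreover have "PiE UNIV X = {f. \<forall>i. f i \<in> X i}" by auto
  ultimately show ?thesis by (simp add: euclidean_product_topology)
qed

text \<open>If every point of \<open>K\<close> had a neighbourhood in which \<open>Q\<close> eventually has no witness, finitely many of
  them would cover \<open>K\<close>, and \<open>Q\<close> would eventually have no witness in \<open>K\<close>.\<close>

lemma frequently_compact_cluster:
  fixes K :: "'a::topological_space set"
  assumes K: "compact K" and fr: "frequently (\<lambda>x. \<exists>g\<in>K. Q x g) F"
  obtains g where "g \<in> K" "\<And>V. open V \<Longrightarrow> g \<in> V \<Longrightarrow> frequently (\<lambda>x. \<exists>h\<in>K \<inter> V. Q x h) F"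
proof (rule ccontr)
  assume "\<not> thesis"
  then have "\<forall>g\<in>K. \<exists>V. open V \<and> g \<in> V \<and> eventually (\<lambda>x. \<not> (\<exists>h\<in>K \<inter> V. Q x h)) F"
    using that unfolding not_frequently[symmetric] by blast
  from bchoice[OF this] obtain V where V: "\<And>g. g \<in> K \<Longrightarrow> open (V g)" "\<And>g. g \<in> K \<Longrightarrow> g \<in> V g"
    "\<And>g. g \<in> K \<Longrightarrow> eventually (\<lambda>x. \<not> (\<exists>h\<in>K \<inter> V g. Q x h)) F"
    by blast
  have "K \<subseteq> \<Union> (V ` K)" using V(2) by blast
  with K V(1) obtain C where C: "C \<subseteq> K" "finite C" "K \<subseteq> \<Union> (V ` C)"
    by (rule compactE_image)
  have "eventually (\<lambda>x. \<forall>g\<in>C. \<not> (\<exists>h\<in>K \<inter> V g. Q x h)) F"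
    using C(1,2) V(3) by (auto simp: eventually_ball_finite_distrib)
  then have "eventually (\<lambda>x. \<not> (\<exists>g\<in>K. Q x g)) F"
    by (rule eventually_mono) (use C(3) in blast)
  with fr show False by (simp add: frequently_def)
qed

section \<open>The Hahn--Banach theorem\<close>

definition sublinear :: "('v::real_vector \<Rightarrow> real) \<Rightarrow> bool" where
  "sublinear p \<longleftrightarrow> p 0 = 0 \<and> (\<forall>x y. p (x + y) \<le> p x + p y) \<and> (\<forall>t>0. \<forall>x. p (t *\<^sub>R x) \<le> t * p x)"

lemma sublinear_scale:
  assumes "sublinear p" "0 \<le> t" shows "p (t *\<^sub>R x) = t * p x"
proof (cases "t = 0")
  case False
  then have t: "t > 0" using assms by simp
  have "p x \<le> inverse t * p (t *\<^sub>R x)"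
  proof -
    have "p (inverse t *\<^sub>R (t *\<^sub>R x)) \<le> inverse t * p (t *\<^sub>R x)"
      using assms(1) t positive_imp_inverse_positive unfolding sublinear_def by blast
    then show ?thesis using t by simp
  qed
  then have "t * p x \<le> p (t *\<^sub>R x)" using t by (simp add: field_simps)
  moreover have "p (t *\<^sub>R x) \<le> t * p x" using assms(1) t by (auto simp: sublinear_def)
  ultimately show ?thesis by simp
qed (use assms in \<open>simp add: sublinear_def\<close>)

text \<open>The modified functional \<open>q\<close> is the reason why minimal sublinear functionals are linear: minimality
  forces \<open>q = p\<close>, and the last inequality then becomes superadditivity of \<open>p\<close>.\<close>

lemma sublinear_shift:
  fixes p :: "'v::real_vector \<Rightarrow> real" and v :: 'v
  assumes p: "sublinear p"
  defines "q \<equiv> \<lambda>x. INF t\<in>{0..}. p (x + t *\<^sub>R v) - t * p v"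
  shows "sublinear q" "q x \<le> p x" "q x \<le> p (x + v) - p v"
proof -
  have add: "p (x + y) \<le> p x + p y" for x y using p by (simp add: sublinear_def)
  have low: "- p (- x) \<le> p (x + t *\<^sub>R v) - t * p v" if "t \<ge> 0" for x t
    using add[of "x + t *\<^sub>R v" "- x"] sublinear_scale[OF p that, of v] by simp
  have bdd: "bdd_below ((\<lambda>t. p (x + t *\<^sub>R v) - t * p v) ` {0..})" for x
    using low[of _ x] by (intro bdd_belowI2[where m = "- p (- x)"]) auto
  have le: "q x \<le> p (x + t *\<^sub>R v) - t * p v" if "t \<ge> 0" for x t
    unfolding q_def using that by (intro cINF_lower bdd) auto
  show "q x \<le> p x" using le[of 0] by simp
  show "q x \<le> p (x + v) - p v" using le[of 1] by simp
  have greatest: "c \<le> q x" if "\<And>t. t \<ge> 0 \<Longrightarrow> c \<le> p (x + t *\<^sub>R v) - t * p v" for c x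
    unfolding q_def using that by (intro cINF_greatest) auto
  have "q (x + y) \<le> q x + q y" for x y
  proof -
    have "q (x + y) - (p (x + s *\<^sub>R v) - s * p v) \<le> q y" if s: "s \<ge> 0" for s
    proof (rule greatest)
      fix t :: real assume t: "t \<ge> 0"
      have "q (x + y) \<le> p ((x + s *\<^sub>R v) + (y + t *\<^sub>R v)) - (s + t) * p v"
        using le[of "s + t" "x + y"] s t by (simp add: algebra_simps)
      then show "q (x + y) - (p (x + s *\<^sub>R v) - s * p v) \<le> p (y + t *\<^sub>R v) - t * p v"
        using add[of "x + s *\<^sub>R v" "y + t *\<^sub>R v"] by (simp add: algebra_simps)
    qed
    then have "q (x + y) - q y \<le> p (x + s *\<^sub>R v) - s * p v" if "s \<ge> 0" for s using that by (simp add: algebra_simps)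
    then have "q (x + y) - q y \<le> q x" by (rule greatest)
    then show ?thesis by simp
  qed
  moreover have "q (t *\<^sub>R x) \<le> t * q x" if t: "t > 0" for t x
  proof -
    have "q (t *\<^sub>R x) / t \<le> p (x + s *\<^sub>R v) - s * p v" if s: "s \<ge> 0" for s
    proof -
      have "q (t *\<^sub>R x) \<le> p (t *\<^sub>R (x + s *\<^sub>R v)) - t * s * p v"
        using le[of "t * s" "t *\<^sub>R x"] s t by (simp add: algebra_simps)
      also have "p (t *\<^sub>R (x + s *\<^sub>R v)) = t * p (x + s *\<^sub>R v)"
        using t by (intro sublinear_scale[OF p]) simp
      finally show ?thesis using t by (simp add: field_simps)
    qed
    then have "q (t *\<^sub>R x) / t \<le> q x" by (rule greatest)
    then show ?thesis using t by (simp add: field_simps)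
  qed
  moreover have "q 0 = 0"
  proof -
    have "0 \<le> q 0" using sublinear_scale[OF p, of _ v] by (intro greatest) simp
    moreover have "q 0 \<le> 0" using le[of 0 0] p by (simp add: sublinear_def)
    ultimately show ?thesis by simp
  qed
  ultimately show "sublinear q" by (simp add: sublinear_def)
qed

lemma minimal_sublinear_exists:
  fixes p :: "'v::real_vector \<Rightarrow> real"
  assumes p: "sublinear p"
  obtains q where "sublinear q" "q \<le> p" "\<And>q'. sublinear q' \<Longrightarrow> q' \<le> q \<Longrightarrow> q' = q"
proof -
  define A where "A = {q. sublinear q \<and> q \<le> p}"
  have low: "- p (- x) \<le> q x" if "q \<in> A" for q x
  proof -
    have "q (x + - x) \<le> q x + q (- x)" "q 0 = 0" using that unfolding A_def sublinear_def by blast+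
    moreover have "q (- x) \<le> p (- x)" using that by (simp add: A_def le_fun_def)
    ultimately show ?thesis by simp
  qed
  have "\<exists>m\<in>A. \<forall>a\<in>A. a \<le> m \<longrightarrow> a = m"
  proof (rule predicate_Zorn)
    show "partial_order_on A (relation_of (\<lambda>q q'. q' \<le> q) A)"
      by (rule partial_order_on_relation_ofI) auto
    fix C assume "C \<in> Chains (relation_of (\<lambda>q q'. q' \<le> q) A)"
    then have CA: "C \<subseteq> A" and tot: "\<And>q q'. q \<in> C \<Longrightarrow> q' \<in> C \<Longrightarrow> q \<le> q' \<or> q' \<le> q"
      unfolding Chains_def relation_of_def by blast+
    show "\<exists>u\<in>A. \<forall>a\<in>C. u \<le> a"
    proof (cases "C = {}")
      case True
      then show ?thesis using p by (auto simp: A_def)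
    next
      case False
      define u where "u x = (INF q\<in>C. q x)" for x
      have bdd: "bdd_below ((\<lambda>q. q x) ` C)" for x
        using low CA by (intro bdd_belowI2[where m = "- p (- x)"]) auto
      have le: "u x \<le> q x" if "q \<in> C" for q x
        unfolding u_def using that by (intro cINF_lower bdd)
      have greatest: "c \<le> u x" if "\<And>q. q \<in> C \<Longrightarrow> c \<le> q x" for c x
        unfolding u_def using that False by (intro cINF_greatest) auto
      have "u (x + y) \<le> u x + u y" for x y
      proof -
        have *: "u (x + y) \<le> q1 x + q2 y" if q: "q1 \<in> C" "q2 \<in> C" for q1 q2
        proof -
          obtain q where "q \<in> C" "q \<le> q1" "q \<le> q2" using tot[OF q] q by auto
          moreover from this have "q (x + y) \<le> q x + q y"
            using CA by (auto simp: A_def sublinear_def)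
          ultimately show ?thesis using le[of q "x + y"] by (smt (verit) le_fun_def)
        qed
        have "u (x + y) - q1 x \<le> u y" if "q1 \<in> C" for q1
          by (rule greatest) (use *[OF that] in \<open>simp add: algebra_simps\<close>)
        then have "u (x + y) - u y \<le> u x" by (intro greatest) (simp add: algebra_simps)
        then show ?thesis by simp
      qed
      moreover have "u (t *\<^sub>R x) \<le> t * u x" if t: "t > 0" for t x
      proof -
        have "u (t *\<^sub>R x) / t \<le> u x"
        proof (rule greatest)
          fix q assume q: "q \<in> C"
          then have "q (t *\<^sub>R x) = t * q x" using CA t by (intro sublinear_scale) (auto simp: A_def)
          then show "u (t *\<^sub>R x) / t \<le> q x" using le[OF q, of "t *\<^sub>R x"] t by (simp add: field_simps)
        qed
        then show ?thesis using t by (simp add: field_simps)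
      qed
      moreover have "u 0 = 0"
      proof -
        have "q 0 = 0" if "q \<in> C" for q using that CA by (auto simp: A_def sublinear_def)
        then have "(\<lambda>q. q 0) ` C = (\<lambda>_. 0) ` C" by (intro image_cong) auto
        then show ?thesis using False by (simp add: u_def image_constant_conv)
      qed
      ultimately have "sublinear u" by (simp add: sublinear_def)
      moreover obtain q where q: "q \<in> C" using False by blast
      then have "u \<le> p" using le[OF q] CA unfolding A_def le_fun_def by (blast intro: order_trans)
      ultimately show ?thesis using le by (auto simp: A_def le_fun_def)
    qed
  qed
  then obtain q where q: "q \<in> A" "\<And>a. a \<in> A \<Longrightarrow> a \<le> q \<Longrightarrow> a = q" by blast
  show ?thesis
    by (rule that[of q]) (use q in \<open>auto simp: A_def intro: order_trans\<close>)
qed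

text \<open>A minimal sublinear functional below \<open>p\<close> is linear. To make it agree with \<open>p\<close> at \<open>v\<close>,
  the minimal functional is taken below the shift of \<open>p\<close> by \<open>v\<close>, whose value at \<open>- v\<close> is at most \<open>- p v\<close>.\<close>

theorem Hahn_Banach_sublinear:
  fixes p :: "'v::real_vector \<Rightarrow> real"
  assumes p: "sublinear p"
  obtains u where "linear u" "\<And>x. u x \<le> p x" "u v = p v"
proof -
  define p' where "p' = (\<lambda>x. INF t\<in>{0..}. p (x + t *\<^sub>R v) - t * p v)"
  note p' = sublinear_shift[OF p, where v = v, folded p'_def]
  have p'_le: "p' x \<le> p x" "p' x \<le> p (x + v) - p v" for x using p'(2,3)[of x] by (simp_all add: p'_def)
  obtain q where q: "sublinear q" "q \<le> p'" "\<And>q'. sublinear q' \<Longrightarrow> q' \<le> q \<Longrightarrow> q' = q"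
    using minimal_sublinear_exists[OF p'(1)] by blast
  have add: "q (x + y) = q x + q y" for x y
  proof -
    note s = sublinear_shift[OF q(1), where v = y]
    have "(\<lambda>x. INF t\<in>{0..}. q (x + t *\<^sub>R y) - t * q y) = q"
      using s(1,2) by (intro q(3)) (auto simp: le_fun_def)
    then have "q x \<le> q (x + y) - q y" using s(3)[of x] by (metis (no_types))
    moreover have "q (x + y) \<le> q x + q y" using q(1) by (simp add: sublinear_def)
    ultimately show ?thesis by simp
  qed
  have q0: "q 0 = 0" using q(1) by (simp add: sublinear_def)
  have neg: "q (- x) = - q x" for x using add[of x "- x"] q0 by simp
  have "linear q"
  proof (rule linearI)
    fix r :: real and x
    show "q (r *\<^sub>R x) = r *\<^sub>R q x"
      using sublinear_scale[OF q(1), of r x] sublinear_scale[OF q(1), of "- r" "x"] neg[of "r *\<^sub>R x"]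
      by (cases "r \<ge> 0") auto
  qed (rule add)
  moreover have le: "q x \<le> p x" for x using q(2) p'_le(1)[of x] by (auto simp: le_fun_def intro: order_trans)
  moreover have "q v = p v"
  proof -
    have "q (- v) \<le> p (- v + v) - p v" using q(2) p'_le(2)[of "- v"] by (auto simp: le_fun_def intro: order_trans)
    then have "- q v \<le> - p v" using p by (simp add: neg sublinear_def)
    then show ?thesis using le[of v] by simp
  qed
  ultimately show ?thesis using that by blast
qed

text \<open>In the complex case the functional with real part \<open>u\<close> is \<open>u x - j u(j x)\<close>. Its modulus at \<open>x\<close> is the value of
  \<open>u\<close> at a multiple of \<open>x\<close> by a scalar of modulus 1, hence at most \<open>norm x\<close>.\<close>

lemma norming_functional:
  fixes smul :: "'k::real_or_complex \<Rightarrow> 'v::banach \<Rightarrow> 'v"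
  assumes "banach_over smul"
  obtains f where "f \<in> dual smul" "norm f \<le> 1" "norm (f \<cdot> v) = norm v"
proof -
  note goal = that
  interpret banach_over smul by fact
  have "sublinear (norm :: 'v \<Rightarrow> real)" by (auto simp: sublinear_def norm_triangle_ineq)
  then obtain u :: "'v \<Rightarrow> real" where u: "linear u" "\<And>x. u x \<le> norm x" "u v = norm v"
    using Hahn_Banach_sublinear by blast
  note uadd = linear_add[OF u(1)] and uscale = linear_scale[OF u(1)]
  have umin: "u (- x) = - u x" for x using linear_neg[OF u(1)] .
  have main: ?thesis if add: "\<And>x y. f (x + y) = f x + f y" and hom: "\<And>c x. f (smul c x) = c * f x"
    and re: "\<And>x. norm (u x) \<le> norm (f x)" "\<And>x s. f x = of_real s \<Longrightarrow> u x = s" for f :: "'v \<Rightarrow> 'k"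
  proof -
    have bound: "norm (f x) \<le> norm x" for x
    proof -
      obtain c where c: "norm c = 1" "c * f x = of_real (norm (f x))" using scalar_rotation by blast
      then have "u (smul c x) = norm (f x)" using re(2) hom by metis
      then show ?thesis using u(2)[of "smul c x"] c(1) by (simp add: norm_smul)
    qed
    have bl: "bounded_linear f"
    proof (rule bounded_linear_intro[where K = 1])
      fix r x show "f (r *\<^sub>R x) = r *\<^sub>R f x"
        using hom[of "of_real r" x] by (simp add: smul_of_real scaleR_conv_of_real)
    qed (use add bound in auto)
    note ap = bounded_linear_Blinfun_apply[OF bl]
    show ?thesis
    proof (rule goal[of "Blinfun f"])
      show "Blinfun f \<in> dual smul" by (simp add: dual_def ap hom)
      show "norm (Blinfun f) \<le> 1" by (rule norm_blinfun_bound) (simp_all add: ap bound)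
      show "norm ((Blinfun f) \<cdot> v) = norm v"
        using bound[of v] re(1)[of v] u(3) by (simp add: ap)
    qed
  qed
  show ?thesis
  proof (cases rule: scalar_cases[where 'k = 'k])
    case real
    show ?thesis
    proof (rule main[of "\<lambda>x. of_real (u x)"])
      fix c :: 'k and x
      obtain r where "c = of_real r" using real[of c] by blast
      then show "of_real (u (smul c x)) = c * of_real (u x)" by (simp add: smul_of_real uscale)
    qed (simp_all add: uadd)
  next
    case (complex j)
    have jj: "smul j (smul j x) = - x" for x
      using complex(1) by simp
    show ?thesis
    proof (rule main[of "\<lambda>x. of_real (u x) - j * of_real (u (smul j x))"])
      fix x y
      show "of_real (u (x + y)) - j * of_real (u (smul j (x + y))) =
        of_real (u x) - j * of_real (u (smul j x)) + (of_real (u y) - j * of_real (u (smul j y)))"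
        by (simp add: uadd scale_right_distrib algebra_simps)
    next
      fix c :: 'k and x
      obtain a b where c: "c = of_real a + of_real b * j" using complex(2) by blast
      have 1: "smul c x = a *\<^sub>R x + b *\<^sub>R smul j x"
        unfolding c by (simp add: scale_left_distrib smul_of_real flip: scale_scale)
      have 2: "smul j (smul c x) = a *\<^sub>R smul j x - b *\<^sub>R x"
      proof -
        have "smul j (smul c x) = smul c (smul j x)" by (simp add: scale_left_commute)
        also have "\<dots> = a *\<^sub>R smul j x + b *\<^sub>R smul j (smul j x)"
          unfolding c by (simp only: scale_left_distrib smul_of_real flip: scale_scale)
        finally show ?thesis unfolding jj by simp
      qed
      have j2: "j * (j * z) = - z" for z using complex(1) by (metis mult.assoc mult_minus1)
      show "of_real (u (smul c x)) - j * of_real (u (smul j (smul c x))) =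
          c * (of_real (u x) - j * of_real (u (smul j x)))"
        unfolding 2 unfolding 1 unfolding c by (simp add: uadd uscale linear_diff[OF u(1)] algebra_simps j2)
    next
      fix x
      show "norm (u x) \<le> norm (of_real (u x) - j * of_real (u (smul j x)))"
        using complex(3)[of "u x" "- u (smul j x)"] by (simp add: mult.commute)
    next
      fix x s assume "of_real (u x) - j * of_real (u (smul j x)) = of_real s"
      then have "of_real (u x - s) + of_real (- u (smul j x)) * j = 0" by (simp add: algebra_simps)
      then show "u x = s" using complex(3)[of "u x - s" "- u (smul j x)"] by simp
    qed
  qed
qed

section \<open>Functionals on finite- and infinite-dimensional spaces\<close>

text \<open>Finitely many functionals see only finitely many dimensions: a new functional either vanishes wherever the old
  ones do, or one more vector \<open>s\<close> is needed.\<close>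

lemma (in vector_space) finite_functionals_interpolate:
  assumes "finite F" and S: "subspace S"
    and add: "\<And>f x y. f \<in> F \<Longrightarrow> f (x + y) = f x + f y"
    and hom: "\<And>f c x. f \<in> F \<Longrightarrow> f (scale c x) = c * f x"
  shows "\<exists>B. finite B \<and> B \<subseteq> S \<and> (\<forall>x\<in>S. \<exists>b\<in>span B. \<forall>f\<in>F. f x = f b)"
  using assms(1,3,4)
proof (induction F)
  case empty
  show ?case by (rule exI[of _ "{}"]) auto
next
  case (insert f F)
  have add: "g (x + y) = g x + g y" and hom: "g (scale c x) = c * g x" if "g \<in> insert f F" for g x y c
    using insert.prems that by blast+
  obtain B where B: "finite B" "B \<subseteq> S" "\<And>x. x \<in> S \<Longrightarrow> \<exists>b\<in>span B. \<forall>g\<in>F. g x = g b"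
    using insert.IH add hom by (metis insertCI)
  show ?case
  proof (cases "\<exists>s\<in>S. (\<forall>g\<in>F. g s = 0) \<and> f s \<noteq> 0")
    case True
    then obtain s where s: "s \<in> S" "\<forall>g\<in>F. g s = 0" "f s \<noteq> 0" by blast
    have "\<exists>b\<in>span (insert s B). \<forall>g\<in>insert f F. g x = g b" if x: "x \<in> S" for x
    proof -
      obtain b where b: "b \<in> span B" "\<forall>g\<in>F. g x = g b" using B(3)[OF x] by blast
      let ?b = "b + scale ((f x - f b) / f s) s"
      have "b \<in> span (insert s B)" using b(1) span_mono[of B "insert s B"] by blast
      then have "?b \<in> span (insert s B)" by (intro span_add[OF _ span_scale[OF span_base]]) auto
      moreover have "g x = g ?b" if "g \<in> insert f F" for g
        using that b(2) s(2,3) by (auto simp: add hom)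
      ultimately show ?thesis by blast
    qed
    then show ?thesis using B(1,2) s(1) by (intro exI[of _ "insert s B"]) auto
  next
    case False
    have "\<exists>b\<in>span B. \<forall>g\<in>insert f F. g x = g b" if x: "x \<in> S" for x
    proof -
      obtain b where b: "b \<in> span B" "\<forall>g\<in>F. g x = g b" using B(3)[OF x] by blast
      have bS: "b \<in> S" using b(1) B(2) S span_minimal by blast
      have d: "g (x - b) = g x - g b" if "g \<in> insert f F" for g
        using add[OF that, of "x - b" b] by simp
      have "x - b \<in> S" using x bS S by (simp add: subspace_diff)
      moreover have "\<forall>g\<in>F. g (x - b) = 0" using b(2) by (simp add: d)
      ultimately have "f (x - b) = 0" using False by blast
      then show ?thesis using b d[of f] by auto
    qed
    then show ?thesis using B(1,2) by blast
  qed
qed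

lemma dual_scale_apply [simp]: "(dual_scale c f) \<cdot> x = c * f \<cdot> x"
  by (simp add: dual_scale_def)

lemma vector_space_dual_scale:
  "vector_space (dual_scale :: 'k::real_or_complex \<Rightarrow> ('v::real_normed_vector \<Rightarrow>\<^sub>L 'k) \<Rightarrow> _)"
  by unfold_locales (auto intro!: blinfun_eqI simp: blinfun.add_left algebra_simps)

lemma norm_dual_scale:
  fixes c :: "'k::real_or_complex" and f :: "'v::real_normed_vector \<Rightarrow>\<^sub>L 'k"
  shows "norm (dual_scale c f) = norm c * norm f"
proof -
  have le: "norm (dual_scale c f) \<le> norm c * norm f" for c :: 'k and f :: "'v \<Rightarrow>\<^sub>L 'k"
    by (rule norm_blinfun_bound) (auto simp: norm_mult mult.assoc intro!: mult_left_mono norm_blinfun)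
  show ?thesis
  proof (cases "c = 0")
    case False
    have "norm f = norm (dual_scale (inverse c) (dual_scale c f))"
      using False by (intro arg_cong[where f = norm] blinfun_eqI) simp
    also have "\<dots> \<le> norm (inverse c) * norm (dual_scale c f)" by (rule le)
    finally have "norm c * norm f \<le> norm (dual_scale c f)"
      unfolding norm_inverse using False by (simp add: divide_simps mult.commute)
    then show ?thesis using le[of c f] by simp
  qed (use le[of 0 f] in simp)
qed

lemma subspace_dual:
  "module.subspace dual_scale (dual smul)"
proof -
  interpret vector_space "dual_scale :: 'a \<Rightarrow> ('b \<Rightarrow>\<^sub>L 'a) \<Rightarrow> _" by (rule vector_space_dual_scale)
  show ?thesis by (auto simp: subspace_def dual_def blinfun.add_left algebra_simps)
qed

lemma dual_apply_scale: "f \<in> dual smul \<Longrightarrow> f \<cdot> (smul c x) = c * f \<cdot> x"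
  by (simp add: dual_def)

lemma infinite_dim_annihilated_vector:
  fixes smul :: "'k::real_or_complex \<Rightarrow> 'v::banach \<Rightarrow> 'v"
  assumes "banach_over smul" "\<not> finite_dim smul" "finite F" "F \<subseteq> dual smul"
  obtains x where "norm x = 1" "\<And>f. f \<in> F \<Longrightarrow> f \<cdot> x = 0"
proof -
  interpret banach_over smul by fact
  have "\<exists>B. finite B \<and> B \<subseteq> UNIV \<and> (\<forall>x\<in>UNIV. \<exists>b\<in>span B. \<forall>f\<in>blinfun_apply ` F. f x = f b)"
    by (rule finite_functionals_interpolate) (use assms(3,4) in \<open>auto simp: blinfun.add_right dual_def\<close>)
  then obtain B where B: "finite B" "\<And>x. \<exists>b\<in>span B. \<forall>f\<in>blinfun_apply ` F. f x = f b" by auto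
  obtain y where y: "y \<notin> span B" using B(1) assms(2) unfolding finite_dim_def by blast
  obtain b where b: "b \<in> span B" "\<forall>f\<in>F. f \<cdot> y = f \<cdot> b" using B(2)[of y] by auto
  define z where "z = y - b"
  have z: "z \<noteq> 0" using y b(1) by (auto simp: z_def)
  have "f \<cdot> ((1 / norm z) *\<^sub>R z) = 0" if "f \<in> F" for f
    using b(2) that by (simp add: blinfun.scaleR_right z_def blinfun.diff_right)
  then show ?thesis using that[of "(1 / norm z) *\<^sub>R z"] z by simp
qed

text \<open>If no functional other than 0 vanished on \<open>F\<close>, interpolation on \<open>F\<close> would show that the dual is
  spanned by a finite set, and a second interpolation, on that set, that the space itself is finite-dimensional,
  because functionals separate points.\<close>

lemma infinite_dim_annihilating_functional:
  fixes smul :: "'k::real_or_complex \<Rightarrow> 'v::banach \<Rightarrow> 'v"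
  assumes "banach_over smul" "\<not> finite_dim smul" "finite F"
  obtains f where "f \<in> dual smul" "norm f = 1" "\<And>x. x \<in> F \<Longrightarrow> f \<cdot> x = 0"
proof -
  interpret banach_over smul by fact
  interpret D: vector_space "dual_scale :: 'k \<Rightarrow> ('v \<Rightarrow>\<^sub>L 'k) \<Rightarrow> _" by (rule vector_space_dual_scale)
  have "\<exists>f\<in>dual smul. f \<noteq> 0 \<and> (\<forall>x\<in>F. f \<cdot> x = 0)"
  proof (rule ccontr)
    assume neg: "\<not> ?thesis"
    have "\<exists>B. finite B \<and> B \<subseteq> dual smul \<and>
        (\<forall>f\<in>dual smul. \<exists>b\<in>D.span B. \<forall>e\<in>(\<lambda>v f. f \<cdot> v) ` F. e f = e b)"
      by (rule D.finite_functionals_interpolate) (use assms(3) in \<open>auto simp: blinfun.add_left subspace_dual\<close>)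
    then obtain B where B: "finite B" "B \<subseteq> dual smul"
      "\<And>f. f \<in> dual smul \<Longrightarrow> \<exists>b\<in>D.span B. \<forall>e\<in>(\<lambda>v f. f \<cdot> v) ` F. e f = e b" by blast
    have span: "f \<in> D.span B" if f: "f \<in> dual smul" for f
    proof -
      obtain b where b: "b \<in> D.span B" "\<forall>v\<in>F. f \<cdot> v = b \<cdot> v" using B(3)[OF f] by auto
      have "b \<in> dual smul" using b(1) B(2) D.span_minimal[OF _ subspace_dual] by blast
      then have "f - b \<in> dual smul" using f by (simp add: D.subspace_diff subspace_dual)
      then have "f - b = 0" using neg b(2) by (auto simp: blinfun.diff_left)
      then show ?thesis using b(1) by simp
    qed
    have "\<exists>C. finite C \<and> C \<subseteq> UNIV \<and> (\<forall>x\<in>UNIV. \<exists>b\<in>span C. \<forall>f\<in>blinfun_apply ` B. f x = f b)"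
      by (rule finite_functionals_interpolate) (use B(1,2) in \<open>auto simp: blinfun.add_right dual_def\<close>)
    then obtain C where C: "finite C" "\<And>x. \<exists>b\<in>span C. \<forall>f\<in>blinfun_apply ` B. f x = f b" by auto
    have "x \<in> span C" for x
    proof -
      obtain b where b: "b \<in> span C" "\<forall>f\<in>B. f \<cdot> x = f \<cdot> b" using C(2)[of x] by auto
      obtain f where f: "f \<in> dual smul" "norm (f \<cdot> (x - b)) = norm (x - b)"
        using norming_functional[OF assms(1)] by blast
      have "D.subspace {g. g \<cdot> (x - b) = 0}"
        by (auto simp: D.subspace_def blinfun.add_left)
      moreover have "B \<subseteq> {g. g \<cdot> (x - b) = 0}" using b(2) by (auto simp: blinfun.diff_right)
      ultimately have "f \<in> {g. g \<cdot> (x - b) = 0}"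
        using span[OF f(1)] D.span_minimal by blast
      then have "x = b" using f(2) by simp
      then show ?thesis using b(1) by simp
    qed
    then show False using assms(2) C(1) unfolding finite_dim_def by blast
  qed
  then obtain f where f: "f \<in> dual smul" "f \<noteq> 0" "\<And>x. x \<in> F \<Longrightarrow> f \<cdot> x = 0" by blast
  show ?thesis
  proof (rule that[of "dual_scale (of_real (1 / norm f)) f"])
    show "dual_scale (of_real (1 / norm f)) f \<in> dual smul"
      using f(1) D.subspace_scale[OF subspace_dual] by blast
  qed (use f(2,3) in \<open>simp_all add: norm_dual_scale norm_divide\<close>)
qed

text \<open>Only the continuity of the coordinates is at stake. On the compact set of coefficient families with one entry
  equal to 1 and all others of modulus at most 1, the norm of the combination attains a positive minimum;
  dividing a vector by its largest coordinate puts its coefficients into such a set.\<close>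

lemma finite_dim_coordinates:
  fixes smul :: "'k::real_or_complex \<Rightarrow> 'v::banach \<Rightarrow> 'v"
  assumes "banach_over smul" "finite_dim smul"
  obtains B c where "finite B" "\<And>b. b \<in> B \<Longrightarrow> c b \<in> dual smul"
    "\<And>x. x = (\<Sum>b\<in>B. smul ((c b) \<cdot> x) b)"
proof -
  interpret banach_over smul by fact
  obtain B0 where B0: "finite B0" "span B0 = UNIV" using assms(2) unfolding finite_dim_def by blast
  obtain B where B: "B \<subseteq> B0" "independent B" "B0 \<subseteq> span B"
    using maximal_independent_subset by blast
  have fin: "finite B" using B0(1) B(1) finite_subset by blast
  have span: "x \<in> span B" for x using B(3) B0(2) by (metis UNIV_I span_minimal subspace_span subset_iff)
  define N where "N c = norm (\<Sum>b\<in>B. smul (c b) b)" for c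
  have cont: "continuous_on UNIV N"
  proof -
    have bl: "bounded_linear (\<lambda>z. smul z v)" for v
    proof (rule bounded_linear_intro[where K = "norm v"])
      fix r z show "smul (r *\<^sub>R z) v = r *\<^sub>R smul z v"
        by (metis scaleR_conv_of_real scale_scale smul_of_real)
    qed (simp_all add: scale_left_distrib norm_smul mult.commute)
    show ?thesis unfolding N_def
      by (intro continuous_on_norm continuous_on_sum bounded_linear.continuous_on[OF bl]
          continuous_on_product_coordinates)
  qed
  have min: "\<exists>m>0. \<forall>c. c b0 = 1 \<and> (\<forall>b\<in>B. norm (c b) \<le> 1) \<longrightarrow> m \<le> N c" if b0: "b0 \<in> B" for b0
  proof -
    define X :: "'v \<Rightarrow> 'k set" where "X b = (if b = b0 then {1} else if b \<in> B then cball 0 1 else {0})" for b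
    define K where "K = {c. \<forall>b. c b \<in> X b}"
    have "compact K" unfolding K_def by (rule compact_product) (simp add: X_def compact_scalar_cball)
    moreover have "(\<lambda>b. if b = b0 then 1 else 0) \<in> K" by (auto simp: K_def X_def)
    ultimately obtain d where d: "d \<in> K" "\<And>c. c \<in> K \<Longrightarrow> N d \<le> N c"
      using continuous_attains_inf[of K N] continuous_on_subset[OF cont] by blast
    have "d b0 = 1" using d(1) by (auto simp: K_def X_def split: if_splits dest: spec[of _ b0])
    have "N d \<noteq> 0"
    proof
      assume "N d = 0"
      then have "(\<Sum>b\<in>B. smul (d b) b) = 0" by (simp add: N_def)
      then have "d b0 = 0" using B(2) fin b0 by (auto simp: independent_explicit_finite_subsets)
      then show False using \<open>d b0 = 1\<close> by simp
    qed
    then have "N d > 0" by (simp add: N_def)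
    moreover have "N d \<le> N c" if c: "c b0 = 1" "\<forall>b\<in>B. norm (c b) \<le> 1" for c
    proof -
      have "(\<lambda>b. if b \<in> B then c b else 0) \<in> K" using c b0 by (auto simp: K_def X_def)
      then have "N d \<le> N (\<lambda>b. if b \<in> B then c b else 0)" by (rule d(2))
      also have "\<dots> = N c" unfolding N_def by (intro arg_cong[where f = norm] sum.cong) auto
      finally show ?thesis .
    qed
    ultimately show ?thesis by blast
  qed
  then obtain m where m: "\<And>b0. b0 \<in> B \<Longrightarrow> m b0 > 0"
    "\<And>b0 c. b0 \<in> B \<Longrightarrow> c b0 = 1 \<Longrightarrow> \<forall>b\<in>B. norm (c b) \<le> 1 \<Longrightarrow> m b0 \<le> N c"
    by metis
  define f where "f b x = representation B x b" for b x
  have rep: "(\<Sum>b\<in>B. smul (f b x) b) = x" for x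
    unfolding f_def using sum_representation_eq[OF B(2) span fin] by blast
  have bound: "\<exists>M. \<forall>x. norm (f b x) \<le> norm x * M" if b: "b \<in> B" for b
  proof -
    define mm where "mm = Min (m ` B)"
    have "Min (m ` B) \<in> m ` B" using fin b by (intro Min_in) auto
    then have mm: "mm > 0" "\<And>b0. b0 \<in> B \<Longrightarrow> mm \<le> m b0"
      unfolding mm_def using fin b m(1) by auto
    have "norm (f b x) \<le> norm x * (1 / mm)" for x
    proof -
      define M where "M = Max ((\<lambda>b. norm (f b x)) ` B)"
      have "M \<in> (\<lambda>b. norm (f b x)) ` B" unfolding M_def using fin b by (intro Max_in) auto
      then obtain b0 where b0: "b0 \<in> B" "M = norm (f b0 x)" by blast
      have le: "norm (f b' x) \<le> norm (f b0 x)" if "b' \<in> B" for b'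
        unfolding b0(2)[symmetric] M_def using fin that by (intro Max_ge) auto
      show ?thesis
      proof (cases "f b0 x = 0")
        case True
        then show ?thesis using le[OF b] mm(1) by simp
      next
        case False
        have "mm \<le> N (\<lambda>b. inverse (f b0 x) * f b x)"
          using False le by (intro order_trans[OF mm(2)[OF b0(1)] m(2)[OF b0(1)]]) 
            (auto simp: norm_mult norm_inverse norm_divide divide_simps)
        also have "\<dots> = norm (smul (inverse (f b0 x)) (\<Sum>b\<in>B. smul (f b x) b))"
          unfolding N_def by (simp add: scale_sum_right)
        also have "\<dots> = norm x / norm (f b0 x)"
          unfolding rep by (simp add: norm_smul norm_inverse norm_divide field_simps)
        finally have "norm (f b0 x) \<le> norm x * (1 / mm)" using False mm(1) by (simp add: field_simps)
        then show ?thesis using le[OF b] by linarith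
      qed
    qed
    then show ?thesis by blast
  qed
  have hom: "f b (smul c x) = c * f b x" for b c x
    unfolding f_def using representation_scale[OF B(2) span] by simp
  have bl: "bounded_linear (f b)" if "b \<in> B" for b
  proof -
    obtain M where M: "\<And>x. norm (f b x) \<le> norm x * M" using bound[OF \<open>b \<in> B\<close>] by blast
    show ?thesis
    proof (rule bounded_linear_intro)
      fix x y r
      show "f b (x + y) = f b x + f b y"
        unfolding f_def using representation_add[OF B(2) span span] by simp
      show "f b (r *\<^sub>R x) = r *\<^sub>R f b x"
        using hom[of b "of_real r" x] by (simp add: smul_of_real scaleR_conv_of_real)
      show "norm (f b x) \<le> norm x * M" by (rule M)
    qed
  qed
  show ?thesis
  proof (rule that[of B "\<lambda>b. Blinfun (f b)"])
    fix b assume "b \<in> B"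
    then show "Blinfun (f b) \<in> dual smul" by (simp add: dual_def bounded_linear_Blinfun_apply bl hom)
  next
    fix x
    show "x = (\<Sum>b\<in>B. smul ((Blinfun (f b)) \<cdot> x) b)"
      using rep[of x] by (simp add: bounded_linear_Blinfun_apply bl)
  qed (rule fin)
qed

section \<open>Trees as iterated filters\<close>

text \<open>Eventually in \<open>tree_filter G n\<close> means: for \<open>G\<close>-almost all \<open>v\<^sub>1\<close>, for \<open>G\<close>-almost all \<open>v\<^sub>2\<close>, and so on.\<close>

fun tree_filter :: "'v filter \<Rightarrow> nat \<Rightarrow> 'v list filter" where
  "tree_filter G 0 = principal {[]}"
| "tree_filter G (Suc n) =
     Abs_filter (\<lambda>P. eventually (\<lambda>v. eventually (\<lambda>vs. P (v # vs)) (tree_filter G n)) G)"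

declare tree_filter.simps [simp del]

lemma eventually_tree_filter_0 [simp]: "eventually P (tree_filter G 0) \<longleftrightarrow> P []"
  by (simp add: tree_filter.simps eventually_principal)

lemma eventually_tree_filter_Suc:
  "eventually P (tree_filter G (Suc n)) \<longleftrightarrow>
     eventually (\<lambda>v. eventually (\<lambda>vs. P (v # vs)) (tree_filter G n)) G"
proof -
  have "is_filter (\<lambda>P. eventually (\<lambda>v. eventually (\<lambda>vs. P (v # vs)) (tree_filter G n)) G)"
  proof
    fix P Q
    assume "eventually (\<lambda>v. eventually (\<lambda>vs. P (v # vs)) (tree_filter G n)) G"
      "eventually (\<lambda>v. eventually (\<lambda>vs. Q (v # vs)) (tree_filter G n)) G"
    then show "eventually (\<lambda>v. eventually (\<lambda>vs. P (v # vs) \<and> Q (v # vs)) (tree_filter G n)) G"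
      by eventually_elim (rule eventually_conj)
  next
    fix P Q :: "'a list \<Rightarrow> bool"
    assume PQ: "\<forall>x. P x \<longrightarrow> Q x"
      and "eventually (\<lambda>v. eventually (\<lambda>vs. P (v # vs)) (tree_filter G n)) G"
    from this(2) show "eventually (\<lambda>v. eventually (\<lambda>vs. Q (v # vs)) (tree_filter G n)) G"
      by eventually_elim (use PQ in \<open>auto elim!: eventually_mono\<close>)
  qed simp
  then show ?thesis by (simp add: tree_filter.simps eventually_Abs_filter)
qed

lemma frequently_tree_filter_0 [simp]: "frequently P (tree_filter G 0) \<longleftrightarrow> P []"
  by (simp add: frequently_def)

lemma frequently_tree_filter_Suc:
  "frequently P (tree_filter G (Suc n)) \<longleftrightarrow>
     frequently (\<lambda>v. frequently (\<lambda>vs. P (v # vs)) (tree_filter G n)) G"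
  by (simp add: frequently_def eventually_tree_filter_Suc)

lemma eventually_tree_filter_elements:
  assumes "eventually Q G"
  shows "eventually (\<lambda>vs. length vs = n \<and> (\<forall>v\<in>set vs. Q v)) (tree_filter G n)"
proof (induction n)
  case (Suc n)
  have "eventually (\<lambda>v. eventually (\<lambda>vs. length (v # vs) = Suc n \<and> (\<forall>w\<in>set (v # vs). Q w)) (tree_filter G n)) G"
    using assms
  proof eventually_elim
    case (elim v)
    with Suc show ?case by (auto elim!: eventually_mono)
  qed
  then show ?case by (simp only: eventually_tree_filter_Suc)
qed simp

text \<open>The list is built up as in a game. A state \<open>s\<close> records what has been chosen along with the list so far;
  \<open>V k vs s\<close> says that the position \<open>(vs, s)\<close> is good with \<open>k\<close> moves to go.\<close>

lemma frequently_tree_filter_game: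
  assumes step: "\<And>k vs s. V (Suc k) vs s \<Longrightarrow> frequently (\<lambda>v. \<exists>s'. V k (vs @ [v]) s') G"
    and start: "V n vs s"
  shows "frequently (\<lambda>ws. \<exists>s'. V 0 (vs @ ws) s') (tree_filter G n)"
  using start
proof (induction n arbitrary: vs s)
  case 0
  then show ?case by auto
next
  case (Suc n)
  have "frequently (\<lambda>v. \<exists>s'. V n (vs @ [v]) s') G" using step Suc.prems by blast
  then have "frequently (\<lambda>v. frequently (\<lambda>ws. \<exists>s'. V 0 (vs @ v # ws) s') (tree_filter G n)) G"
  proof (rule frequently_elim1)
    fix v assume "\<exists>s'. V n (vs @ [v]) s'"
    then obtain s' where "V n (vs @ [v]) s'" by blast
    from Suc.IH[OF this] show "frequently (\<lambda>ws. \<exists>s'. V 0 (vs @ v # ws) s') (tree_filter G n)" by simp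
  qed
  then show ?case by (simp add: frequently_tree_filter_Suc)
qed

lemma frequently_const_nontrivial: "frequently (\<lambda>_. P) F \<Longrightarrow> P"
  by (cases P) auto

text \<open>Omitted coordinates drop out because a property that does not depend on the variable and holds frequently
  simply holds.\<close>

lemma frequently_tree_filter_nths:
  assumes "frequently (\<lambda>vs. P (nths vs I)) (tree_filter G n)"
  shows "frequently P (tree_filter G (card (I \<inter> {..<n})))"
  using assms
proof (induction n arbitrary: P I)
  case 0
  then show ?case by simp
next
  case (Suc n)
  define J where "J = {j. Suc j \<in> I}"
  have split: "I \<inter> {..<Suc n} = (I \<inter> {0}) \<union> Suc ` (J \<inter> {..<n})"
  proof (intro set_eqI)
    fix i show "i \<in> I \<inter> {..<Suc n} \<longleftrightarrow> i \<in> (I \<inter> {0}) \<union> Suc ` (J \<inter> {..<n})"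
      by (cases i) (auto simp: J_def)
  qed
  have card: "card (I \<inter> {..<Suc n}) = card (I \<inter> {0}) + card (J \<inter> {..<n})"
    unfolding split by (subst card_Un_disjoint) (auto simp: card_image)
  have "frequently (\<lambda>v. frequently (\<lambda>vs. P ((if 0 \<in> I then [v] else []) @ nths vs J)) (tree_filter G n)) G"
    using Suc.prems by (simp add: frequently_tree_filter_Suc nths_Cons J_def)
  then have *: "frequently (\<lambda>v. frequently (\<lambda>vs. P ((if 0 \<in> I then [v] else []) @ vs))
      (tree_filter G (card (J \<inter> {..<n})))) G"
    by (rule frequently_elim1) (rule Suc.IH)
  show ?case
  proof (cases "0 \<in> I")
    case True
    then have "card (I \<inter> {..<Suc n}) = Suc (card (J \<inter> {..<n}))" using card by simp
    then show ?thesis using * True by (simp add: frequently_tree_filter_Suc)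
  next
    case False
    then show ?thesis using * card by (auto dest: frequently_const_nontrivial)
  qed
qed

text \<open>The trace on the unit sphere of \<open>S\<close> of the neighbourhoods of 0 in the topology induced by \<open>\<Phi>\<close>.\<close>

definition sphere_filter :: "'v::real_normed_vector set \<Rightarrow> ('v \<Rightarrow> 'k::real_normed_vector) set \<Rightarrow> 'v filter" where
  "sphere_filter S \<Phi> = (INF (F, \<epsilon>)\<in>{F. finite F \<and> F \<subseteq> \<Phi>} \<times> {0<..}.
     principal {v\<in>S. norm v = 1 \<and> (\<forall>\<phi>\<in>F. norm (\<phi> v) < \<epsilon>)})"

lemma eventually_sphere_filter:
  fixes S :: "'v::real_normed_vector set" and \<Phi> :: "('v \<Rightarrow> 'k::real_normed_vector) set"
  shows "eventually P (sphere_filter S \<Phi>) \<longleftrightarrow> (\<exists>F \<epsilon>. finite F \<and> F \<subseteq> \<Phi> \<and> 0 < (\<epsilon> :: real) \<and>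
     (\<forall>v\<in>S. norm v = 1 \<longrightarrow> (\<forall>\<phi>\<in>F. norm (\<phi> v) < \<epsilon>) \<longrightarrow> P v))"
proof -
  define I where "I = {F :: ('v \<Rightarrow> 'k) set. finite F \<and> F \<subseteq> \<Phi>} \<times> {0 :: real<..}"
  define W where "W = (\<lambda>(F :: ('v \<Rightarrow> 'k) set, \<epsilon>). {v\<in>S. norm v = 1 \<and> (\<forall>\<phi>\<in>F. norm (\<phi> v) < \<epsilon>)})"
  have "eventually P (INF i\<in>I. principal (W i)) \<longleftrightarrow> (\<exists>i\<in>I. eventually P (principal (W i)))"
  proof (rule eventually_INF_base)
    show "I \<noteq> {}" unfolding I_def by (auto intro: gt_ex)
    fix a b assume "a \<in> I" "b \<in> I"
    then obtain F \<epsilon> H \<delta> where *: "a = (F, \<epsilon>)" "b = (H, \<delta>)" "finite F" "F \<subseteq> \<Phi>" "0 < \<epsilon>" "finite H" "H \<subseteq> \<Phi>" "0 < \<delta>"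
      unfolding I_def by auto
    have "(F \<union> H, min \<epsilon> \<delta>) \<in> I" using * by (simp add: I_def)
    moreover have "W (F \<union> H, min \<epsilon> \<delta>) \<subseteq> W a \<inter> W b" using * by (auto simp: W_def)
    ultimately show "\<exists>i\<in>I. principal (W i) \<le> inf (principal (W a)) (principal (W b))"
      by (intro bexI[of _ "(F \<union> H, min \<epsilon> \<delta>)"]) (simp_all add: inf_principal)
  qed
  moreover have "sphere_filter S \<Phi> = (INF i\<in>I. principal (W i))"
    unfolding sphere_filter_def I_def W_def by (simp add: case_prod_unfold)
  moreover have "(\<exists>i\<in>I. eventually P (principal (W i))) \<longleftrightarrow> (\<exists>F \<epsilon>. finite F \<and> F \<subseteq> \<Phi> \<and> 0 < \<epsilon> \<and>
     (\<forall>v\<in>S. norm v = 1 \<longrightarrow> (\<forall>\<phi>\<in>F. norm (\<phi> v) < \<epsilon>) \<longrightarrow> P v))"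
    unfolding I_def W_def by (force simp: eventually_principal)
  ultimately show ?thesis by simp
qed

lemma frequently_sphere_filter:
  "frequently P (sphere_filter S \<Phi>) \<longleftrightarrow> (\<forall>F \<epsilon>. finite F \<longrightarrow> F \<subseteq> \<Phi> \<longrightarrow> 0 < (\<epsilon> :: real) \<longrightarrow>
     (\<exists>v\<in>S. norm v = 1 \<and> (\<forall>\<phi>\<in>F. norm (\<phi> v) < \<epsilon>) \<and> P v))"
  unfolding frequently_def eventually_sphere_filter by auto

lemma eventually_sphere_filter_small:
  "\<phi> \<in> \<Phi> \<Longrightarrow> 0 < \<epsilon> \<Longrightarrow> eventually (\<lambda>v. norm (\<phi> v) < \<epsilon>) (sphere_filter S \<Phi>)"
  unfolding eventually_sphere_filter by (intro exI[of _ "{\<phi>}"] exI[of _ \<epsilon>]) auto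

lemma eventually_sphere_filter_unit:
  "eventually (\<lambda>v. v \<in> S \<and> norm v = 1) (sphere_filter S \<Phi>)"
  unfolding eventually_sphere_filter by (intro exI[of _ "{}"] exI[of _ 1]) auto

lemma eventually_net_filterD:
  assumes dir: "directed D le" and ev: "eventually Q (net_filter D le)"
  shows "\<exists>u\<in>D. \<forall>v\<in>D. le u v \<longrightarrow> Q v"
proof -
  have "eventually Q (net_filter D le) \<longleftrightarrow> (\<exists>u\<in>D. eventually Q (principal {v\<in>D. le u v}))"
    unfolding net_filter_def
  proof (rule eventually_INF_base)
    show "D \<noteq> {}" using dir by (simp add: directed_def)
    fix a b assume ab: "a \<in> D" "b \<in> D"
    then obtain w where w: "w \<in> D" "le a w" "le b w" using dir unfolding directed_def by blast
    have "\<forall>v\<in>D. le w v \<longrightarrow> le a v \<and> le b v"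
      using dir w ab unfolding directed_def by blast
    then show "\<exists>x\<in>D. principal {v \<in> D. le x v} \<le> inf (principal {v \<in> D. le a v}) (principal {v \<in> D. le b v})"
      using w by (intro bexI[of _ w]) (auto simp: inf_principal)
  qed
  then show ?thesis using ev by (auto simp: eventually_principal)
qed

lemma frequently_tree_filter_if_tree:
  assumes dir: "directed D le" and norm: "normalized_tree S D n x" and null: "null_tree \<Phi> D le n x"
    and P: "\<And>t. t \<in> lists D \<Longrightarrow> length t = n \<Longrightarrow> P (map (\<lambda>i. x (take i t)) [1..<Suc n])"
  shows "frequently P (tree_filter (sphere_filter S \<Phi>) n)"
proof -
  have "frequently (\<lambda>vs. P (map (\<lambda>i. x (take i t)) [1..<Suc (length t)] @ vs)) (tree_filter (sphere_filter S \<Phi>) k)"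
    if "t \<in> lists D" "length t + k = n" for t k
    using that
  proof (induction k arbitrary: t)
    case 0
    then show ?case using P by simp
  next
    case (Suc k)
    show ?case unfolding frequently_tree_filter_Suc frequently_sphere_filter
    proof (intro allI impI)
      fix F and \<epsilon> :: real assume F: "finite F" "F \<subseteq> \<Phi>" "0 < \<epsilon>"
      have "eventually (\<lambda>u. norm (\<phi> (x (t @ [u]))) < \<epsilon>) (net_filter D le)" if "\<phi> \<in> F" for \<phi>
      proof -
        have "length t < n" "\<phi> \<in> \<Phi>" using Suc.prems that F by auto
        then have "((\<lambda>u. \<phi> (x (t @ [u]))) \<longlongrightarrow> 0) (net_filter D le)"
          using null Suc.prems(1) unfolding null_tree_def null_net_def by blast
        then show ?thesis using F(3) by (auto simp: tendsto_iff)
      qed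
      then have "eventually (\<lambda>u. \<forall>\<phi>\<in>F. norm (\<phi> (x (t @ [u]))) < \<epsilon>) (net_filter D le)"
        using F(1) by (simp add: eventually_ball_finite_distrib)
      then obtain u where u0: "u \<in> D" "\<forall>v\<in>D. le u v \<longrightarrow> (\<forall>\<phi>\<in>F. norm (\<phi> (x (t @ [v]))) < \<epsilon>)"
        using eventually_net_filterD[OF dir] by blast
      have "le u u" using dir u0(1) unfolding directed_def by blast
      then have u: "u \<in> D" "\<forall>\<phi>\<in>F. norm (\<phi> (x (t @ [u]))) < \<epsilon>" using u0 by blast+
      have tu: "t @ [u] \<in> lists D" "length (t @ [u]) + k = n" using Suc.prems u(1) by auto
      have "x (t @ [u]) \<in> S" "norm (x (t @ [u])) = 1"
        using norm tu unfolding normalized_tree_def by auto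
      moreover have "map (\<lambda>i. x (take i (t @ [u]))) [1..<Suc (length (t @ [u]))] =
          map (\<lambda>i. x (take i t)) [1..<Suc (length t)] @ [x (t @ [u])]"
        by (simp del: upt_Suc add: upt_Suc_append)
      ultimately show "\<exists>v\<in>S. norm v = 1 \<and> (\<forall>\<phi>\<in>F. norm (\<phi> v) < \<epsilon>) \<and>
          frequently (\<lambda>vs. P (map (\<lambda>i. x (take i t)) [1..<Suc (length t)] @ v # vs)) (tree_filter (sphere_filter S \<Phi>) k)"
        using Suc.IH[OF tu] u(2) by (intro bexI[of _ "x (t @ [u])"] conjI) (simp_all del: upt_Suc)
    qed
  qed
  from this[of "[]" n] show ?thesis by simp
qed

text \<open>The index set consists of the sets that belong to the filter, ordered by reverse inclusion; the vector
  at \<open>t @ [U]\<close> is a point of \<open>U\<close> from which the property can still be reached.\<close>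

lemma tree_if_frequently_tree_filter:
  fixes S :: "'v::real_normed_vector set" and \<Phi> :: "('v \<Rightarrow> 'k::real_normed_vector) set"
  assumes fr: "frequently P (tree_filter (sphere_filter S \<Phi>) n)"
  obtains D :: "'v set set" and le x where "directed D le" "normalized_tree S D n x" "null_tree \<Phi> D le n x"
    "\<And>t. t \<in> lists D \<Longrightarrow> length t = n \<Longrightarrow> P (map (\<lambda>i. x (take i t)) [1..<Suc n])"
proof -
  define G where "G = sphere_filter S \<Phi>"
  define D where "D = {U. eventually (\<lambda>v. v \<in> U) G}"
  define le where "le = (\<lambda>U V :: 'v set. V \<subseteq> U)"
  define W where "W k vs \<longleftrightarrow> frequently (\<lambda>ws. P (vs @ ws)) (tree_filter G k)" for k vs
  have dir: "directed D le"
    unfolding directed_def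
  proof (intro conjI ballI)
    have "UNIV \<in> D" by (simp add: D_def)
    then show "D \<noteq> {}" by blast
  next
    fix U V assume "U \<in> D" "V \<in> D"
    then have "U \<inter> V \<in> D" by (auto simp: D_def eventually_conj_iff)
    then show "\<exists>W\<in>D. le U W \<and> le V W" by (auto simp: le_def)
  qed (auto simp: le_def)
  define c where "c vs U = (SOME v. v \<in> U \<and> v \<in> S \<and> norm v = 1 \<and> W (n - Suc (length vs)) (vs @ [v]))" for vs U
  have c: "c vs U \<in> U \<and> c vs U \<in> S \<and> norm (c vs U) = 1 \<and> W (n - Suc (length vs)) (vs @ [c vs U])"
    if U: "U \<in> D" and vs: "length vs < n" "W (n - length vs) vs" for vs U
  proof -
    obtain k where k: "n - length vs = Suc k" "n - Suc (length vs) = k"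
      using vs(1) by (metis Suc_diff_Suc)
    have "frequently (\<lambda>v. W k (vs @ [v])) G"
      using vs(2) unfolding k W_def frequently_tree_filter_Suc by simp
    moreover have "eventually (\<lambda>v. v \<in> U) G" using U by (simp add: D_def)
    then have "eventually (\<lambda>v. W k (vs @ [v]) \<longrightarrow> W k (vs @ [v]) \<and> v \<in> U \<and> v \<in> S \<and> norm v = 1) G"
      using eventually_sphere_filter_unit[of S \<Phi>, folded G_def] by eventually_elim blast
    ultimately have "frequently (\<lambda>v. W k (vs @ [v]) \<and> v \<in> U \<and> v \<in> S \<and> norm v = 1) G"
      by (rule frequently_rev_mp)
    then have "\<exists>v. v \<in> U \<and> v \<in> S \<and> norm v = 1 \<and> W (n - Suc (length vs)) (vs @ [v])"
      unfolding k using frequently_ex by blast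
    then show ?thesis unfolding c_def by (rule someI_ex)
  qed
  define h where "h = foldl (\<lambda>vs U. vs @ [c vs U]) []"
  have h_snoc: "h (t @ [U]) = h t @ [c (h t) U]" for t U by (simp add: h_def)
  have h_nil: "h [] = []" by (simp add: h_def)
  have h_len: "length (h t) = length t" for t
    by (induction t rule: rev_induct) (simp_all add: h_snoc h_nil)
  have h_take: "h (take i t) = take i (h t)" for i t
  proof (induction t rule: rev_induct)
    case (snoc U t)
    then show ?case by (cases "i \<le> length t") (simp_all add: h_snoc h_len)
  qed (simp add: h_nil)
  have h_W: "W (n - length t) (h t)" if "t \<in> lists D" "length t \<le> n" for t
    using that
  proof (induction t rule: rev_induct)
    case Nil
    then show ?case using fr by (simp add: W_def h_nil G_def)
  next
    case (snoc U t)
    then show ?case using c[of U "h t"] by (simp add: h_snoc h_len)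
  qed
  define x where "x t = last (h t)" for t
  have x_snoc: "x (t @ [U]) = c (h t) U" for t U by (simp add: x_def h_snoc)
  have x_map: "map (\<lambda>i. x (take i t)) [1..<Suc (length t)] = h t" for t
  proof (rule nth_equalityI)
    fix i assume "i < length (map (\<lambda>i. x (take i t)) [1..<Suc (length t)])"
    then have i: "i < length t" by (simp del: upt_Suc)
    then have "map (\<lambda>i. x (take i t)) [1..<Suc (length t)] ! i = last (h (take (Suc i) t))"
      by (simp del: upt_Suc add: x_def)
    also have "\<dots> = h t ! i" using i unfolding h_take by (simp add: take_Suc_conv_app_nth h_len)
    finally show "map (\<lambda>i. x (take i t)) [1..<Suc (length t)] ! i = h t ! i" .
  qed (simp del: upt_Suc add: h_len)
  show ?thesis
  proof (rule that[of D le x])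
    show "normalized_tree S D n x"
      unfolding normalized_tree_def
    proof (intro ballI impI)
      fix t assume t: "t \<in> lists D" "1 \<le> length t \<and> length t \<le> n"
      then obtain t' U where tU: "t = t' @ [U]" by (metis append_butlast_last_id list.size(3) not_one_le_zero)
      show "x t \<in> S \<and> norm (x t) = 1"
        using c[of U "h t'"] h_W[of t'] t unfolding tU x_snoc by (simp add: h_len)
    qed
    show "null_tree \<Phi> D le n x"
      unfolding null_tree_def null_net_def tendsto_iff
    proof (intro ballI impI allI)
      fix t \<phi> and \<epsilon> :: real assume t: "t \<in> lists D" "length t < n" and \<phi>: "\<phi> \<in> \<Phi>" and \<epsilon>: "0 < \<epsilon>"
      define U where "U = {v. norm (\<phi> v) < \<epsilon>}"
      have U: "U \<in> D" using eventually_sphere_filter_small[OF \<phi> \<epsilon>] by (simp add: D_def U_def G_def)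
      have "norm (\<phi> (x (t @ [V]))) < \<epsilon>" if "V \<in> D" "V \<subseteq> U" for V
        using c[OF that(1), of "h t"] h_W[OF t(1)] t(2) that(2) unfolding x_snoc U_def by (auto simp: h_len)
      then have "eventually (\<lambda>V. norm (\<phi> (x (t @ [V]))) < \<epsilon>) (principal {V\<in>D. le U V})"
        by (simp add: eventually_principal le_def)
      then show "eventually (\<lambda>V. dist (\<phi> (x (t @ [V]))) 0 < \<epsilon>) (net_filter D le)"
        unfolding net_filter_def dist_0_norm using U by (simp add: dist_norm) (rule eventually_INF1)
    qed
    fix t assume t: "t \<in> lists D" "length t = n"
    have "P (h t)" using h_W[OF t(1)] t(2) by (simp add: W_def)
    then show "P (map (\<lambda>i. x (take i t)) [1..<Suc n])" using x_map[of t] t(2) by simp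
  qed (rule dir)
qed

section \<open>Existence of asymptotic pairs\<close>

definition comb :: "('k \<Rightarrow> 'v \<Rightarrow> 'v) \<Rightarrow> nat \<Rightarrow> (nat \<Rightarrow> 'k) \<Rightarrow> 'v list \<Rightarrow> 'v::comm_monoid_add" where
  "comb smul n a vs = (\<Sum>i=1..n. smul (a i) (vs ! (i - 1)))"

definition approximates ::
  "('k::real_or_complex \<Rightarrow> 'v \<Rightarrow> 'v) \<Rightarrow> ('v::real_normed_vector \<Rightarrow> 'w::real_normed_vector) \<Rightarrow> nat \<Rightarrow>
   real \<Rightarrow> ((nat \<Rightarrow> 'k) \<Rightarrow> real) \<Rightarrow> ((nat \<Rightarrow> 'k) \<Rightarrow> real) \<Rightarrow> 'v list \<Rightarrow> bool" where
  "approximates smul T n \<delta> r \<rho> vs \<longleftrightarrow>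
     (\<forall>a. (\<forall>i\<in>{1..n}. norm (a i) \<le> 1) \<longrightarrow>
        \<bar>norm (comb smul n a vs) - r (basis_sum n a)\<bar> < \<delta> \<and>
        \<bar>norm (T (comb smul n a vs)) - \<rho> (basis_sum n a)\<bar> < \<delta>)"

lemma approximates_along_branches:
  "tree_approximates smul T D n \<delta> x r \<rho> \<longleftrightarrow>
     (\<forall>t\<in>lists D. length t = n \<longrightarrow> approximates smul T n \<delta> r \<rho> (map (\<lambda>i. x (take i t)) [1..<Suc n]))"
proof -
  have "comb smul n a (map (\<lambda>i. x (take i t)) [1..<Suc n]) = (\<Sum>i=1..n. smul (a i) (x (take i t)))" for a t
    unfolding comb_def
  proof (intro sum.cong refl)
    fix i assume i: "i \<in> {1..n}"
    then have "map (\<lambda>i. x (take i t)) [1..<Suc n] ! (i - 1) = x (take ([1..<Suc n] ! (i - 1)) t)"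
      by (intro nth_map) (auto simp del: upt_Suc)
    also have "[1..<Suc n] ! (i - 1) = i" using i by (subst nth_upt) auto
    finally show "smul (a i) (map (\<lambda>i. x (take i t)) [1..<Suc n] ! (i - 1)) = smul (a i) (x (take i t))" by simp
  qed
  then show ?thesis by (simp add: tree_approximates_def approximates_def del: upt_Suc)
qed

text \<open>This removes trees and directed sets from the definition of the asymptotic structures.\<close>

lemma asymptotic_pairs_tree_filter:
  "(\<exists>(D :: 'v set set) le x. directed D le \<and> normalized_tree S D n x \<and> null_tree \<Phi> D le n x \<and>
      tree_approximates smul T D n \<delta> x r \<rho>) \<longleftrightarrow>
   frequently (approximates smul T n \<delta> r \<rho>) (tree_filter (sphere_filter (S :: 'v::real_normed_vector set) \<Phi>) n)"
  (is "?l \<longleftrightarrow> ?r")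
proof
  assume ?l
  then obtain D :: "'v set set" and le x where *: "directed D le" "normalized_tree S D n x" "null_tree \<Phi> D le n x"
    "tree_approximates smul T D n \<delta> x r \<rho>" by blast
  show ?r by (rule frequently_tree_filter_if_tree[OF *(1-3)]) (use *(4) approximates_along_branches in blast)
next
  assume ?r
  then obtain D :: "'v set set" and le x where "directed D le" "normalized_tree S D n x" "null_tree \<Phi> D le n x"
    "\<And>t. t \<in> lists D \<Longrightarrow> length t = n \<Longrightarrow> approximates smul T n \<delta> r \<rho> (map (\<lambda>i. x (take i t)) [1..<Suc n])"
    using tree_if_frequently_tree_filter[OF \<open>?r\<close>] by metis
  then show ?l unfolding approximates_along_branches by blast
qed

lemma basis_sum_eq: "basis_sum m a = (\<lambda>j. if j \<in> {1..m} then a j else 0)"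
  by (rule ext) (simp add: basis_sum_def basis_vec_def if_distrib[of "(*) _"] cong: if_cong)

lemma basis_sum_in_coord_space: "m \<le> n \<Longrightarrow> basis_sum m a \<in> coord_space n"
  by (auto simp: basis_sum_eq coord_space_def)

lemma basis_sum_coord_space: "a \<in> coord_space n \<Longrightarrow> basis_sum n a = a"
  by (auto simp: basis_sum_eq coord_space_def)

lemma basis_vec_in_coord_space: "i \<in> {1..n} \<Longrightarrow> basis_vec i \<in> coord_space n"
  by (auto simp: basis_vec_def coord_space_def)

text \<open>Total boundedness of a bounded family of scalars. The net consists of points of \<open>A\<close> itself: one point for each
  pattern of approximate values that occurs.\<close>

lemma finite_net:
  fixes g :: "'i \<Rightarrow> 'x \<Rightarrow> 'k::real_or_complex"
  assumes I: "finite I" and bd: "\<And>x i. x \<in> A \<Longrightarrow> i \<in> I \<Longrightarrow> norm (g i x) \<le> M" and \<delta>: "0 < \<delta>"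
  obtains E where "finite E" "E \<subseteq> A" "\<And>x. x \<in> A \<Longrightarrow> \<exists>e\<in>E. \<forall>i\<in>I. norm (g i x - g i e) < \<delta>"
proof -
  have "cball (0::'k) M \<subseteq> (\<Union>z\<in>cball 0 M. ball z (\<delta> / 2))" using \<delta> by force
  then obtain N where N: "finite N" "cball (0::'k) M \<subseteq> (\<Union>z\<in>N. ball z (\<delta> / 2))"
    by (rule compactE_image[OF compact_scalar_cball open_ball])
  define code where "code x = (\<lambda>i\<in>I. SOME z. z \<in> N \<and> dist z (g i x) < \<delta> / 2)" for x
  have code: "code x i \<in> N \<and> dist (code x i) (g i x) < \<delta> / 2" if "x \<in> A" "i \<in> I" for x i
  proof -
    have "g i x \<in> cball 0 M" using bd[OF that] by simp
    then have "g i x \<in> (\<Union>z\<in>N. ball z (\<delta> / 2))" by (rule subsetD[OF N(2)])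
    then have "\<exists>z. z \<in> N \<and> dist z (g i x) < \<delta> / 2" unfolding UN_iff mem_ball by blast
    from someI_ex[OF this] show ?thesis using that by (simp add: code_def)
  qed
  have "code ` A \<subseteq> PiE I (\<lambda>_. N)" using code by (auto simp: code_def PiE_def extensional_def)
  then have fin: "finite (code ` A)" using finite_PiE[OF I, of "\<lambda>_. N"] N(1) finite_subset by blast
  define E where "E = inv_into A code ` (code ` A)"
  show ?thesis
  proof (rule that[of E])
    show "finite E" using fin by (simp add: E_def)
    show "E \<subseteq> A" by (auto simp: E_def intro: inv_into_into)
    fix x assume x: "x \<in> A"
    define e where "e = inv_into A code (code x)"
    have e: "e \<in> E" "e \<in> A" "code e = code x"
      using x by (auto simp: e_def E_def f_inv_into_f intro: inv_into_into)
    have "norm (g i x - g i e) < \<delta>" if i: "i \<in> I" for i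
      using code[OF x i] code[OF e(2) i] dist_triangle[of "g i x" "g i e" "code x i"]
      unfolding e(3) by (simp add: dist_norm norm_minus_commute)
    then show "\<exists>e\<in>E. \<forall>i\<in>I. norm (g i x - g i e) < \<delta>" using e(1) by blast
  qed
qed

text \<open>A filter \<open>F'\<close> that refines \<open>F\<close> and along which \<open>f\<close> converges plays the role of a subnet. Along it,
  limits inherit all identities and inequalities that hold eventually for \<open>F\<close>.\<close>

lemma frequently_compact_limit:
  assumes K: "compact K" and P: "frequently P F" and ev: "eventually (\<lambda>x. f x \<in> K) F"
  obtains F' l where "F' \<noteq> bot" "F' \<le> F" "eventually P F'" "(f \<longlongrightarrow> l) F'"
proof -
  define F1 where "F1 = inf F (principal {x. P x})"
  have F1: "F1 \<noteq> bot"
    using P by (auto simp: F1_def trivial_limit_def eventually_inf_principal frequently_def)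
  have "eventually (\<lambda>y. y \<in> K) (filtermap f F1)"
    using ev by (auto simp: eventually_filtermap F1_def eventually_inf_principal elim: eventually_mono)
  moreover have "filtermap f F1 \<noteq> bot" using F1 by (simp add: filtermap_bot_iff)
  ultimately obtain l where l: "inf (nhds l) (filtermap f F1) \<noteq> bot"
    using K unfolding compact_filter by blast
  define F' where "F' = inf F1 (filtercomap f (nhds l))"
  have "F' \<noteq> bot"
  proof
    assume "F' = bot"
    then have "eventually (\<lambda>_. False) F'" by simp
    then obtain Q R where QR: "eventually Q F1" "eventually R (filtercomap f (nhds l))" "\<And>x. Q x \<Longrightarrow> R x \<Longrightarrow> False"
      unfolding F'_def eventually_inf by blast
    obtain R' where R': "eventually R' (nhds l)" "\<And>x. R' (f x) \<Longrightarrow> R x"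
      using QR(2) unfolding eventually_filtercomap by blast
    have "eventually (\<lambda>y. \<not> R' y) (filtermap f F1)"
      unfolding eventually_filtermap using QR(1) by eventually_elim (use QR(3) R'(2) in blast)
    then have "eventually (\<lambda>_. False) (inf (nhds l) (filtermap f F1))"
      unfolding eventually_inf using R'(1) by blast
    with l show False by (simp add: trivial_limit_def)
  qed
  moreover have "F' \<le> F" unfolding F'_def F1_def by (simp add: le_infI1)
  moreover have "eventually P F'"
  proof -
    have "eventually P F1" by (simp add: F1_def eventually_inf_principal)
    then show ?thesis unfolding F'_def by (rule filter_leD[OF inf_le1])
  qed
  moreover have "(f \<longlongrightarrow> l) F'"
    unfolding filterlim_iff_le_filtercomap F'_def by simp
  ultimately show ?thesis by (rule that)
qed

text \<open>The functionals in \<open>\<Phi>\<close> that are dominated by the seminorm \<open>norm (R v)\<close> almost recover it; hence this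
  seminorm is lower semicontinuous for the topology induced by \<open>\<Phi>\<close>.\<close>

definition normed_by :: "'v set \<Rightarrow> ('v \<Rightarrow> 'k::real_normed_vector) set \<Rightarrow> ('v \<Rightarrow> 'w::real_normed_vector) \<Rightarrow> bool" where
  "normed_by S \<Phi> R \<longleftrightarrow> (\<forall>v\<in>S. \<forall>\<epsilon>>0. \<exists>\<phi>\<in>\<Phi>. norm (R v) - \<epsilon> \<le> norm (\<phi> v) \<and> (\<forall>w\<in>S. norm (\<phi> w) \<le> norm (R w)))"

text \<open>What the weak structure of \<open>A\<close> and the weak* structure of \<open>A*\<close> have in common.\<close>

locale asymptotic_setting = vector_space smul
  for smul :: "'k::real_or_complex \<Rightarrow> 'v::real_normed_vector \<Rightarrow> 'v" +
  fixes S :: "'v set" and \<Phi> :: "('v \<Rightarrow> 'k) set" and T :: "'v \<Rightarrow> 'w::real_normed_vector"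
  assumes norm_smul: "norm (smul c x) = norm c * norm x"
    and subspace: "subspace S"
    and T_add: "T (x + y) = T x + T y"
    and norm_T_smul: "norm (T (smul c x)) = norm c * norm (T x)"
    and T_bounded: "\<exists>M. \<forall>x\<in>S. norm (T x) \<le> M * norm x"
    and functional_add: "\<phi> \<in> \<Phi> \<Longrightarrow> \<phi> (x + y) = \<phi> x + \<phi> y"
    and functional_smul: "\<phi> \<in> \<Phi> \<Longrightarrow> \<phi> (smul c x) = c * \<phi> x"
    and normed_id: "normed_by S \<Phi> (\<lambda>x. x)"
    and normed_T: "normed_by S \<Phi> T"
begin

abbreviation G :: "'v filter" where "G \<equiv> sphere_filter S \<Phi>"

lemma norm_weakly_lower_semicontinuous:
  assumes R: "normed_by S \<Phi> R" and v: "v \<in> S" and \<epsilon>: "0 < \<epsilon>"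
  shows "eventually (\<lambda>w. norm (R v) \<le> norm (R (v + smul c w)) + \<epsilon>) G"
proof -
  have "0 < \<epsilon> / 2" using \<epsilon> by simp
  then obtain \<phi> where \<phi>: "\<phi> \<in> \<Phi>" "norm (R v) - \<epsilon> / 2 \<le> norm (\<phi> v)" "\<And>w. w \<in> S \<Longrightarrow> norm (\<phi> w) \<le> norm (R w)"
    using R v unfolding normed_by_def by metis
  define \<eta> where "\<eta> = \<epsilon> / (2 * (norm c + 1))"
  have c: "norm c + 1 > 0" by (simp add: add_nonneg_pos)
  then have \<eta>: "\<eta> > 0" using \<epsilon> by (simp add: \<eta>_def)
  have "(norm c + 1) * \<eta> = \<epsilon> / 2" using c by (simp add: \<eta>_def field_simps)
  then have c\<eta>: "norm c * \<eta> \<le> \<epsilon> / 2" using \<eta> by (simp add: algebra_simps)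
  from eventually_sphere_filter_small[OF \<phi>(1) \<eta>] eventually_sphere_filter_unit
  show ?thesis
  proof eventually_elim
    case (elim w)
    have "v + smul c w \<in> S" using v elim(2) subspace by (simp add: subspace_add subspace_scale)
    then have "norm (\<phi> (v + smul c w)) \<le> norm (R (v + smul c w))" by (rule \<phi>(3))
    moreover have "\<phi> v = \<phi> (v + smul c w) - c * \<phi> w"
      by (simp add: functional_add[OF \<phi>(1)] functional_smul[OF \<phi>(1)])
    then have "norm (\<phi> v) \<le> norm (\<phi> (v + smul c w)) + norm c * norm (\<phi> w)"
      by (metis norm_triangle_ineq4 norm_mult)
    moreover have "norm c * norm (\<phi> w) \<le> norm c * \<eta>" using elim(1) by (intro mult_left_mono) auto
    ultimately show ?case using \<phi>(2) c\<eta> by linarith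
  qed
qed

text \<open>Lower semicontinuity, applied to one coordinate at a time, is the source of the monotonicity that the definition
  of the asymptotic structures demands.\<close>

lemma eventually_norm_initial_segment:
  assumes R: "normed_by S \<Phi> R" and "v \<in> S" "0 < \<epsilon>" "m \<le> n"
  shows "eventually (\<lambda>vs. norm (R (v + (\<Sum>i<m. smul (a i) (vs ! i)))) \<le>
     norm (R (v + (\<Sum>i<n. smul (a i) (vs ! i)))) + \<epsilon>) (tree_filter G n)"
  using assms(2-4)
proof (induction n arbitrary: v a m \<epsilon>)
  case 0
  then show ?case by simp
next
  case (Suc n)
  have shift: "v + (\<Sum>i<Suc k. smul (a i) ((w # vs) ! i)) =
      (v + smul (a 0) w) + (\<Sum>i<k. smul (a (Suc i)) (vs ! i))" for w vs k
    by (simp only: sum.lessThan_Suc_shift) (simp add: add.assoc)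
  have S: "v + smul (a 0) w \<in> S" if "w \<in> S" for w
    using that Suc.prems(1) subspace by (simp add: subspace_add subspace_scale)
  show ?case
  proof (cases m)
    case 0
    have "0 < \<epsilon> / 2" using Suc.prems by simp
    from norm_weakly_lower_semicontinuous[OF R Suc.prems(1) this, of "a 0"] eventually_sphere_filter_unit
    have "eventually (\<lambda>w. eventually (\<lambda>vs. norm (R v) \<le>
        norm (R (v + (\<Sum>i<Suc n. smul (a i) ((w # vs) ! i)))) + \<epsilon>) (tree_filter G n)) G"
    proof eventually_elim
      case (elim w)
      have "eventually (\<lambda>vs. norm (R (v + smul (a 0) w)) \<le>
          norm (R ((v + smul (a 0) w) + (\<Sum>i<n. smul (a (Suc i)) (vs ! i)))) + \<epsilon> / 2) (tree_filter G n)"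
        using Suc.IH[OF S, of w "\<epsilon> / 2" 0 "\<lambda>i. a (Suc i)"] elim(2) Suc.prems by simp
      then show ?case by eventually_elim (use elim(1) in \<open>unfold shift, linarith\<close>)
    qed
    then show ?thesis unfolding 0 by (simp add: eventually_tree_filter_Suc del: sum.lessThan_Suc)
  next
    case (Suc m')
    have "eventually (\<lambda>w. eventually (\<lambda>vs. norm (R (v + (\<Sum>i<m. smul (a i) ((w # vs) ! i)))) \<le>
        norm (R (v + (\<Sum>i<Suc n. smul (a i) ((w # vs) ! i)))) + \<epsilon>) (tree_filter G n)) G"
      using eventually_sphere_filter_unit
    proof eventually_elim
      case (elim w)
      show ?case unfolding Suc shift
        using Suc.IH[OF S, of w \<epsilon> m' "\<lambda>i. a (Suc i)"] elim Suc.prems Suc by simp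
    qed
    then show ?thesis by (simp only: eventually_tree_filter_Suc)
  qed
qed

lemma comb_in_S: "length vs = n \<Longrightarrow> set vs \<subseteq> S \<Longrightarrow> comb smul n a vs \<in> S"
  unfolding comb_def using subspace by (intro subspace_sum subspace_scale) (auto simp: subset_iff)

lemma comb_add: "comb smul n (\<lambda>i. a i + b i) vs = comb smul n a vs + comb smul n b vs"
  by (simp add: comb_def scale_left_distrib sum.distrib)

lemma comb_scale: "comb smul n (\<lambda>i. c * a i) vs = smul c (comb smul n a vs)"
  by (simp add: comb_def scale_sum_right)

lemma norm_comb_le:
  assumes "length vs = n" "\<And>v. v \<in> set vs \<Longrightarrow> norm v = 1"
  shows "norm (comb smul n a vs) \<le> (\<Sum>i=1..n. norm (a i))"
  unfolding comb_def using assms by (intro sum_norm_le) (auto simp: norm_smul)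

lemma T_zero: "T 0 = 0"
  using T_add[of 0 0] by simp

lemma T_sum: "T (sum f I) = (\<Sum>i\<in>I. T (f i))"
proof (cases "finite I")
  case True
  then show ?thesis by induction (simp_all add: T_zero T_add)
qed (simp add: T_zero)

lemma norm_T_le: "x \<in> S \<Longrightarrow> norm (T x) \<le> onorm_on S T * norm x"
proof (cases "x = 0")
  case False
  assume x: "x \<in> S"
  obtain M where M: "\<And>x. x \<in> S \<Longrightarrow> norm (T x) \<le> M * norm x" using T_bounded by blast
  have "bdd_above ((\<lambda>x. norm (T x) / norm x) ` S)"
  proof (rule bdd_aboveI2)
    fix x assume "x \<in> S"
    then have "norm (T x) \<le> \<bar>M\<bar> * norm x"
      by (intro order_trans[OF M mult_right_mono]) auto
    then show "norm (T x) / norm x \<le> \<bar>M\<bar>" by (cases "x = 0") (simp_all add: divide_simps)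
  qed
  then have "norm (T x) / norm x \<le> onorm_on S T" unfolding onorm_on_def using x by (intro cSUP_upper)
  then show ?thesis using False by (simp add: field_simps)
qed (simp add: T_zero)

text \<open>By Tychonoff's theorem the functions \<open>a \<mapsto> (\<parallel>\<Sum> a\<^sub>i v\<^sub>i\<parallel>, \<parallel>T \<Sum> a\<^sub>i v\<^sub>i\<parallel>)\<close> attached to branches have a
  limit \<open>(r, \<rho>)\<close> along a filter that respects \<open>P\<close>. The properties required of the pair pass to the limit.
  Convergence is pointwise in \<open>a\<close>, and uniform on the unit cube since all functions are Lipschitz.\<close>

theorem asymptotic_pair_exists:
  assumes P: "frequently P (tree_filter G n)"
  obtains r \<rho> where "(r, \<rho>) \<in> asymptotic_pairs S smul \<Phi> T n"
    "\<And>\<delta>. 0 < \<delta> \<Longrightarrow> frequently (\<lambda>vs. P vs \<and> approximates smul T n \<delta> r \<rho> vs) (tree_filter G n)"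
proof -
  obtain M where M: "\<And>x. x \<in> S \<Longrightarrow> norm (T x) \<le> M * norm x" using T_bounded by blast
  define tree where "tree vs \<longleftrightarrow> length vs = n \<and> set vs \<subseteq> S \<and> (\<forall>v\<in>set vs. norm v = 1)" for vs
  have tree: "eventually tree (tree_filter G n)"
    using eventually_tree_filter_elements[OF eventually_sphere_filter_unit]
    by (rule eventually_mono) (auto simp: tree_def)
  have tree_le: "norm (comb smul n a vs) \<le> (\<Sum>i=1..n. norm (a i))" and tree_S: "comb smul n a vs \<in> S"
    if "tree vs" for a vs
    using that norm_comb_le[of vs n a] comb_in_S[of vs n a] by (auto simp: tree_def)
  \<comment> \<open>The Boolean selects between the norm and the seminorm, so that one function space serves for both.\<close>
  define pat where "pat vs = (\<lambda>(a, b). if b then norm (T (comb smul n a vs)) else norm (comb smul n a vs))" for vs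
  define K where "K = {h :: (nat \<Rightarrow> 'k) \<times> bool \<Rightarrow> real. \<forall>e. h e \<in> cball 0 ((\<bar>M\<bar> + 1) * (\<Sum>i=1..n. norm (fst e i)))}"
  have compact: "compact K" unfolding K_def by (rule compact_product) simp
  have in_K: "eventually (\<lambda>vs. pat vs \<in> K) (tree_filter G n)"
    using tree
  proof eventually_elim
    case (elim vs)
    have 1: "norm (comb smul n a vs) \<le> (\<Sum>i=1..n. norm (a i))" for a
      using elim by (rule tree_le)
    have 2: "norm (T (comb smul n a vs)) \<le> \<bar>M\<bar> * (\<Sum>i=1..n. norm (a i))" for a
    proof -
      have "norm (T (comb smul n a vs)) \<le> M * norm (comb smul n a vs)"
        using elim by (intro M tree_S)
      also have "\<dots> \<le> \<bar>M\<bar> * (\<Sum>i=1..n. norm (a i))" using 1[of a] by (intro mult_mono) auto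
      finally show ?thesis .
    qed
    have z: "0 \<le> (\<Sum>i=1..n. norm (a i))" "0 \<le> \<bar>M\<bar> * (\<Sum>i=1..n. norm (a i))" for a :: "nat \<Rightarrow> 'k"
      by (auto intro!: sum_nonneg mult_nonneg_nonneg)
    have "norm (comb smul n a vs) \<le> (\<bar>M\<bar> + 1) * (\<Sum>i=1..n. norm (a i))"
      "norm (T (comb smul n a vs)) \<le> (\<bar>M\<bar> + 1) * (\<Sum>i=1..n. norm (a i))" for a
      unfolding distrib_right mult_1 using 1[of a] 2[of a] z[of a] by linarith+
    then show ?case by (simp add: K_def pat_def case_prod_beta)
  qed
  obtain F h where F: "F \<noteq> bot" "F \<le> tree_filter G n" "eventually P F" "(pat \<longlongrightarrow> h) F"
    by (rule frequently_compact_limit[OF compact P in_K])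
  have coord: "((\<lambda>vs. pat vs e) \<longlongrightarrow> h e) F" for e
  proof -
    have "continuous_on UNIV (\<lambda>f :: (nat \<Rightarrow> 'k) \<times> bool \<Rightarrow> real. f e)" by (rule continuous_on_product_coordinates)
    then show ?thesis by (rule continuous_on_tendsto_compose[OF _ F(4)]) simp_all
  qed
  define r where "r a = h (a, False)" for a
  define \<rho> where "\<rho> a = h (a, True)" for a
  have r: "((\<lambda>vs. norm (comb smul n a vs)) \<longlongrightarrow> r a) F" for a
    using coord[of "(a, False)"] by (simp add: r_def pat_def)
  have \<rho>: "((\<lambda>vs. norm (T (comb smul n a vs))) \<longlongrightarrow> \<rho> a) F" for a
    using coord[of "(a, True)"] by (simp add: \<rho>_def pat_def)
  have Ftree: "eventually tree F" using tree F(2) by (rule filter_leD[rotated])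
  have r_scale: "r (\<lambda>i. c * a i) = norm c * r a" for c a
    using tendsto_unique[OF F(1) r] tendsto_mult_left[OF r] by (simp add: comb_scale norm_smul)
  have \<rho>_scale: "\<rho> (\<lambda>i. c * a i) = norm c * \<rho> a" for c a
    using tendsto_unique[OF F(1) \<rho>] tendsto_mult_left[OF \<rho>] by (simp add: comb_scale norm_T_smul)
  have r_add: "r (\<lambda>i. a i + b i) \<le> r a + r b" for a b
    by (rule tendsto_le[OF F(1) tendsto_add[OF r r] r]) (simp add: comb_add norm_triangle_ineq)
  have \<rho>_add: "\<rho> (\<lambda>i. a i + b i) \<le> \<rho> a + \<rho> b" for a b
    by (rule tendsto_le[OF F(1) tendsto_add[OF \<rho> \<rho>] \<rho>]) (simp add: comb_add T_add norm_triangle_ineq)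
  have r_nonneg: "0 \<le> r a" and \<rho>_nonneg: "0 \<le> \<rho> a" for a
    using tendsto_lowerbound[OF r _ F(1)] tendsto_lowerbound[OF \<rho> _ F(1)] by simp_all
  have r_le: "r a \<le> (\<Sum>i=1..n. norm (a i))" for a
    by (rule tendsto_upperbound[OF r _ F(1)])
      (rule eventually_mono[OF Ftree tree_le])
  have \<rho>_le: "\<rho> a \<le> onorm_on S T * r a" for a
    by (rule tendsto_le[OF F(1) tendsto_mult_left[OF r] \<rho>])
      (rule eventually_mono[OF Ftree norm_T_le[OF tree_S]])
  have comb_basis: "comb smul n (basis_sum m a) vs = comb smul m a vs" if "m \<le> n" for m a vs
    unfolding comb_def using that
    by (intro sum.mono_neutral_cong_right) (auto simp: basis_sum_eq)
  have r_sum: "((\<lambda>vs. norm (comb smul m a vs)) \<longlongrightarrow> r (basis_sum m a)) F"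
    and \<rho>_sum: "((\<lambda>vs. norm (T (comb smul m a vs))) \<longlongrightarrow> \<rho> (basis_sum m a)) F" if "m \<le> n" for m a
    using r[of "basis_sum m a"] \<rho>[of "basis_sum m a"] by (simp_all add: comb_basis[OF that])
  have r_basis: "r (basis_sum n a) = r a" and \<rho>_basis: "\<rho> (basis_sum n a) = \<rho> a" for a
    using tendsto_unique[OF F(1) r_sum r] tendsto_unique[OF F(1) \<rho>_sum \<rho>] by simp_all
  have segment: "eventually (\<lambda>vs. norm (R (comb smul m a vs)) \<le> norm (R (comb smul n a vs)) + \<epsilon>) F"
    if "normed_by S \<Phi> R" "m \<le> n" "0 < \<epsilon>" for R :: "'v \<Rightarrow> 'z::real_normed_vector" and m a \<epsilon>
  proof (rule filter_leD[OF F(2)])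
    show "eventually (\<lambda>vs. norm (R (comb smul m a vs)) \<le> norm (R (comb smul n a vs)) + \<epsilon>) (tree_filter G n)"
      using eventually_norm_initial_segment[OF that(1) _ that(3,2), of 0 "\<lambda>i. a (Suc i)"] subspace_0[OF subspace]
      by (simp add: comb_def sum.atLeast1_atMost_eq)
  qed
  have r_mono: "r (basis_sum m a) \<le> r (basis_sum n a)" if "m \<le> n" for m a
  proof (rule field_le_epsilon)
    fix \<epsilon> :: real assume "0 < \<epsilon>"
    from segment[OF normed_id that this] show "r (basis_sum m a) \<le> r (basis_sum n a) + \<epsilon>"
      by (rule tendsto_le[OF F(1) tendsto_add[OF r_sum[OF order_refl] tendsto_const] r_sum[OF that]])
  qed
  have \<rho>_mono: "\<rho> (basis_sum m a) \<le> \<rho> (basis_sum n a)" if "m \<le> n" for m a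
  proof (rule field_le_epsilon)
    fix \<epsilon> :: real assume "0 < \<epsilon>"
    from segment[OF normed_T that this] show "\<rho> (basis_sum m a) \<le> \<rho> (basis_sum n a) + \<epsilon>"
      by (rule tendsto_le[OF F(1) tendsto_add[OF \<rho>_sum[OF order_refl] tendsto_const] \<rho>_sum[OF that]])
  qed
  have r_unit: "r (basis_vec i) = 1" if i: "i \<in> {1..n}" for i
  proof -
    have "comb smul n (basis_vec i) vs = vs ! (i - 1)" for vs
    proof -
      have "comb smul n (basis_vec i) vs = (\<Sum>j=1..n. if j = i then vs ! (i - 1) else 0)"
        unfolding comb_def by (intro sum.cong) (auto simp: basis_vec_def)
      then show ?thesis using i by simp
    qed
    then have "eventually (\<lambda>vs. norm (comb smul n (basis_vec i) vs) = 1) F"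
      using i by (intro eventually_mono[OF Ftree]) (auto simp: tree_def)
    then have "((\<lambda>vs. norm (comb smul n (basis_vec i) vs)) \<longlongrightarrow> 1) F" by (rule tendsto_eventually)
    then show ?thesis using tendsto_unique[OF F(1) r] by blast
  qed
  \<comment> \<open>A multiple of a basis vector is the difference of two initial segments, whose norms vanish by monotonicity.\<close>
  have r_definite: "a = (\<lambda>_. 0)" if a: "a \<in> coord_space n" "r a = 0" for a
  proof (rule ext)
    fix i show "a i = 0"
    proof (cases "i \<in> {1..n}")
      case True
      have z: "r (basis_sum m a) = 0" if "m \<le> n" for m
        using r_mono[OF that, of a] r_nonneg[of "basis_sum m a"] a(2) by (simp add: r_basis)
      have "(\<lambda>j. a i * basis_vec i j) = (\<lambda>j. basis_sum i a j + (-1) * basis_sum (i - 1) a j)"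
        using True by (intro ext) (auto simp: basis_sum_eq basis_vec_def)
      then have "norm (a i) * r (basis_vec i) \<le> r (basis_sum i a) + norm (-1 :: 'k) * r (basis_sum (i - 1) a)"
        using r_add[of "basis_sum i a" "\<lambda>j. (-1) * basis_sum (i - 1) a j"] by (simp only: r_scale flip: r_scale[of "a i"])
      moreover have "r (basis_sum i a) = 0" "r (basis_sum (i - 1) a) = 0" using True by (auto intro!: z)
      ultimately show ?thesis using True by (simp add: r_unit)
    qed (use a(1) in \<open>auto simp: coord_space_def\<close>)
  qed
  have approx: "eventually (approximates smul T n \<delta> r \<rho>) F" if \<delta>: "0 < \<delta>" for \<delta>
  proof -
    define L where "L = \<bar>onorm_on S T\<bar>"
    \<comment> \<open>\<open>\<tau>\<close> bounds the change of the norms, and \<open>L * \<tau>\<close> that of the seminorms, on passing from \<open>a\<close> to a net point; each occurs twice.\<close>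
    define \<tau> where "\<tau> = \<delta> / (8 * (L + 1))"
    have "0 \<le> L" by (simp add: L_def)
    then have \<tau>: "0 < \<tau>" using \<delta> by (simp add: \<tau>_def)
    have "(L + 1) * \<tau> = \<delta> / 8" using \<open>0 \<le> L\<close> by (simp add: \<tau>_def field_simps)
    then have L\<tau>: "L * \<tau> + \<tau> = \<delta> / 8" by (simp add: algebra_simps)
    have L\<tau>0: "0 \<le> L * \<tau>" using \<open>0 \<le> L\<close> \<tau> by simp
    have "0 < \<tau> / (real n + 1)" using \<tau> by simp
    then obtain E where E: "finite E" "E \<subseteq> {a. \<forall>i\<in>{1..n}. norm (a i :: 'k) \<le> 1}"
      "\<And>a. a \<in> {a. \<forall>i\<in>{1..n}. norm (a i :: 'k) \<le> 1} \<Longrightarrow> \<exists>e\<in>E. \<forall>i\<in>{1..n}. norm (a i - e i) < \<tau> / (real n + 1)"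
      by (rule finite_net[of "{1..n}" "{a. \<forall>i\<in>{1..n}. norm (a i :: 'k) \<le> 1}" "\<lambda>i a. a i" 1, rotated 2]) auto
    have "eventually (\<lambda>vs. \<bar>norm (comb smul n e vs) - r e\<bar> < \<delta> / 2 \<and>
        \<bar>norm (T (comb smul n e vs)) - \<rho> e\<bar> < \<delta> / 2) F" for e
      using tendstoD[OF r[of e], of "\<delta> / 2"] tendstoD[OF \<rho>[of e], of "\<delta> / 2"] \<delta>
      by (simp add: dist_real_def eventually_conj_iff)
    then have "eventually (\<lambda>vs. \<forall>e\<in>E. \<bar>norm (comb smul n e vs) - r e\<bar> < \<delta> / 2 \<and>
        \<bar>norm (T (comb smul n e vs)) - \<rho> e\<bar> < \<delta> / 2) F"
      using E(1) by (simp add: eventually_ball_finite_distrib)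
    with Ftree show ?thesis
    proof eventually_elim
      case (elim vs)
      show ?case unfolding approximates_def r_basis \<rho>_basis
      proof (intro allI impI)
        fix a :: "nat \<Rightarrow> 'k" assume "\<forall>i\<in>{1..n}. norm (a i) \<le> 1"
        then obtain e where e: "e \<in> E" "\<And>i. i \<in> {1..n} \<Longrightarrow> norm (a i - e i) < \<tau> / (real n + 1)" using E(3)[of a] by blast
        define d where "d i = a i - e i" for i
        have d: "(\<Sum>i=1..n. norm (d i)) \<le> \<tau>"
        proof -
          have "(\<Sum>i=1..n. norm (d i)) \<le> real (card {1..n}) * (\<tau> / (real n + 1))"
            using e(2) by (intro sum_bounded_above) (auto simp: d_def intro: less_imp_le)
          also have "\<dots> \<le> \<tau>" using \<tau> by (simp add: field_simps)
          finally show ?thesis .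
        qed
        have a: "a = (\<lambda>i. e i + d i)" and e': "e = (\<lambda>i. a i + (-1) * d i)" by (auto simp: d_def)
        have ca: "comb smul n a vs = comb smul n e vs + comb smul n d vs" by (subst a) (rule comb_add)
        have S: "comb smul n d vs \<in> S" using elim(1) by (rule tree_S)
        have nd: "norm (comb smul n d vs) \<le> \<tau>"
          using tree_le[OF elim(1), of d] d by simp
        have nTd: "norm (T (comb smul n d vs)) \<le> L * \<tau>"
        proof -
          have "norm (T (comb smul n d vs)) \<le> onorm_on S T * norm (comb smul n d vs)" using S by (rule norm_T_le)
          also have "\<dots> \<le> L * \<tau>" using nd by (intro mult_mono) (auto simp: L_def)
          finally show ?thesis .
        qed
        have rd: "r d \<le> \<tau>" using r_le[of d] d by simp
        have "\<rho> d \<le> L * \<tau>"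
        proof -
          have "\<rho> d \<le> onorm_on S T * r d" by (rule \<rho>_le)
          also have "\<dots> \<le> L * \<tau>" using rd r_nonneg[of d] by (intro mult_mono) (auto simp: L_def)
          finally show ?thesis .
        qed
        moreover have "\<rho> a \<le> \<rho> e + \<rho> d" "\<rho> e \<le> \<rho> a + \<rho> d"
          using \<rho>_add[of e d, folded a] \<rho>_add[of a "\<lambda>i. (-1) * d i", folded e'] by (simp_all only: \<rho>_scale) simp_all
        moreover have "r a \<le> r e + r d" "r e \<le> r a + r d"
          using r_add[of e d, folded a] r_add[of a "\<lambda>i. (-1) * d i", folded e'] by (simp_all only: r_scale) simp_all
        moreover have "\<bar>norm (comb smul n a vs) - norm (comb smul n e vs)\<bar> \<le> \<tau>"
          unfolding ca using nd norm_triangle_ineq3[of "comb smul n e vs + comb smul n d vs" "comb smul n e vs"] by simp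
        moreover have "\<bar>norm (T (comb smul n a vs)) - norm (T (comb smul n e vs))\<bar> \<le> L * \<tau>"
          unfolding ca T_add using nTd norm_triangle_ineq3[of "T (comb smul n e vs) + T (comb smul n d vs)" "T (comb smul n e vs)"] by simp
        moreover have "\<bar>norm (comb smul n e vs) - r e\<bar> < \<delta> / 2" "\<bar>norm (T (comb smul n e vs)) - \<rho> e\<bar> < \<delta> / 2"
          using elim(2) e(1) by blast+
        ultimately show "\<bar>norm (comb smul n a vs) - r a\<bar> < \<delta> \<and> \<bar>norm (T (comb smul n a vs)) - \<rho> a\<bar> < \<delta>"
          using rd L\<tau> L\<tau>0 \<tau> \<delta> by linarith
      qed
    qed
  qed
  have fr: "frequently (\<lambda>vs. P vs \<and> approximates smul T n \<delta> r \<rho> vs) (tree_filter G n)" if "0 < \<delta>" for \<delta>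
  proof -
    have "eventually (\<lambda>vs. P vs \<and> approximates smul T n \<delta> r \<rho> vs) F"
      using F(3) approx[OF that] by (rule eventually_conj)
    then have "frequently (\<lambda>vs. P vs \<and> approximates smul T n \<delta> r \<rho> vs) F"
      by (rule eventually_frequently[OF F(1)])
    then show ?thesis unfolding frequently_def by (rule contrapos_nn) (rule filter_leD[OF F(2)])
  qed
  show ?thesis
  proof (rule that)
    show "(r, \<rho>) \<in> asymptotic_pairs S smul \<Phi> T n"
      unfolding asymptotic_pairs_def asymptotic_pairs_tree_filter
    proof (intro CollectI case_prodI conjI allI impI ballI)
      show sr: "norm_on_coord n r"
        using r_nonneg r_add r_scale r_definite by (simp add: norm_on_coord_def seminorm_on_coord_def)
      show "seminorm_on_coord n \<rho>"
        using \<rho>_nonneg \<rho>_add \<rho>_scale by (simp add: seminorm_on_coord_def)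
      fix \<delta> :: real assume "0 < \<delta>"
      from fr[OF this] show "frequently (approximates smul T n \<delta> r \<rho>) (tree_filter G n)"
        by (rule frequently_elim1) simp
    qed (simp_all add: r_unit r_mono \<rho>_mono \<rho>_le)
  qed (rule fr)
qed

end

section \<open>The weak and the weak* setting\<close>

lemma norm_blinfun_attained:
  fixes f :: "'v::real_normed_vector \<Rightarrow>\<^sub>L 'w::real_normed_vector"
  assumes "0 < \<epsilon>"
  obtains x where "norm x \<le> 1" "norm f - \<epsilon> \<le> norm (f \<cdot> x)"
proof (rule ccontr)
  assume "\<not> thesis"
  then have less: "norm (f \<cdot> x) < norm f - \<epsilon>" if "norm x \<le> 1" for x
    using that \<open>\<And>x. norm x \<le> 1 \<Longrightarrow> norm f - \<epsilon> \<le> norm (f \<cdot> x) \<Longrightarrow> thesis\<close> by force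
  from less[of 0] have pos: "0 < norm f - \<epsilon>" by simp
  have "norm f \<le> norm f - \<epsilon>"
  proof (rule norm_blinfun_bound)
    fix x show "norm (f \<cdot> x) \<le> (norm f - \<epsilon>) * norm x"
    proof (cases "x = 0")
      case False
      then have "norm (f \<cdot> ((1 / norm x) *\<^sub>R x)) < norm f - \<epsilon>" by (intro less) simp
      then show ?thesis using False by (simp add: blinfun.scaleR_right field_simps)
    qed simp
  qed (use pos in simp)
  with assms show False by simp
qed

lemma adjoint_op_apply [simp]: "(adjoint_op A f) \<cdot> x = f \<cdot> (A \<cdot> x)"
  by (simp add: adjoint_op_def)

lemma adjoint_op_in_dual:
  "linear_over scaleX scaleY A \<Longrightarrow> f \<in> dual scaleY \<Longrightarrow> adjoint_op A f \<in> dual scaleX"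
  by (simp add: dual_def linear_over_def)

lemma norm_adjoint_op_le: "norm (adjoint_op A f) \<le> norm A * norm f"
  unfolding adjoint_op_def by (metis mult.commute norm_blinfun_compose)

lemma weak_setting:
  fixes A :: "'x::banach \<Rightarrow>\<^sub>L 'y::banach" and scaleX :: "'k::real_or_complex \<Rightarrow> 'x \<Rightarrow> 'x"
  assumes X: "banach_over scaleX" and Y: "banach_over scaleY" and A: "linear_over scaleX scaleY A"
  shows "asymptotic_setting scaleX UNIV (weak_functionals scaleX) (blinfun_apply A)"
proof -
  interpret X: banach_over scaleX by fact
  interpret Y: banach_over scaleY by fact
  have Asmul: "A \<cdot> (scaleX c x) = scaleY c (A \<cdot> x)" for c x
    using A by (simp add: linear_over_def)
  show ?thesis
  proof
    show "\<exists>M. \<forall>x\<in>UNIV. norm (A \<cdot> x) \<le> M * norm x" using norm_blinfun by blast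
    show "normed_by UNIV (weak_functionals scaleX) (\<lambda>x. x)"
      unfolding normed_by_def
    proof (intro ballI allI impI)
      fix v :: 'x and \<epsilon> :: real assume "0 < \<epsilon>"
      obtain f where f: "f \<in> dual scaleX" "norm f \<le> 1" "norm (f \<cdot> v) = norm v"
        by (rule norming_functional[OF X])
      have "norm (f \<cdot> w) \<le> norm w" for w
        using norm_blinfun[of f w] f(2) mult_right_mono[OF f(2), of "norm w"] by simp
      then show "\<exists>\<phi>\<in>weak_functionals scaleX. norm v - \<epsilon> \<le> norm (\<phi> v) \<and> (\<forall>w\<in>UNIV. norm (\<phi> w) \<le> norm w)"
        using f(1,3) \<open>0 < \<epsilon>\<close> unfolding weak_functionals_def by (intro bexI[of _ "blinfun_apply f"]) auto
    qed
    show "normed_by UNIV (weak_functionals scaleX) (blinfun_apply A)"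
      unfolding normed_by_def
    proof (intro ballI allI impI)
      fix v :: 'x and \<epsilon> :: real assume "0 < \<epsilon>"
      obtain f where f: "f \<in> dual scaleY" "norm f \<le> 1" "norm (f \<cdot> (A \<cdot> v)) = norm (A \<cdot> v)"
        by (rule norming_functional[OF Y])
      have "norm (f \<cdot> w) \<le> norm w" for w
        using norm_blinfun[of f w] f(2) mult_right_mono[OF f(2), of "norm w"] by simp
      then show "\<exists>\<phi>\<in>weak_functionals scaleX. norm (A \<cdot> v) - \<epsilon> \<le> norm (\<phi> v) \<and>
          (\<forall>w\<in>UNIV. norm (\<phi> w) \<le> norm (A \<cdot> w))"
        using f(3) adjoint_op_in_dual[OF A f(1)] \<open>0 < \<epsilon>\<close> unfolding weak_functionals_def
        by (intro bexI[of _ "blinfun_apply (adjoint_op A f)"]) auto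
    qed
  qed (auto simp: X.norm_smul Asmul Y.norm_smul weak_functionals_def dual_def blinfun.add_right)
qed

lemma weakstar_setting:
  fixes A :: "'x::banach \<Rightarrow>\<^sub>L 'y::banach" and scaleY :: "'k::real_or_complex \<Rightarrow> 'y \<Rightarrow> 'y"
  shows "asymptotic_setting dual_scale (dual scaleY) weakstar_functionals (adjoint_op A)"
proof -
  interpret D: vector_space "dual_scale :: 'k \<Rightarrow> ('y \<Rightarrow>\<^sub>L 'k) \<Rightarrow> _" by (rule vector_space_dual_scale)
  show ?thesis
  proof
    show "D.subspace (dual scaleY)" by (rule subspace_dual)
    show "adjoint_op A (x + y) = adjoint_op A x + adjoint_op A y" for x y :: "'y \<Rightarrow>\<^sub>L 'k"
      by (rule blinfun_eqI) (simp add: blinfun.add_left)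
    show "norm (adjoint_op A (dual_scale c x)) = norm c * norm (adjoint_op A x)" for c :: 'k and x
    proof -
      have "adjoint_op A (dual_scale c x) = dual_scale c (adjoint_op A x)" by (rule blinfun_eqI) simp
      then show ?thesis by (simp add: norm_dual_scale)
    qed
    show "\<exists>M. \<forall>x\<in>dual scaleY. norm (adjoint_op A x) \<le> M * norm x" using norm_adjoint_op_le by blast
    show "normed_by (dual scaleY) weakstar_functionals (\<lambda>x. x)"
      unfolding normed_by_def
    proof (intro ballI allI impI)
      fix f :: "'y \<Rightarrow>\<^sub>L 'k" and \<epsilon> :: real assume "0 < \<epsilon>"
      then obtain y where y: "norm y \<le> 1" "norm f - \<epsilon> \<le> norm (f \<cdot> y)"
        by (rule norm_blinfun_attained)
      have "norm (g \<cdot> y) \<le> norm g" for g :: "'y \<Rightarrow>\<^sub>L 'k"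
        using norm_blinfun[of g y] mult_left_mono[OF y(1), of "norm g"] by simp
      then show "\<exists>\<phi>\<in>weakstar_functionals. norm f - \<epsilon> \<le> norm (\<phi> f) \<and> (\<forall>w\<in>dual scaleY. norm (\<phi> w) \<le> norm w)"
        using y(2) unfolding weakstar_functionals_def by (intro bexI[of _ "\<lambda>f. f \<cdot> y"]) auto
    qed
    show "normed_by (dual scaleY) weakstar_functionals (adjoint_op A)"
      unfolding normed_by_def
    proof (intro ballI allI impI)
      fix f :: "'y \<Rightarrow>\<^sub>L 'k" and \<epsilon> :: real assume "0 < \<epsilon>"
      then obtain x where x: "norm x \<le> 1" "norm (adjoint_op A f) - \<epsilon> \<le> norm ((adjoint_op A f) \<cdot> x)"
        by (rule norm_blinfun_attained)
      have "norm (g \<cdot> (A \<cdot> x)) \<le> norm (adjoint_op A g)" for g :: "'y \<Rightarrow>\<^sub>L 'k"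
        using norm_blinfun[of "adjoint_op A g" x] mult_left_mono[OF x(1), of "norm (adjoint_op A g)"] by simp
      then show "\<exists>\<phi>\<in>weakstar_functionals. norm (adjoint_op A f) - \<epsilon> \<le> norm (\<phi> f) \<and>
          (\<forall>w\<in>dual scaleY. norm (\<phi> w) \<le> norm (adjoint_op A w))"
        using x(2) unfolding weakstar_functionals_def
        by (intro bexI[of _ "\<lambda>f. f \<cdot> (A \<cdot> x)"]) auto
    qed
  qed (auto simp: norm_dual_scale weakstar_functionals_def blinfun.add_left)
qed

definition dual_ball :: "('k::real_or_complex \<Rightarrow> 'v::real_normed_vector \<Rightarrow> 'v) \<Rightarrow> ('v \<Rightarrow>\<^sub>L 'k) set" where
  "dual_ball smul = {f \<in> dual smul. norm f \<le> 1}"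

text \<open>The Banach--Alaoglu theorem for the functionals that are linear over the scalar field: the linear functions form
  a closed subset of a product of balls.\<close>

theorem compact_dual_ball:
  fixes smul :: "'k::real_or_complex \<Rightarrow> 'v::banach \<Rightarrow> 'v"
  assumes "banach_over smul"
  shows "compact (blinfun_apply ` dual_ball smul)"
proof -
  interpret banach_over smul by fact
  define B :: "('v \<Rightarrow> 'k) set" where "B = {g. \<forall>y. g y \<in> cball 0 (norm y)}"
  define L :: "('v \<Rightarrow> 'k) set" where
    "L = {g. (\<forall>x y. g (x + y) = g x + g y) \<and> (\<forall>c x. g (smul c x) = c * g x)}"
  have "closed L"
  proof -
    have c: "continuous_on UNIV (\<lambda>g :: 'v \<Rightarrow> 'k. g x)" for x by (rule continuous_on_product_coordinates)
    have "closed {g :: 'v \<Rightarrow> 'k. \<forall>x y. g (x + y) = g x + g y}"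
      by (intro closed_Collect_all closed_Collect_eq continuous_on_add c)
    moreover have "closed {g :: 'v \<Rightarrow> 'k. \<forall>k x. g (smul k x) = k * g x}"
      by (intro closed_Collect_all closed_Collect_eq continuous_on_mult_left c)
    ultimately show ?thesis unfolding L_def by (rule closed_Collect_conj)
  qed
  moreover have "compact B" unfolding B_def by (rule compact_product) (rule compact_scalar_cball)
  ultimately have "compact (B \<inter> L)" by (simp add: compact_Int_closed)
  also have "B \<inter> L = blinfun_apply ` dual_ball smul"
  proof (intro equalityI subsetI)
    fix g assume g: "g \<in> B \<inter> L"
    have bl: "bounded_linear g"
    proof (rule bounded_linear_intro[where K = 1])
      fix r x show "g (r *\<^sub>R x) = r *\<^sub>R g x"
        using g by (simp add: L_def scaleR_conv_of_real flip: smul_of_real)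
    qed (use g in \<open>auto simp: B_def L_def\<close>)
    have "norm (Blinfun g) \<le> 1"
      using g by (intro norm_blinfun_bound) (auto simp: bounded_linear_Blinfun_apply[OF bl] B_def)
    then show "g \<in> blinfun_apply ` dual_ball smul"
      using g by (intro image_eqI[of _ _ "Blinfun g"]) (auto simp: bounded_linear_Blinfun_apply[OF bl] dual_def dual_ball_def L_def)
  next
    fix g assume "g \<in> blinfun_apply ` dual_ball smul"
    then obtain f where f: "g = blinfun_apply f" "f \<in> dual smul" "norm f \<le> 1"
      by (auto simp: dual_ball_def)
    have "norm (f \<cdot> w) \<le> norm w" for w
      using norm_blinfun[of f w] mult_right_mono[OF f(3), of "norm w"] by simp
    then show "g \<in> B \<inter> L" using f by (auto simp: B_def L_def dual_def blinfun.add_right)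
  qed
  finally show ?thesis .
qed

lemma frequently_weakstar_cluster:
  fixes smul :: "'k::real_or_complex \<Rightarrow> 'v::banach \<Rightarrow> 'v"
  assumes "banach_over smul" and fr: "frequently (\<lambda>x. \<exists>g\<in>dual_ball smul. Q x g) F"
  obtains g where "g \<in> dual_ball smul"
    "\<And>Y \<epsilon>. finite Y \<Longrightarrow> 0 < (\<epsilon>::real) \<Longrightarrow> frequently (\<lambda>x. \<exists>h\<in>dual_ball smul.
       (\<forall>y\<in>Y. norm (h \<cdot> y - g \<cdot> y) < \<epsilon>) \<and> Q x h) F"
proof -
  define K where "K = blinfun_apply ` dual_ball smul"
  define R where "R x g \<longleftrightarrow> (\<exists>f\<in>dual_ball smul. g = blinfun_apply f \<and> Q x f)" for x g
  have K: "compact K" unfolding K_def by (rule compact_dual_ball[OF assms(1)])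
  have "frequently (\<lambda>x. \<exists>g\<in>K. R x g) F"
    by (rule frequently_elim1[OF fr]) (auto simp: K_def R_def)
  from frequently_compact_cluster[OF K this] obtain g' where g': "g' \<in> K"
    "\<And>V. open V \<Longrightarrow> g' \<in> V \<Longrightarrow> frequently (\<lambda>x. \<exists>h\<in>K \<inter> V. R x h) F" by blast
  obtain g where g: "g \<in> dual_ball smul" "g' = blinfun_apply g" using g'(1) by (auto simp: K_def)
  show ?thesis
  proof (rule that[OF g(1)])
    fix Y :: "'v set" and \<epsilon> :: real assume Y: "finite Y" "0 < \<epsilon>"
    define V where "V = (\<Inter>y\<in>Y. {h. norm (h y - g' y) < \<epsilon>})"
    have "open V" unfolding V_def
      by (intro open_INT Y ballI open_Collect_less continuous_on_norm continuous_on_diff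
          continuous_on_product_coordinates continuous_on_const)
    moreover have "g' \<in> V" using Y by (simp add: V_def)
    ultimately have "frequently (\<lambda>x. \<exists>h\<in>K \<inter> V. R x h) F" by (rule g'(2))
    then show "frequently (\<lambda>x. \<exists>h\<in>dual_ball smul.
       (\<forall>y\<in>Y. norm (h \<cdot> y - g \<cdot> y) < \<epsilon>) \<and> Q x h) F"
      by (rule frequently_elim1) (auto simp: R_def V_def g(2))
  qed
qed

section \<open>From weak*-null trees to weakly null trees\<close>

locale operator_between =
  fixes scaleX :: "'k::real_or_complex \<Rightarrow> 'x::banach \<Rightarrow> 'x"
    and scaleY :: "'k \<Rightarrow> 'y::banach \<Rightarrow> 'y"
    and A :: "'x \<Rightarrow>\<^sub>L 'y"
  assumes X: "banach_over scaleX" and Y: "banach_over scaleY" and A: "linear_over scaleX scaleY A"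
begin

abbreviation weak_filter :: "'x filter" where
  "weak_filter \<equiv> sphere_filter UNIV (weak_functionals scaleX)"

abbreviation weakstar_filter :: "('y \<Rightarrow>\<^sub>L 'k) filter" where
  "weakstar_filter \<equiv> sphere_filter (dual scaleY) weakstar_functionals"

end

text \<open>The main step from functionals to vectors. Let \<open>F\<close> and \<open>\<epsilon>\<close> describe a weak neighbourhood of 0. Choose a finite
  set \<open>E\<close> in the unit ball such that every point of the ball is close to a point of \<open>E\<close> for the functionals in \<open>F\<close>,
  and then a functional \<open>f\<close> which is small on \<open>A E\<close>. If \<open>x\<close> almost norms \<open>A* f\<close> and \<open>e \<in> E\<close> is close to \<open>x\<close>,
  then \<open>x - e\<close> lies in the neighbourhood, has norm at most 2 and satisfies \<open>f (A (x - e)) \<approx> \<parallel>A* f\<parallel>\<close>.\<close>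

lemma (in operator_between) almost_norming_vector_step:
  assumes inf: "\<not> finite_dim scaleX"
    and fr: "frequently W weakstar_filter"
    and fin: "finite U" "U \<subseteq> dual scaleY" "finite V" and \<delta>: "0 < \<delta>"
  shows "frequently (\<lambda>x. norm x = 1 \<and> (\<exists>f. W f \<and> f \<in> dual scaleY \<and> norm f = 1 \<and>
      (\<forall>v\<in>V. norm (f \<cdot> (A \<cdot> v)) < \<delta>) \<and>
      (\<forall>u\<in>U. norm (u \<cdot> (A \<cdot> x)) < \<delta>) \<and>
      norm (adjoint_op A f) - \<delta> \<le> 2 * norm (f \<cdot> (A \<cdot> x))))
    weak_filter"
  unfolding frequently_sphere_filter[of _ UNIV]
proof (intro allI impI)
  fix F and \<epsilon> :: real assume F: "finite F" "F \<subseteq> weak_functionals scaleX" and \<epsilon>: "0 < \<epsilon>"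
  obtain H0 where H0: "finite H0" "H0 \<subseteq> dual scaleX" "F = blinfun_apply ` H0"
    using finite_subset_image[OF F(1) F(2)[unfolded weak_functionals_def]] by blast
  define H where "H = H0 \<union> adjoint_op A ` U"
  have H: "finite H" "H \<subseteq> dual scaleX"
    using H0 fin adjoint_op_in_dual[OF A] by (auto simp: H_def)
  define \<epsilon>' where "\<epsilon>' = min \<epsilon> \<delta>"
  \<comment> \<open>The second bound keeps \<open>x - e\<close> weakly small after normalization: its norm is at least \<open>\<delta> / (2 * norm A)\<close>.\<close>
  define \<eta> where "\<eta> = min (\<delta> / 4) (\<epsilon>' * \<delta> / (2 * (norm A + 1)))"
  have A0: "0 < norm A + 1" by (simp add: add_nonneg_pos)
  have \<epsilon>': "0 < \<epsilon>'" using \<epsilon> \<delta> by (simp add: \<epsilon>'_def)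
  then have "0 < \<eta>" using \<delta> A0 by (simp add: \<eta>_def)
  moreover have "\<eta> \<le> \<delta> / 4" unfolding \<eta>_def by (rule min.cobounded1)
  ultimately have \<eta>: "0 < \<eta>" "\<eta> \<le> \<delta> / 4" by simp_all
  have "\<eta> \<le> \<epsilon>' * \<delta> / (2 * (norm A + 1))" by (simp add: \<eta>_def)
  then have "\<eta> * (2 * (norm A + 1)) \<le> \<epsilon>' * \<delta>" using A0 by (simp add: pos_le_divide_eq)
  then have \<eta>A: "2 * \<eta> * norm A < \<epsilon>' * \<delta>" using \<eta>(1) by (simp add: algebra_simps)
  have bd: "norm (f \<cdot> x) \<le> (\<Sum>f\<in>H. norm f)" if "x \<in> cball 0 1" "f \<in> H" for x f
  proof -
    have "norm (f \<cdot> x) \<le> norm f * norm x" by (rule norm_blinfun)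
    also have "\<dots> \<le> norm f" using mult_left_mono[of "norm x" 1 "norm f"] that(1) by simp
    also have "\<dots> \<le> (\<Sum>f\<in>H. norm f)" using H(1) that(2) by (intro member_le_sum) auto
    finally show ?thesis .
  qed
  obtain E where E: "finite E" "E \<subseteq> cball 0 1"
    "\<And>x. x \<in> cball 0 1 \<Longrightarrow> \<exists>e\<in>E. \<forall>f\<in>H. norm (f \<cdot> x - f \<cdot> e) < \<eta>"
    using finite_net[where g = blinfun_apply and A = "cball 0 1" and I = H, OF H(1) bd \<eta>(1)] by metis
  define ev where "ev x = (\<lambda>f :: 'y \<Rightarrow>\<^sub>L 'k. f \<cdot> (A \<cdot> x))" for x
  have "finite (ev ` (E \<union> V))" "ev ` (E \<union> V) \<subseteq> weakstar_functionals" "0 < min \<eta> \<delta>"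
    using E(1) fin(3) \<eta>(1) \<delta> by (auto simp: ev_def weakstar_functionals_def)
  then obtain f where f: "f \<in> dual scaleY" "norm f = 1" "\<forall>\<phi>\<in>ev ` (E \<union> V). norm (\<phi> f) < min \<eta> \<delta>" "W f"
    using fr unfolding frequently_sphere_filter by meson
  have fE: "norm (f \<cdot> (A \<cdot> e)) < \<eta>" if "e \<in> E" for e
    using f(3) that by (auto simp: ev_def)
  have fV: "\<forall>v\<in>V. norm (f \<cdot> (A \<cdot> v)) < \<delta>"
    using f(3) by (auto simp: ev_def)
  have "\<exists>x. norm x = 1 \<and> (\<forall>h\<in>H. norm (h \<cdot> x) < \<epsilon>') \<and>
      norm (adjoint_op A f) - \<delta> \<le> 2 * norm (f \<cdot> (A \<cdot> x))"
  \<comment> \<open>If \<open>A* f\<close> is tiny, nothing has to be normed, and any weakly small unit vector will do.\<close>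
  proof (cases "norm (adjoint_op A f) < \<delta>")
    case True
    obtain x where x: "norm x = 1" "\<And>h. h \<in> H \<Longrightarrow> h \<cdot> x = 0"
      using infinite_dim_annihilated_vector[OF X inf H] by blast
    have "norm (adjoint_op A f) - \<delta> \<le> 2 * norm (f \<cdot> (A \<cdot> x))"
      using True by (smt (verit) norm_ge_zero)
    with x \<epsilon>' show ?thesis by (intro exI[of _ x]) auto
  next
    case False
    obtain x where x: "norm x \<le> 1" "norm (adjoint_op A f) - \<eta> \<le> norm ((adjoint_op A f) \<cdot> x)"
      by (rule norm_blinfun_attained[OF \<eta>(1)])
    then obtain e where e: "e \<in> E" "\<And>h. h \<in> H \<Longrightarrow> norm (h \<cdot> x - h \<cdot> e) < \<eta>"
      using E(3)[of x] by auto
    define z where "z = x - e"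
    define w where "w = norm (f \<cdot> (A \<cdot> z))"
    have "norm z \<le> norm x + norm e" unfolding z_def by (rule norm_triangle_ineq4)
    then have z2: "norm z \<le> 2" using x(1) e(1) E(2) by force
    have "norm (f \<cdot> (A \<cdot> x)) \<le> w + norm (f \<cdot> (A \<cdot> e))"
      using norm_triangle_ineq[of "f \<cdot> (A \<cdot> z)" "f \<cdot> (A \<cdot> e)"]
      by (simp add: w_def z_def blinfun.diff_right)
    then have w: "norm (adjoint_op A f) - 2 * \<eta> \<le> w" using x(2) fE[OF e(1)] by simp
    then have w2: "\<delta> / 2 \<le> w" using False \<eta>(2) by simp
    have "w \<le> norm f * norm (A \<cdot> z)" unfolding w_def by (rule norm_blinfun)
    also have "\<dots> \<le> norm A * norm z" using norm_blinfun[of A z] f(2) by simp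
    finally have wA: "w \<le> norm A * norm z" .
    then have z0: "0 < norm z" using w2 \<delta> by (cases "z = 0") auto
    have small: "norm (h \<cdot> ((1 / norm z) *\<^sub>R z)) < \<epsilon>'" if h: "h \<in> H" for h
    proof -
      have "norm A * (2 * \<eta>) < \<epsilon>' * (norm A * norm z * 2)"
      proof -
        have "\<epsilon>' * \<delta> \<le> \<epsilon>' * (norm A * norm z * 2)" using w2 wA \<epsilon>' by (intro mult_left_mono) auto
        then show ?thesis using \<eta>A by (simp add: algebra_simps)
      qed
      then have "norm A * \<eta> < norm A * (\<epsilon>' * norm z)" by (simp add: algebra_simps)
      then have "\<eta> < \<epsilon>' * norm z" by (rule mult_left_less_imp_less) simp
      moreover have "norm (h \<cdot> z) < \<eta>" using e(2)[OF h] by (simp add: z_def blinfun.diff_right)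
      ultimately show ?thesis using z0 by (simp add: blinfun.scaleR_right field_simps)
    qed
    have "norm (adjoint_op A f) - \<delta> \<le> w" using w \<eta> by simp
    also have "w \<le> 2 * (w / norm z)"
    proof -
      have "w * norm z \<le> w * 2" using z2 w2 \<delta> by (intro mult_left_mono) auto
      then show ?thesis using z0 by (simp add: field_simps)
    qed
    also have "w / norm z = norm (f \<cdot> (A \<cdot> ((1 / norm z) *\<^sub>R z)))"
      by (simp add: blinfun.scaleR_right w_def)
    finally show ?thesis using small z0 by (intro exI[of _ "(1 / norm z) *\<^sub>R z"]) auto
  qed
  then obtain x where x: "norm x = 1" "\<And>h. h \<in> H \<Longrightarrow> norm (h \<cdot> x) < \<epsilon>'"
    "norm (adjoint_op A f) - \<delta> \<le> 2 * norm (f \<cdot> (A \<cdot> x))" by blast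
  have "norm (\<phi> x) < \<epsilon>" if "\<phi> \<in> F" for \<phi>
    using that x(2) by (auto simp: H0(3) H_def \<epsilon>'_def)
  moreover have "norm (u \<cdot> (A \<cdot> x)) < \<delta>" if "u \<in> U" for u
    using that x(2)[of "adjoint_op A u"] by (auto simp: H_def \<epsilon>'_def)
  ultimately show "\<exists>x\<in>UNIV. norm x = 1 \<and> (\<forall>\<phi>\<in>F. norm (\<phi> x) < \<epsilon>) \<and> norm x = 1 \<and>
      (\<exists>f. W f \<and> f \<in> dual scaleY \<and> norm f = 1 \<and>
      (\<forall>v\<in>V. norm (f \<cdot> (A \<cdot> v)) < \<delta>) \<and>
      (\<forall>u\<in>U. norm (u \<cdot> (A \<cdot> x)) < \<delta>) \<and>
      norm (adjoint_op A f) - \<delta> \<le> 2 * norm (f \<cdot> (A \<cdot> x)))"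
    using x(1,3) f(1,2,4) fV by blast
qed

text \<open>Lists are indexed from 0, coordinates from 1.\<close>

lemma comb_lessThan: "comb smul n a vs = (\<Sum>i<n. smul (a (Suc i)) (vs ! i))"
  by (simp add: comb_def sum.atLeast1_atMost_eq)

lemma comb_basis_vec:
  assumes "vector_space smul" "i < n"
  shows "comb smul n (basis_vec (Suc i)) vs = vs ! i"
proof -
  interpret vector_space smul by fact
  have "comb smul n (basis_vec (Suc i)) vs = (\<Sum>j<n. if j = i then vs ! i else 0)"
    unfolding comb_lessThan by (intro sum.cong) (auto simp: basis_vec_def)
  then show ?thesis using assms(2) by simp
qed

lemma approximates_basis_vec:
  assumes "approximates smul T n \<delta> r \<rho> vs" "vector_space smul" "i < n"
  shows "\<bar>norm (T (vs ! i)) - \<rho> (basis_vec (Suc i))\<bar> < \<delta>"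
proof -
  have b: "\<forall>j\<in>{1..n}. norm (basis_vec (Suc i) j :: 'a) \<le> 1" by (simp add: basis_vec_def)
  have "basis_sum n (basis_vec (Suc i)) = (basis_vec (Suc i) :: nat \<Rightarrow> 'a)"
    using assms(3) by (intro basis_sum_coord_space basis_vec_in_coord_space) auto
  then show ?thesis
    using assms(1) b comb_basis_vec[OF assms(2,3), of vs] unfolding approximates_def by metis
qed

text \<open>The vectors and functionals chosen so far form the state of the game. Entries above the diagonal are small because
  the vectors are chosen weakly small after the earlier functionals, entries below it because
  the functionals are chosen weak* small after the earlier vectors.\<close>

lemma (in operator_between) frequently_almost_biorthogonal:
  assumes inf: "\<not> finite_dim scaleX"
    and fr: "frequently Q (tree_filter weakstar_filter n)" and \<delta>: "0 < \<delta>"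
  shows "frequently (\<lambda>xs. \<exists>fs. length xs = n \<and> length fs = n \<and> Q fs \<and>
      (\<forall>i<n. norm (xs ! i) = 1 \<and> fs ! i \<in> dual scaleY \<and>
        norm (adjoint_op A (fs ! i)) - \<delta> \<le> 2 * norm ((fs ! i) \<cdot> (A \<cdot> (xs ! i))) \<and>
        (\<forall>j<n. i \<noteq> j \<longrightarrow> norm ((fs ! i) \<cdot> (A \<cdot> (xs ! j))) < \<delta>)))
    (tree_filter weak_filter n)"
proof -
  define good where "good xs fs \<longleftrightarrow> (\<forall>i<length xs. norm (xs ! i) = 1 \<and> fs ! i \<in> dual scaleY \<and>
        norm (adjoint_op A (fs ! i)) - \<delta> \<le> 2 * norm ((fs ! i) \<cdot> (A \<cdot> (xs ! i))) \<and>
        (\<forall>j<length xs. i \<noteq> j \<longrightarrow> norm ((fs ! i) \<cdot> (A \<cdot> (xs ! j))) < \<delta>))"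
    for xs :: "'x list" and fs :: "('y \<Rightarrow>\<^sub>L 'k) list"
  define V where "V k xs fs \<longleftrightarrow> k + length xs = n \<and> length fs = length xs \<and> good xs fs \<and>
      frequently (\<lambda>gs. Q (fs @ gs)) (tree_filter weakstar_filter k)" for k xs fs
  have "V n [] []" using fr by (simp add: V_def good_def)
  then have "frequently (\<lambda>ws. \<exists>s'. V 0 ([] @ ws) s') (tree_filter weak_filter n)"
  proof (rule frequently_tree_filter_game[rotated])
    fix k xs fs assume V: "V (Suc k) xs fs"
    then have len: "Suc k + length xs = n" "length fs = length xs" and good: "good xs fs"
      and next_f: "frequently (\<lambda>f. frequently (\<lambda>gs. Q (fs @ f # gs)) (tree_filter weakstar_filter k)) weakstar_filter"
      by (simp_all add: V_def frequently_tree_filter_Suc)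
    have fsd: "set fs \<subseteq> dual scaleY" using good len(2) by (auto simp: good_def in_set_conv_nth)
    show "frequently (\<lambda>x. \<exists>s'. V k (xs @ [x]) s') weak_filter"
      using almost_norming_vector_step[OF inf next_f finite_set fsd finite_set \<delta>, of xs]
    proof (rule frequently_elim1)
      fix x assume "norm x = 1 \<and> (\<exists>f. frequently (\<lambda>gs. Q (fs @ f # gs)) (tree_filter weakstar_filter k) \<and>
        f \<in> dual scaleY \<and> norm f = 1 \<and>
        (\<forall>v\<in>set xs. norm (f \<cdot> (A \<cdot> v)) < \<delta>) \<and>
        (\<forall>u\<in>set fs. norm (u \<cdot> (A \<cdot> x)) < \<delta>) \<and>
        norm (adjoint_op A f) - \<delta> \<le> 2 * norm (f \<cdot> (A \<cdot> x)))"
      then obtain f where f: "norm x = 1" "frequently (\<lambda>gs. Q (fs @ f # gs)) (tree_filter weakstar_filter k)" "f \<in> dual scaleY"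
        "\<forall>v\<in>set xs. norm (f \<cdot> (A \<cdot> v)) < \<delta>"
        "\<forall>u\<in>set fs. norm (u \<cdot> (A \<cdot> x)) < \<delta>"
        "norm (adjoint_op A f) - \<delta> \<le> 2 * norm (f \<cdot> (A \<cdot> x))" by blast
      have "good (xs @ [x]) (fs @ [f])"
        using good f len(2) unfolding good_def by (auto simp: nth_append less_Suc_eq)
      then have "V k (xs @ [x]) (fs @ [f])" using len f(2) by (simp add: V_def)
      then show "\<exists>s'. V k (xs @ [x]) s'" by blast
    qed
  qed
  then show ?thesis
    by (rule frequently_elim1) (auto simp: V_def good_def)
qed

text \<open>Evaluate \<open>f = \<Sum> a\<^sub>i f\<^sub>i\<close> at \<open>A x\<close>, \<open>x = \<Sum> b'\<^sub>i x\<^sub>i\<close>, where the phases of \<open>b'\<close> make the diagonal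
  terms nonnegative. These terms dominate \<open>\<Sum> \<bar>a\<^sub>i b\<^sub>i\<bar> \<rho>(e\<^sub>i) / 2\<close>, the other ones are negligible, and the whole
  is at most \<open>\<parallel>f\<parallel> \<parallel>A x\<parallel>\<close>, which approximates \<open>r(a) \<rho>'(b')\<close>.\<close>

theorem (in operator_between) weakstar_pair_dominated:
  assumes inf: "\<not> finite_dim scaleX"
    and pair: "(r, \<rho>) \<in> weakstar_asymptotic_structure scaleY A n"
    and a: "\<And>i. i \<in> {1..n} \<Longrightarrow> norm (a i) \<le> 1" and b: "\<And>i. i \<in> {1..n} \<Longrightarrow> norm (b i) \<le> 1" and \<eta>: "0 < \<eta>"
  obtains r' \<rho>' b' where "(r', \<rho>') \<in> asymptotic_structure scaleX A n" "\<And>i. norm (b' i :: 'k) = norm (b i :: 'k)"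
    "(\<Sum>i=1..n. norm (a i) * norm (b i) * \<rho> (basis_vec i)) \<le> 2 * r (basis_sum n a) * \<rho>' (basis_sum n b') + \<eta>"
proof -
  interpret X: asymptotic_setting scaleX UNIV "weak_functionals scaleX" "blinfun_apply A"
    by (rule weak_setting[OF X Y A])
  interpret D: asymptotic_setting dual_scale "dual scaleY" weakstar_functionals "adjoint_op A"
    by (rule weakstar_setting)
  have pair': "(r, \<rho>) \<in> asymptotic_pairs (dual scaleY) dual_scale weakstar_functionals (adjoint_op A) n"
    using pair by (simp add: weakstar_asymptotic_structure_def split: if_splits)
  then have r0: "0 \<le> r (basis_sum n a)"
    by (auto simp: asymptotic_pairs_def norm_on_coord_def seminorm_on_coord_def basis_sum_in_coord_space)
  \<comment> \<open>\<open>C * \<delta>\<close> is the total error: that of the two norms in the product, that of the off-diagonal terms and that of the diagonal ones.\<close>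
  define C where "C = 2 * (r (basis_sum n a) + norm A * real n) + 2 * real n * real n + 2 * real n + 1"
  define \<delta> where "\<delta> = \<eta> / C"
  have C: "0 < C" using r0 by (simp add: C_def add_nonneg_pos)
  then have \<delta>: "0 < \<delta>" using \<eta> by (simp add: \<delta>_def)
  have fr: "frequently (approximates dual_scale (adjoint_op A) n \<delta> r \<rho>) (tree_filter weakstar_filter n)"
    using pair' \<delta> unfolding asymptotic_pairs_def asymptotic_pairs_tree_filter by blast
  define good where "good xs fs \<longleftrightarrow> length xs = n \<and> length fs = n \<and>
      approximates dual_scale (adjoint_op A) n \<delta> r \<rho> fs \<and>
      (\<forall>i<n. norm (xs ! i) = 1 \<and> fs ! i \<in> dual scaleY \<and>
        norm (adjoint_op A (fs ! i)) - \<delta> \<le> 2 * norm ((fs ! i) \<cdot> (A \<cdot> (xs ! i))) \<and>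
        (\<forall>j<n. i \<noteq> j \<longrightarrow> norm ((fs ! i) \<cdot> (A \<cdot> (xs ! j))) < \<delta>))" for xs fs
  from frequently_almost_biorthogonal[OF inf fr \<delta>]
  have "frequently (\<lambda>xs. \<exists>fs. good xs fs) (tree_filter weak_filter n)" unfolding good_def .
  then obtain r' \<rho>' where pair2: "(r', \<rho>') \<in> asymptotic_pairs UNIV scaleX (weak_functionals scaleX) (blinfun_apply A) n"
    and fr2: "\<And>\<delta>. 0 < \<delta> \<Longrightarrow> frequently (\<lambda>xs. (\<exists>fs. good xs fs) \<and> approximates scaleX (blinfun_apply A) n \<delta> r' \<rho>' xs) (tree_filter weak_filter n)"
    by (rule X.asymptotic_pair_exists) (rule that)
  obtain xs fs where good: "good xs fs" and app: "approximates scaleX (blinfun_apply A) n \<delta> r' \<rho>' xs"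
    using frequently_ex[OF fr2[OF \<delta>]] by blast
  define m where "m i j = (fs ! i) \<cdot> (A \<cdot> (xs ! j))" for i j
  have "\<exists>c. norm c = 1 \<and> c * (a i * b i * m (i - 1) (i - 1)) = of_real (norm (a i * b i * m (i - 1) (i - 1)))" for i
    using scalar_rotation[of "a i * b i * m (i - 1) (i - 1)"] by metis
  then obtain c where c: "\<And>i. norm (c i) = 1"
    "\<And>i. c i * (a i * b i * m (i - 1) (i - 1)) = of_real (norm (a i * b i * m (i - 1) (i - 1)))" by metis
  define b' where "b' i = c i * b i" for i
  have nb': "norm (b' i) = norm (b i)" for i by (simp add: b'_def norm_mult c(1))
  define f where "f = comb dual_scale n a fs"
  define x where "x = comb scaleX n b' xs"
  have aS: "norm (a (Suc i)) \<le> 1" and bS: "norm (b (Suc i)) \<le> 1" if "i < n" for i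
    using a[of "Suc i"] b[of "Suc i"] that by auto
  have fx: "f \<cdot> (A \<cdot> x) = (\<Sum>i<n. \<Sum>j<n. a (Suc i) * b' (Suc j) * m i j)"
  proof -
    have Ax: "A \<cdot> x = (\<Sum>j<n. scaleY (b' (Suc j)) (A \<cdot> (xs ! j)))"
      using A unfolding x_def comb_lessThan by (simp add: X.T_sum linear_over_def)
    have "(fs ! i) \<cdot> (A \<cdot> x) = (\<Sum>j<n. b' (Suc j) * m i j)" if "i < n" for i
      using good that unfolding Ax by (simp add: blinfun.sum_right dual_apply_scale good_def m_def)
    moreover have "f \<cdot> y = (\<Sum>i<n. a (Suc i) * (fs ! i) \<cdot> y)" for y
      unfolding f_def comb_lessThan by (simp add: blinfun.sum_left)
    ultimately show ?thesis by (simp add: sum_distrib_left mult.assoc)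
  qed
  define s where "s = (\<Sum>i<n. norm (a (Suc i) * b (Suc i) * m i i))"
  have diag: "a (Suc i) * b' (Suc i) * m i i = of_real (norm (a (Suc i) * b (Suc i) * m i i))" for i
    using c(2)[of "Suc i"] by (simp add: b'_def mult_ac)
  have s_le: "s \<le> norm (f \<cdot> (A \<cdot> x)) + real n * real n * \<delta>"
  proof -
    have "f \<cdot> (A \<cdot> x) =
        (\<Sum>i<n. a (Suc i) * b' (Suc i) * m i i + (\<Sum>j\<in>{..<n} - {i}. a (Suc i) * b' (Suc j) * m i j))"
      unfolding fx
    proof (rule sum.cong[OF refl])
      fix i assume "i \<in> {..<n}"
      then show "(\<Sum>j<n. a (Suc i) * b' (Suc j) * m i j) =
          a (Suc i) * b' (Suc i) * m i i + (\<Sum>j\<in>{..<n} - {i}. a (Suc i) * b' (Suc j) * m i j)"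
        by (rule sum.remove[rotated]) auto
    qed
    also have "\<dots> = of_real s + (\<Sum>i<n. \<Sum>j\<in>{..<n} - {i}. a (Suc i) * b' (Suc j) * m i j)"
      unfolding sum.distrib diag s_def by simp
    finally have s: "(of_real s :: 'k) = f \<cdot> (A \<cdot> x) - (\<Sum>i<n. \<Sum>j\<in>{..<n} - {i}. a (Suc i) * b' (Suc j) * m i j)"
      by simp
    have "\<bar>s\<bar> = norm (of_real s :: 'k)" by simp
    then have "\<bar>s\<bar> \<le> norm (f \<cdot> (A \<cdot> x)) + norm (\<Sum>i<n. \<Sum>j\<in>{..<n} - {i}. a (Suc i) * b' (Suc j) * m i j)"
      unfolding s using norm_triangle_ineq4 by simp
    moreover have "norm (\<Sum>i<n. \<Sum>j\<in>{..<n} - {i}. a (Suc i) * b' (Suc j) * m i j) \<le> (\<Sum>i<n. real n * \<delta>)"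
    proof (rule sum_norm_le)
      fix i assume i: "i \<in> {..<n}"
      have "norm (\<Sum>j\<in>{..<n} - {i}. a (Suc i) * b' (Suc j) * m i j) \<le> (\<Sum>j\<in>{..<n} - {i}. \<delta>)"
      proof (rule sum_norm_le)
        fix j assume j: "j \<in> {..<n} - {i}"
        have "norm (a (Suc i)) * norm (b (Suc j)) * norm (m i j) \<le> 1 * 1 * \<delta>"
          using i j aS[of i] bS[of j] good by (intro mult_mono) (auto simp: good_def m_def less_imp_le)
        then show "norm (a (Suc i) * b' (Suc j) * m i j) \<le> \<delta>" by (simp add: norm_mult nb')
      qed
      also have "\<dots> \<le> real n * \<delta>"
        using \<delta> card_Diff1_le[of "{..<n}" i] by (simp add: mult_right_mono)
      finally show "norm (\<Sum>j\<in>{..<n} - {i}. a (Suc i) * b' (Suc j) * m i j) \<le> real n * \<delta>" .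
    qed
    ultimately show ?thesis by simp
  qed
  have nf: "norm f \<le> r (basis_sum n a) + \<delta>"
  proof -
    have "\<bar>norm f - r (basis_sum n a)\<bar> < \<delta>" using good a by (simp add: good_def approximates_def f_def)
    then show ?thesis by simp
  qed
  have nAx: "norm (A \<cdot> x) \<le> \<rho>' (basis_sum n b') + \<delta>"
  proof -
    have "\<bar>norm (A \<cdot> x) - \<rho>' (basis_sum n b')\<bar> < \<delta>" using app b by (simp add: approximates_def x_def nb')
    then show ?thesis by simp
  qed
  have nAx2: "norm (A \<cdot> x) \<le> norm A * real n"
  proof -
    have "norm x \<le> (\<Sum>i=1..n. norm (b' i))"
      unfolding x_def using good by (intro X.norm_comb_le) (auto simp: good_def in_set_conv_nth)
    also have "\<dots> \<le> real n" using sum_bounded_above[of "{1..n}" "\<lambda>i. norm (b' i)" 1] b by (simp add: nb')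
    finally have "norm A * norm x \<le> norm A * real n" by (intro mult_left_mono) auto
    then show ?thesis using norm_blinfun[of A x] by linarith
  qed
  have "norm (f \<cdot> (A \<cdot> x)) \<le> norm f * norm (A \<cdot> x)" by (rule norm_blinfun)
  also have "\<dots> \<le> (r (basis_sum n a) + \<delta>) * norm (A \<cdot> x)" using nf by (intro mult_right_mono) auto
  also have "\<dots> = r (basis_sum n a) * norm (A \<cdot> x) + \<delta> * norm (A \<cdot> x)" by (simp add: algebra_simps)
  also have "\<dots> \<le> r (basis_sum n a) * (\<rho>' (basis_sum n b') + \<delta>) + \<delta> * (norm A * real n)"
    using nAx nAx2 r0 \<delta> by (intro add_mono mult_left_mono) auto
  finally have fAx: "norm (f \<cdot> (A \<cdot> x)) \<le>
    r (basis_sum n a) * \<rho>' (basis_sum n b') + \<delta> * (r (basis_sum n a) + norm A * real n)" by (simp add: algebra_simps)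
  have "(\<Sum>i=1..n. norm (a i) * norm (b i) * \<rho> (basis_vec i)) =
      (\<Sum>i<n. norm (a (Suc i)) * norm (b (Suc i)) * \<rho> (basis_vec (Suc i)))" by (simp add: sum.atLeast1_atMost_eq)
  also have "\<dots> \<le> (\<Sum>i<n. 2 * norm (a (Suc i) * b (Suc i) * m i i) + 2 * \<delta>)"
  proof (rule sum_mono)
    fix i assume "i \<in> {..<n}"
    then have i: "i < n" by simp
    have app_f: "approximates dual_scale (adjoint_op A) n \<delta> r \<rho> fs"
      and nrm: "norm (adjoint_op A (fs ! i)) - \<delta> \<le> 2 * norm (m i i)"
      using good i by (auto simp: good_def m_def)
    have le: "\<rho> (basis_vec (Suc i)) \<le> 2 * norm (m i i) + 2 * \<delta>"
      using approximates_basis_vec[OF app_f vector_space_dual_scale i] nrm by linarith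
    have ab: "norm (a (Suc i)) * norm (b (Suc i)) \<le> 1" using mult_mono[OF aS[OF i] bS[OF i]] by simp
    have "norm (a (Suc i)) * norm (b (Suc i)) * \<rho> (basis_vec (Suc i)) \<le>
        norm (a (Suc i)) * norm (b (Suc i)) * (2 * norm (m i i) + 2 * \<delta>)"
      using le by (intro mult_left_mono) auto
    also have "\<dots> = 2 * norm (a (Suc i) * b (Suc i) * m i i) + (norm (a (Suc i)) * norm (b (Suc i))) * (2 * \<delta>)"
      by (simp add: norm_mult algebra_simps)
    also have "\<dots> \<le> 2 * norm (a (Suc i) * b (Suc i) * m i i) + 1 * (2 * \<delta>)"
      using ab \<delta> by (intro add_left_mono mult_right_mono) auto
    finally show "norm (a (Suc i)) * norm (b (Suc i)) * \<rho> (basis_vec (Suc i)) \<le>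
        2 * norm (a (Suc i) * b (Suc i) * m i i) + 2 * \<delta>" by simp
  qed
  also have "\<dots> = 2 * s + 2 * real n * \<delta>" by (simp add: s_def sum.distrib sum_distrib_left)
  also have "\<dots> \<le> 2 * r (basis_sum n a) * \<rho>' (basis_sum n b') + C * \<delta>"
    using s_le fAx \<delta> by (simp add: C_def algebra_simps)
  also have "C * \<delta> = \<eta>" using C by (simp add: \<delta>_def)
  finally show ?thesis
    using that[of r' \<rho>' b'] pair2 inf nb' by (simp add: asymptotic_structure_def)
qed

section \<open>From weakly null trees to weak*-null trees\<close>

text \<open>A weak* small functional \<open>z\<close> is written as \<open>l w\<close> with a weak* small unit functional \<open>w\<close>. This is
  normalization, unless \<open>z\<close> is too short for \<open>w\<close> to remain small; then \<open>l = 0\<close> and \<open>w\<close> is arbitrary.\<close>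

lemma normalize_or_replace:
  fixes smul :: "'k::real_or_complex \<Rightarrow> 'v::banach \<Rightarrow> 'v"
  assumes X: "banach_over smul" and inf: "\<not> finite_dim smul"
    and z: "z \<in> dual smul" "norm z \<le> 2" and \<epsilon>: "0 < \<epsilon>" and \<eta>: "0 < \<eta>" and Y: "finite Y"
    and small: "\<And>y. y \<in> Y \<Longrightarrow> norm (z \<cdot> y) < \<epsilon> * \<eta>"
  obtains w l where "w \<in> dual smul" "norm w = 1" "norm l \<le> 2" "norm (z - dual_scale l w) \<le> \<eta>"
    "\<And>y. y \<in> Y \<Longrightarrow> norm (w \<cdot> y) < \<epsilon>"
proof (cases "norm z < \<eta>")
  case True
  obtain w where w: "w \<in> dual smul" "norm w = 1" "\<And>x. x \<in> Y \<Longrightarrow> w \<cdot> x = 0"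
    by (rule infinite_dim_annihilating_functional[OF X inf Y]) (rule that)
  have "dual_scale 0 w = 0" by (rule blinfun_eqI) simp
  then show ?thesis using that[of w 0] w True \<epsilon> by simp
next
  case False
  then have nz: "0 < norm z" using \<eta> by linarith
  interpret D: vector_space "dual_scale :: 'k \<Rightarrow> ('v \<Rightarrow>\<^sub>L 'k) \<Rightarrow> _" by (rule vector_space_dual_scale)
  define w where "w = dual_scale (of_real (1 / norm z)) z"
  have "dual_scale (of_real (norm z)) w = z"
    using nz by (auto intro!: blinfun_eqI simp: w_def)
  moreover have "w \<in> dual smul" unfolding w_def by (rule D.subspace_scale[OF subspace_dual z(1)])
  moreover have "norm w = 1" using nz by (simp add: w_def norm_dual_scale norm_divide)
  moreover have "norm (w \<cdot> y) < \<epsilon>" if "y \<in> Y" for y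
  proof -
    have "\<epsilon> * \<eta> \<le> \<epsilon> * norm z" using False \<epsilon> by (intro mult_left_mono) auto
    then have "norm (z \<cdot> y) < \<epsilon> * norm z" using small[OF that] by linarith
    then show ?thesis using nz by (simp add: w_def norm_mult norm_divide field_simps)
  qed
  ultimately show ?thesis using that[of w "of_real (norm z)"] z(2) \<eta> by simp
qed

text \<open>The state of the game consists of the vectors \<open>xs\<close>, the coefficients \<open>ls\<close> and a functional \<open>g\<close>, which is a weak*
  cluster point of the functionals available at the ends of the branches through \<open>xs\<close>. In a move, a weak* neighbourhood of 0 for the next
  difference is given. A vector \<open>x\<close> and a cluster point \<open>g1\<close> for the branches through \<open>xs @ [x]\<close> are chosen such that
  \<open>g1 - g\<close> lies in this neighbourhood and is small at the images of the earlier vectors, while \<open>g (A x)\<close> is small. Thus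
  \<open>g1 (A x)\<close> is almost \<open>(g1 - g) (A x)\<close>, and later moves hardly change it.\<close>

theorem (in operator_between) frequently_functional_differences:
  assumes inf: "\<not> finite_dim scaleY" and \<eta>: "0 < \<eta>"
    and fr: "frequently (\<lambda>xs. \<exists>g\<in>dual_ball scaleY. Q xs g) (tree_filter weak_filter n)"
  shows "frequently (\<lambda>ws. \<exists>xs ls. length ws = n \<and> length xs = n \<and> length ls = n \<and>
      norm (\<Sum>i<n. dual_scale (ls ! i) (ws ! i)) \<le> 2 + real n * \<eta> \<and>
      (\<exists>g\<in>dual_ball scaleY. Q xs g \<and> (\<forall>i<n. norm (xs ! i) = 1 \<and> norm (ls ! i) \<le> 2 \<and>
        norm (g \<cdot> (A \<cdot> (xs ! i)) - ls ! i * (ws ! i) \<cdot> (A \<cdot> (xs ! i)))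
          \<le> (real n + 1) * (\<eta> * (1 + norm A)))))
    (tree_filter weakstar_filter n)"
proof -
  define c where "c = \<eta> * (1 + norm A)"
  have c: "\<eta> \<le> c" using \<eta> by (simp add: c_def algebra_simps)
  \<comment> \<open>\<open>L k xs g\<close>: every weak* neighbourhood of \<open>g\<close> contains witnesses for \<open>Q\<close> at the ends of branches through \<open>xs\<close>.\<close>
  define L where "L k xs g \<longleftrightarrow> (\<forall>Y \<epsilon>. finite Y \<longrightarrow> 0 < \<epsilon> \<longrightarrow> frequently (\<lambda>xs'. \<exists>h\<in>dual_ball scaleY.
      (\<forall>y\<in>Y. norm (h \<cdot> y - g \<cdot> y) < \<epsilon>) \<and> Q (xs @ xs') h) (tree_filter weak_filter k))"
    for k xs and g :: "'y \<Rightarrow>\<^sub>L 'k"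
  obtain g0 where g0: "g0 \<in> dual_ball scaleY" "L n [] g0"
    by (rule frequently_weakstar_cluster[OF Y fr]) (simp add: L_def)
  \<comment> \<open>The two estimates are the telescoping sum of the differences and their almost diagonal action.\<close>
  define V where "V k ws s \<longleftrightarrow> (case s of (xs, ls, g) \<Rightarrow> k + length ws = n \<and> length xs = length ws \<and> length ls = length ws \<and>
      g \<in> dual_ball scaleY \<and> L k xs g \<and>
      norm (g - g0 - (\<Sum>i<length ws. dual_scale (ls ! i) (ws ! i))) \<le> real (length ws) * \<eta> \<and>
      (\<forall>i<length ws. norm (xs ! i) = 1 \<and> norm (ls ! i) \<le> 2 \<and>
        norm (g \<cdot> (A \<cdot> (xs ! i)) - ls ! i * (ws ! i) \<cdot> (A \<cdot> (xs ! i)))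
          \<le> real (length ws) * c))" for k ws s
  have "V n [] ([], [], g0)" using g0 by (simp add: V_def)
  then have "frequently (\<lambda>ws. \<exists>s'. V 0 ([] @ ws) s') (tree_filter weakstar_filter n)"
  proof (rule frequently_tree_filter_game[rotated])
    fix k ws s assume V: "V (Suc k) ws s"
    obtain xs ls g where s: "s = (xs, ls, g)" by (metis surj_pair)
    define m where "m = length ws"
    have len: "Suc k + m = n" "length ws = m" "length xs = m" "length ls = m"
      and g: "g \<in> dual_ball scaleY" "L (Suc k) xs g"
      and sum: "norm (g - g0 - (\<Sum>i<m. dual_scale (ls ! i) (ws ! i))) \<le> real m * \<eta>"
      and elem: "\<And>i. i < m \<Longrightarrow> norm (xs ! i) = 1 \<and> norm (ls ! i) \<le> 2 \<and>
        norm (g \<cdot> (A \<cdot> (xs ! i)) - ls ! i * (ws ! i) \<cdot> (A \<cdot> (xs ! i)))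
          \<le> real m * c"
      using V unfolding V_def s m_def by auto
    show "frequently (\<lambda>w. \<exists>s'. V k (ws @ [w]) s') weakstar_filter"
      unfolding frequently_sphere_filter
    proof (intro allI impI)
      fix F :: "(('y \<Rightarrow>\<^sub>L 'k) \<Rightarrow> 'k) set" and \<epsilon> :: real
      assume F: "finite F" "F \<subseteq> weakstar_functionals" and \<epsilon>: "0 < \<epsilon>"
      obtain Y0 where Y0: "finite Y0" "F = (\<lambda>v f. f \<cdot> v) ` Y0"
        using finite_subset_image[OF F(1) F(2)[unfolded weakstar_functionals_def]] by blast
      define Y1 where "Y1 = Y0 \<union> blinfun_apply A ` set xs"
      \<comment> \<open>The first bound is what normalization of a difference of norm at least \<open>\<eta>\<close> requires, the factor 2 comes from approximating both \<open>g\<close> and \<open>g1\<close> by one functional \<open>h\<close>.\<close>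
      define \<epsilon>1 where "\<epsilon>1 = min (\<epsilon> * \<eta>) \<eta> / 2"
      have \<epsilon>1: "0 < \<epsilon>1" "2 * \<epsilon>1 \<le> \<epsilon> * \<eta>" "2 * \<epsilon>1 \<le> \<eta>" using \<epsilon> \<eta> by (auto simp: \<epsilon>1_def)
      have Y1: "finite Y1" using Y0 by (simp add: Y1_def)
      define W where "W x \<longleftrightarrow> frequently (\<lambda>xs'. \<exists>h\<in>dual_ball scaleY.
          (\<forall>y\<in>Y1. norm (h \<cdot> y - g \<cdot> y) < \<epsilon>1) \<and> Q (xs @ x # xs') h) (tree_filter weak_filter k)" for x
      have W: "frequently W weak_filter"
        using g(2) Y1 \<epsilon>1(1) unfolding L_def frequently_tree_filter_Suc W_def by blast
      have "{blinfun_apply (adjoint_op A g)} \<subseteq> weak_functionals scaleX"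
        using g(1) adjoint_op_in_dual[OF A, of g] by (auto simp: weak_functionals_def dual_ball_def)
      then have "\<exists>x\<in>UNIV. norm x = 1 \<and> (\<forall>\<phi>\<in>{blinfun_apply (adjoint_op A g)}. norm (\<phi> x) < \<eta>) \<and> W x"
        by (intro W[unfolded frequently_sphere_filter, rule_format] \<eta>) simp_all
      then obtain x where x: "norm x = 1" "norm ((adjoint_op A g) \<cdot> x) < \<eta>" and "W x" by blast
      then have x_next: "frequently (\<lambda>xs'. \<exists>h\<in>dual_ball scaleY.
          (\<forall>y\<in>Y1. norm (h \<cdot> y - g \<cdot> y) < \<epsilon>1) \<and> Q (xs @ x # xs') h) (tree_filter weak_filter k)"
        by (simp add: W_def)
      obtain g1 where g1: "g1 \<in> dual_ball scaleY" and g1_cluster: "\<And>Y \<epsilon>. finite Y \<Longrightarrow> 0 < \<epsilon> \<Longrightarrow>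
          frequently (\<lambda>xs'. \<exists>h\<in>dual_ball scaleY. (\<forall>y\<in>Y. norm (h \<cdot> y - g1 \<cdot> y) < \<epsilon>) \<and>
          (\<forall>y\<in>Y1. norm (h \<cdot> y - g \<cdot> y) < \<epsilon>1) \<and> Q (xs @ x # xs') h) (tree_filter weak_filter k)"
        by (rule frequently_weakstar_cluster[OF Y x_next]) (rule that)
      have L1: "L k (xs @ [x]) g1" unfolding L_def
      proof (intro allI impI)
        fix Y :: "'y set" and \<epsilon> :: real assume "finite Y" "0 < \<epsilon>"
        from g1_cluster[OF this] show "frequently (\<lambda>xs'. \<exists>h\<in>dual_ball scaleY.
          (\<forall>y\<in>Y. norm (h \<cdot> y - g1 \<cdot> y) < \<epsilon>) \<and> Q ((xs @ [x]) @ xs') h) (tree_filter weak_filter k)"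
          by (rule frequently_elim1) auto
      qed
      obtain h where h: "\<And>y. y \<in> Y1 \<Longrightarrow> norm (h \<cdot> y - g1 \<cdot> y) < \<epsilon>1"
        "\<And>y. y \<in> Y1 \<Longrightarrow> norm (h \<cdot> y - g \<cdot> y) < \<epsilon>1"
        using frequently_ex[OF g1_cluster[OF Y1 \<epsilon>1(1)]] by blast
      define z where "z = g1 - g"
      have zY1: "norm (z \<cdot> y) < 2 * \<epsilon>1" if "y \<in> Y1" for y
        using h[OF that] norm_triangle_ineq4[of "h \<cdot> y - g \<cdot> y" "h \<cdot> y - g1 \<cdot> y"]
        by (simp add: z_def blinfun.diff_left)
      interpret D: vector_space "dual_scale :: 'k \<Rightarrow> ('y \<Rightarrow>\<^sub>L 'k) \<Rightarrow> _" by (rule vector_space_dual_scale)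
      have z: "z \<in> dual scaleY" "norm z \<le> 2"
        using g(1) g1 D.subspace_diff[OF subspace_dual] norm_triangle_ineq4[of g1 g] by (auto simp: z_def dual_ball_def)
      have "norm (z \<cdot> y) < \<epsilon> * \<eta>" if "y \<in> Y0" for y
        using zY1[of y] that \<epsilon>1(2) by (simp add: Y1_def)
      then obtain w l where w: "w \<in> dual scaleY" "norm w = 1" "norm l \<le> 2" "norm (z - dual_scale l w) \<le> \<eta>"
        "\<And>y. y \<in> Y0 \<Longrightarrow> norm (w \<cdot> y) < \<epsilon>"
        by (rule normalize_or_replace[OF Y inf z \<epsilon> \<eta> Y0(1)]) (assumption, rule that)
      have sum1: "norm (g1 - g0 - (\<Sum>i<Suc m. dual_scale ((ls @ [l]) ! i) ((ws @ [w]) ! i))) \<le> real (Suc m) * \<eta>"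
      proof -
        have "g1 - g0 - (\<Sum>i<Suc m. dual_scale ((ls @ [l]) ! i) ((ws @ [w]) ! i)) =
            (g - g0 - (\<Sum>i<m. dual_scale (ls ! i) (ws ! i))) + (z - dual_scale l w)"
          using len by (simp add: nth_append z_def)
        moreover have "real (Suc m) * \<eta> = real m * \<eta> + \<eta>" by (simp add: algebra_simps)
        ultimately show ?thesis using norm_triangle_mono[OF sum w(4)] by (simp only:)
      qed
      have c0: "0 \<le> c" using c \<eta> by simp
      have elem1: "norm ((xs @ [x]) ! i) = 1 \<and> norm ((ls @ [l]) ! i) \<le> 2 \<and>
          norm (g1 \<cdot> (A \<cdot> ((xs @ [x]) ! i)) -
            (ls @ [l]) ! i * ((ws @ [w]) ! i) \<cdot> (A \<cdot> ((xs @ [x]) ! i)))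
          \<le> real (Suc m) * c" if i: "i < Suc m" for i
      proof (cases "i = m")
        case True
        have "norm ((z - dual_scale l w) \<cdot> (A \<cdot> x)) \<le> \<eta> * norm A"
        proof -
          have "norm ((z - dual_scale l w) \<cdot> (A \<cdot> x)) \<le>
              norm (z - dual_scale l w) * norm (A \<cdot> x)" by (rule norm_blinfun)
          also have "\<dots> \<le> \<eta> * norm A" using w(4) norm_blinfun[of A x] x(1) \<eta> by (intro mult_mono) auto
          finally show ?thesis .
        qed
        moreover have "g1 \<cdot> (A \<cdot> x) - l * w \<cdot> (A \<cdot> x) =
            g \<cdot> (A \<cdot> x) + (z - dual_scale l w) \<cdot> (A \<cdot> x)"
          by (simp add: z_def blinfun.diff_left)
        ultimately have "norm (g1 \<cdot> (A \<cdot> x) - l * w \<cdot> (A \<cdot> x)) \<le> c"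
          using x(2) norm_triangle_ineq[of "g \<cdot> (A \<cdot> x)" "(z - dual_scale l w) \<cdot> (A \<cdot> x)"]
          by (simp add: c_def algebra_simps)
        moreover have "c \<le> real (Suc m) * c" using c0 by (simp add: algebra_simps)
        ultimately show ?thesis using True len x(1) w(3) by (simp add: nth_append)
      next
        case False
        then have im: "i < m" using i by simp
        define y where "y = A \<cdot> (xs ! i)"
        have "norm (z \<cdot> y) < 2 * \<epsilon>1" using im len by (intro zY1) (simp add: Y1_def y_def)
        then have "norm (z \<cdot> y) \<le> c" using \<epsilon>1(3) c by linarith
        moreover have "g1 \<cdot> y - ls ! i * (ws ! i) \<cdot> y =
            (g \<cdot> y - ls ! i * (ws ! i) \<cdot> y) + z \<cdot> y"
          by (simp add: z_def blinfun.diff_left)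
        ultimately have "norm (g1 \<cdot> y - ls ! i * (ws ! i) \<cdot> y) \<le> real (Suc m) * c"
          using norm_triangle_mono[of "g \<cdot> y - ls ! i * (ws ! i) \<cdot> y" "real m * c" "z \<cdot> y" c]
            elem[OF im] by (simp add: y_def algebra_simps)
        then show ?thesis using im len elem[OF im] by (simp add: nth_append y_def)
      qed
      have "V k (ws @ [w]) (xs @ [x], ls @ [l], g1)"
        unfolding V_def prod.case length_append_singleton len(2-4)
        using len(1) g1 L1 sum1 elem1 by (auto simp del: sum.lessThan_Suc)
      then show "\<exists>w\<in>dual scaleY. norm w = 1 \<and> (\<forall>\<phi>\<in>F. norm (\<phi> w) < \<epsilon>) \<and> (\<exists>s'. V k (ws @ [w]) s')"
        using w(1,2,5) Y0(2) by (intro bexI[of _ w]) auto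
    qed
  qed
  then show ?thesis
  proof (rule frequently_elim1)
    fix ws assume "\<exists>s'. V 0 ([] @ ws) s'"
    then obtain xs ls g where V: "V 0 ws (xs, ls, g)" by auto
    then have len: "length ws = n" "length xs = n" "length ls = n"
      and g: "g \<in> dual_ball scaleY" "L 0 xs g"
      and sum: "norm (g - g0 - (\<Sum>i<n. dual_scale (ls ! i) (ws ! i))) \<le> real n * \<eta>"
      and elem: "\<And>i. i < n \<Longrightarrow> norm (xs ! i) = 1 \<and> norm (ls ! i) \<le> 2 \<and>
        norm (g \<cdot> (A \<cdot> (xs ! i)) - ls ! i * (ws ! i) \<cdot> (A \<cdot> (xs ! i)))
          \<le> real n * c"
      unfolding V_def by auto
    have "frequently (\<lambda>xs'. \<exists>h\<in>dual_ball scaleY. (\<forall>y\<in>blinfun_apply A ` set xs.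
        norm (h \<cdot> y - g \<cdot> y) < \<eta>) \<and> Q (xs @ xs') h) (tree_filter weak_filter 0)"
      using g(2) \<eta> unfolding L_def by blast
    then obtain h where h: "h \<in> dual_ball scaleY" "Q xs h"
      "\<And>y. y \<in> blinfun_apply A ` set xs \<Longrightarrow> norm (h \<cdot> y - g \<cdot> y) < \<eta>" by auto
    have "norm (g - g0) \<le> 2" using g(1) g0(1) norm_triangle_ineq4[of g g0] by (simp add: dual_ball_def)
    then have n1: "norm (\<Sum>i<n. dual_scale (ls ! i) (ws ! i)) \<le> 2 + real n * \<eta>"
      using sum norm_triangle_ineq4[of "g - g0" "g - g0 - (\<Sum>i<n. dual_scale (ls ! i) (ws ! i))"] by simp
    have n2: "norm (h \<cdot> (A \<cdot> (xs ! i)) - ls ! i * (ws ! i) \<cdot> (A \<cdot> (xs ! i)))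
          \<le> (real n + 1) * (\<eta> * (1 + norm A))" if i: "i < n" for i
    proof -
      define y where "y = A \<cdot> (xs ! i)"
      have "norm (h \<cdot> y - g \<cdot> y) < \<eta>" using i len by (intro h(3)) (simp add: y_def)
      then have "norm (h \<cdot> y - g \<cdot> y) \<le> c" using c by linarith
      then show ?thesis
        using norm_triangle_mono[of "g \<cdot> y - ls ! i * (ws ! i) \<cdot> y" "real n * c" "h \<cdot> y - g \<cdot> y" c]
          elem[OF i] by (simp add: y_def c_def algebra_simps)
    qed
    show "\<exists>xs ls. length ws = n \<and> length xs = n \<and> length ls = n \<and>
      norm (\<Sum>i<n. dual_scale (ls ! i) (ws ! i)) \<le> 2 + real n * \<eta> \<and>
      (\<exists>g\<in>dual_ball scaleY. Q xs g \<and> (\<forall>i<n. norm (xs ! i) = 1 \<and> norm (ls ! i) \<le> 2 \<and>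
        norm (g \<cdot> (A \<cdot> (xs ! i)) - ls ! i * (ws ! i) \<cdot> (A \<cdot> (xs ! i)))
          \<le> (real n + 1) * (\<eta> * (1 + norm A))))"
      using len n1 h(1,2) n2 elem by blast
  qed
qed

text \<open>The bound 3 leaves room for the errors: the coefficients come from \<open>g\<^sub>n - g\<^sub>0\<close>, whose norm is at most 2.\<close>

theorem (in operator_between) weakstar_pair_from_functionals:
  assumes inf: "\<not> finite_dim scaleY" and \<eta>: "0 < \<eta>"
    and fr: "frequently (\<lambda>xs. \<exists>g\<in>dual_ball scaleY. Q xs g) (tree_filter weak_filter n)"
  obtains r \<rho> l xs g where "(r, \<rho>) \<in> weakstar_asymptotic_structure scaleY A n" "r (basis_sum n l) \<le> 3"
    "length xs = n" "Q xs g" "\<And>i. i < n \<Longrightarrow> norm (xs ! i) = 1"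
    "\<And>i. i < n \<Longrightarrow> norm (g \<cdot> (A \<cdot> (xs ! i))) \<le>
       norm (l (Suc i) :: 'k) * \<rho> (basis_vec (Suc i)) + \<eta>"
proof -
  interpret D: asymptotic_setting dual_scale "dual scaleY" weakstar_functionals "adjoint_op A"
    by (rule weakstar_setting)
  define \<eta>' where "\<eta>' = min 1 \<eta> / (2 * (real n + 1) * (1 + norm A))"
  have pos: "0 < (real n + 1) * (1 + norm A)" by (simp add: add_pos_nonneg)
  then have \<eta>': "0 < \<eta>'" using \<eta> unfolding \<eta>'_def mult.assoc by (intro divide_pos_pos) auto
  have e: "(real n + 1) * (\<eta>' * (1 + norm A)) = min 1 \<eta> / 2"
  proof -
    have cancel: "x * (y / x) = y" if "0 < x" for x y :: real using that by simp
    have "(real n + 1) * (\<eta>' * (1 + norm A)) = ((real n + 1) * (1 + norm A)) * (min 1 \<eta> / 2 / ((real n + 1) * (1 + norm A)))"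
      by (simp add: \<eta>'_def mult_ac)
    also have "\<dots> = min 1 \<eta> / 2" by (rule cancel[OF pos])
    finally show ?thesis .
  qed
  have n\<eta>': "real n * \<eta>' \<le> 1 / 2"
  proof -
    have "real n * \<eta>' \<le> (real n + 1) * (\<eta>' * (1 + norm A))"
      using \<eta>' by (intro mult_mono) (auto simp: algebra_simps)
    then show ?thesis unfolding e by simp
  qed
  define P where "P ws xs ls g \<longleftrightarrow> length ws = n \<and> length xs = n \<and> length ls = n \<and>
      norm (\<Sum>i<n. dual_scale (ls ! i) (ws ! i)) \<le> 2 + real n * \<eta>' \<and> Q xs g \<and> (\<forall>i<n. norm (xs ! i) = 1 \<and> norm (ls ! i) \<le> 2 \<and>
        norm (g \<cdot> (A \<cdot> (xs ! i)) - ls ! i * (ws ! i) \<cdot> (A \<cdot> (xs ! i)))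
          \<le> (real n + 1) * (\<eta>' * (1 + norm A)))" for ws xs ls g
  have "frequently (\<lambda>ws. \<exists>xs ls g. P ws xs ls g) (tree_filter weakstar_filter n)"
    by (rule frequently_elim1[OF frequently_functional_differences[OF inf \<eta>' fr]]) (auto simp: P_def)
  then obtain r \<rho> where pair: "(r, \<rho>) \<in> asymptotic_pairs (dual scaleY) dual_scale weakstar_functionals (adjoint_op A) n"
    and fr2: "\<And>\<delta>. 0 < \<delta> \<Longrightarrow> frequently (\<lambda>ws. (\<exists>xs ls g. P ws xs ls g) \<and>
       approximates dual_scale (adjoint_op A) n \<delta> r \<rho> ws) (tree_filter weakstar_filter n)"
    by (rule D.asymptotic_pair_exists) (rule that)
  define \<delta> where "\<delta> = min 1 \<eta> / 4"
  have \<delta>: "0 < \<delta>" "\<delta> \<le> 1 / 4" "\<delta> \<le> \<eta> / 4" using \<eta> by (auto simp: \<delta>_def)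
  obtain ws xs ls g where P: "P ws xs ls g" and app: "approximates dual_scale (adjoint_op A) n \<delta> r \<rho> ws"
    using frequently_ex[OF fr2[OF \<delta>(1)]] by blast
  define l where "l i = (if i \<in> {1..n} then ls ! (i - 1) else 0)" for i
  \<comment> \<open>The coefficients are bounded by 2, while approximation is guaranteed on the unit cube.\<close>
  have r_half: "r (basis_sum n (\<lambda>i. of_real (1 / 2) * l i)) = (1 / 2) * r (basis_sum n l)"
  proof -
    have "basis_sum n (\<lambda>i. of_real (1 / 2) * l i) = (\<lambda>i. of_real (1 / 2) * basis_sum n l i)"
      by (auto simp: basis_sum_eq)
    moreover have "r (\<lambda>i. of_real (1 / 2) * basis_sum n l i) = norm (of_real (1 / 2) :: 'k) * r (basis_sum n l)"
      using pair basis_sum_in_coord_space[of n n l]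
      by (simp only: asymptotic_pairs_def norm_on_coord_def seminorm_on_coord_def) blast
    ultimately show ?thesis by simp
  qed
  have half: "\<forall>i\<in>{1..n}. norm (of_real (1 / 2) * l i) \<le> 1"
  proof
    fix i assume i: "i \<in> {1..n}"
    then have "norm (ls ! (i - 1)) \<le> 2" using P by (auto simp: P_def)
    then show "norm (of_real (1 / 2) * l i) \<le> 1" using i by (simp add: l_def norm_mult norm_divide)
  qed
  have "comb dual_scale n (\<lambda>i. of_real (1 / 2) * l i) ws = dual_scale (of_real (1 / 2)) (\<Sum>i<n. dual_scale (ls ! i) (ws ! i))"
    unfolding D.comb_scale unfolding comb_lessThan by (intro arg_cong2[where f = dual_scale] refl sum.cong) (auto simp: l_def)
  then have "norm (comb dual_scale n (\<lambda>i. of_real (1 / 2) * l i) ws) = (1 / 2) * norm (\<Sum>i<n. dual_scale (ls ! i) (ws ! i))"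
    by (simp add: norm_dual_scale norm_divide)
  moreover have "norm (\<Sum>i<n. dual_scale (ls ! i) (ws ! i)) \<le> 2 + real n * \<eta>'" using P by (simp add: P_def)
  moreover have "\<bar>norm (comb dual_scale n (\<lambda>i. of_real (1 / 2) * l i) ws) - r (basis_sum n (\<lambda>i. of_real (1 / 2) * l i))\<bar> < \<delta>"
    using app[unfolded approximates_def, THEN spec, THEN mp, OF half] by (rule conjunct1)
  ultimately have r3: "r (basis_sum n l) \<le> 3" using r_half n\<eta>' \<delta>(2) by linarith
  have bound: "norm (g \<cdot> (A \<cdot> (xs ! i))) \<le> norm (l (Suc i)) * \<rho> (basis_vec (Suc i)) + \<eta>"
    if i: "i < n" for i
  proof -
    have li: "l (Suc i) = ls ! i" "norm (ls ! i) \<le> 2" and xi: "norm (xs ! i) = 1"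
      and err: "norm (g \<cdot> (A \<cdot> (xs ! i)) - ls ! i * (ws ! i) \<cdot> (A \<cdot> (xs ! i)))
          \<le> min 1 \<eta> / 2"
      using P i unfolding P_def e by (auto simp: l_def)
    have "norm ((ws ! i) \<cdot> (A \<cdot> (xs ! i))) \<le> norm (adjoint_op A (ws ! i))"
      using norm_blinfun[of "adjoint_op A (ws ! i)" "xs ! i"] xi by simp
    also have "\<dots> \<le> \<rho> (basis_vec (Suc i)) + \<delta>"
      using approximates_basis_vec[OF app vector_space_dual_scale i] by linarith
    finally have "norm (ls ! i) * norm ((ws ! i) \<cdot> (A \<cdot> (xs ! i))) \<le>
        norm (ls ! i) * (\<rho> (basis_vec (Suc i)) + \<delta>)" by (intro mult_left_mono) auto
    also have "\<dots> \<le> norm (ls ! i) * \<rho> (basis_vec (Suc i)) + 2 * \<delta>"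
      using mult_right_mono[OF li(2), of \<delta>] \<delta>(1) by (simp add: algebra_simps)
    finally have "norm (ls ! i * (ws ! i) \<cdot> (A \<cdot> (xs ! i))) \<le>
        norm (l (Suc i)) * \<rho> (basis_vec (Suc i)) + 2 * \<delta>" by (simp add: norm_mult li(1))
    moreover have "norm (g \<cdot> (A \<cdot> (xs ! i))) \<le>
        norm (ls ! i * (ws ! i) \<cdot> (A \<cdot> (xs ! i))) + min 1 \<eta> / 2"
      using norm_triangle_ineq2[of "g \<cdot> (A \<cdot> (xs ! i))"
          "ls ! i * (ws ! i) \<cdot> (A \<cdot> (xs ! i))"] err by linarith
    ultimately show ?thesis using \<delta>(3) min.cobounded2[of 1 \<eta>] by linarith
  qed
  show ?thesis
  proof (rule that)
    show "(r, \<rho>) \<in> weakstar_asymptotic_structure scaleY A n"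
      using pair inf by (simp add: weakstar_asymptotic_structure_def)
  qed (use P r3 bound in \<open>auto simp: P_def\<close>)
qed

section \<open>Duality of finite-dimensional sequence spaces\<close>

lemma conjugate_exponents_cases:
  fixes p q :: ennreal
  assumes "1 \<le> p" and pq: "1 / p + 1 / q = 1"
  obtains "p = 1" "q = \<infinity>" | "p = \<infinity>" "q = 1"
  | P Q :: real where "p = ennreal P" "q = ennreal Q" "1 < P" "1 < Q" "1 / P + 1 / Q = 1"
proof -
  have inv1: "x = 1" if "1 / x = 1" for x :: ennreal
    using that
  proof (cases x)
    case (real r)
    then show ?thesis using that by (cases "r = 0") (auto simp: divide_ennreal simp flip: ennreal_1)
  qed auto
  show ?thesis
  proof (cases "p = \<infinity>")
    case True
    then show ?thesis using that(2) pq inv1 by simp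
  next
    case False
    then obtain P where P: "p = ennreal P" "0 \<le> P" by (cases p) auto
    then have P1: "1 \<le> P" using assms(1) by (simp flip: ennreal_1)
    show ?thesis
    proof (cases "q = \<infinity>")
      case True
      then show ?thesis using that(1) pq inv1 by simp
    next
      case False
      then obtain Q where Q: "q = ennreal Q" "0 \<le> Q" by (cases q) auto
      have "Q \<noteq> 0"
      proof
        assume "Q = 0"
        then have "1 / q = \<infinity>" using Q by simp
        then show False using pq by simp
      qed
      then have Q0: "0 < Q" using Q by simp
      have "1 / p + 1 / q = ennreal (1 / P + 1 / Q)"
        using P(1) P1 Q(1) Q0 by (simp add: divide_ennreal ennreal_plus flip: ennreal_1)
      then have "ennreal (1 / P + 1 / Q) = ennreal 1" using pq by (simp only: ennreal_1)
      then have e: "1 / P + 1 / Q = 1" by (subst (asm) ennreal_inj) (use P1 Q0 in auto)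
      have "0 < 1 / P" "0 < 1 / Q" using P1 Q0 by simp_all
      then have "1 / Q < 1" "1 / P < 1" using e by linarith+
      then have "1 < P" "1 < Q" using P1 Q0 by (simp_all add: divide_simps split: if_splits)
      then show ?thesis using that(3) P(1) Q(1) e by blast
    qed
  qed
qed

lemma lp_norm_1: "lp_norm 1 n a = (\<Sum>i=1..n. norm (a i))"
  by (simp add: lp_norm_def sum_nonneg)

lemma lp_norm_infinity: "lp_norm \<infinity> n a = (MAX i\<in>{1..n}. norm (a i))"
  by (simp add: lp_norm_def)

lemma lp_norm_real: "0 \<le> P \<Longrightarrow> lp_norm (ennreal P) n a = (\<Sum>i=1..n. norm (a i) powr P) powr (1 / P)"
  by (simp add: lp_norm_def)

lemma le_MAX: "i \<in> {1..n} \<Longrightarrow> f i \<le> (MAX i\<in>{1..n::nat}. f i :: real)"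
  by (intro Max_ge) auto

lemma lp_norm_nonneg: "1 \<le> n \<Longrightarrow> 0 \<le> lp_norm p n a"
proof (cases "p = \<infinity>")
  case True
  assume "1 \<le> n"
  then have "norm (a 1) \<le> (MAX i\<in>{1..n}. norm (a i))" by (intro le_MAX) auto
  then show ?thesis unfolding True lp_norm_infinity using norm_ge_zero order_trans by blast
qed (simp add: lp_norm_def)

lemma lp_norm_cong: "(\<And>i. i \<in> {1..n} \<Longrightarrow> norm (a i) = norm (b i)) \<Longrightarrow> lp_norm p n a = lp_norm p n b"
  by (simp add: lp_norm_def)

lemma lp_norm_zero: "1 \<le> n \<Longrightarrow> lp_norm p n (\<lambda>_. 0) = 0"
  by (simp add: lp_norm_def)

lemma Holder_inequality_finite_sum:
  fixes u v :: "'i \<Rightarrow> real"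
  assumes PQ: "1 < P" "1 < Q" "1 / P + 1 / Q = 1" and I: "finite I"
    and nonneg: "\<And>i. i \<in> I \<Longrightarrow> 0 \<le> u i" "\<And>i. i \<in> I \<Longrightarrow> 0 \<le> v i"
  shows "(\<Sum>i\<in>I. u i * v i) \<le> (\<Sum>i\<in>I. u i powr P) powr (1 / P) * (\<Sum>i\<in>I. v i powr Q) powr (1 / Q)"
proof -
  define U where "U = (\<Sum>i\<in>I. u i powr P)"
  define V where "V = (\<Sum>i\<in>I. v i powr Q)"
  have UV0: "0 \<le> U" "0 \<le> V" by (simp_all add: U_def V_def sum_nonneg)
  show ?thesis
  proof (cases "U = 0 \<or> V = 0")
    case True
    then have "u i * v i = 0" if "i \<in> I" for i
      using that I by (auto simp: U_def V_def sum_nonneg_eq_0_iff)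
    then have "(\<Sum>i\<in>I. u i * v i) = 0" by (rule sum.neutral[OF ballI])
    then show ?thesis by simp
  next
    case False
    then have pos: "0 < U" "0 < V" using UV0 by auto
    define x where "x = U powr (1 / P)"
    define y where "y = V powr (1 / Q)"
    have xy: "0 < x" "0 < y" "x powr P = U" "y powr Q = V"
      using pos PQ by (simp_all add: x_def y_def powr_powr)
    have "(\<Sum>i\<in>I. (u i / x) * (v i / y)) \<le> (\<Sum>i\<in>I. (u i powr P / U) / P + (v i powr Q / V) / Q)"
    proof (rule sum_mono)
      fix i assume i: "i \<in> I"
      have "(u i / x) * (v i / y) \<le> (u i / x) powr P / P + (v i / y) powr Q / Q"
        using nonneg i xy by (intro Youngs_inequality PQ) auto
      then show "(u i / x) * (v i / y) \<le> (u i powr P / U) / P + (v i powr Q / V) / Q"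
        using nonneg i xy by (simp add: powr_divide)
    qed
    also have "\<dots> = (U / U) / P + (V / V) / Q"
      by (simp add: sum.distrib U_def V_def flip: sum_divide_distrib)
    also have "\<dots> = 1" using pos PQ(3) by simp
    finally have "(\<Sum>i\<in>I. u i * v i) / (x * y) \<le> 1" by (simp add: sum_divide_distrib)
    then show ?thesis using xy by (simp add: x_def y_def U_def V_def divide_simps)
  qed
qed

lemma lp_norm_Holder:
  fixes a b :: "nat \<Rightarrow> 'k::real_normed_field"
  assumes "1 \<le> p" "1 / p + 1 / q = 1" and n: "1 \<le> n"
  shows "(\<Sum>i=1..n. norm (a i) * norm (b i)) \<le> lp_norm p n a * lp_norm q n b"
  using assms(1,2)
proof (cases rule: conjugate_exponents_cases)
  case 1
  have "(\<Sum>i=1..n. norm (a i) * norm (b i)) \<le> (\<Sum>i=1..n. norm (a i) * (MAX i\<in>{1..n}. norm (b i)))"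
    by (intro sum_mono mult_left_mono le_MAX) auto
  then show ?thesis unfolding 1 lp_norm_1 lp_norm_infinity by (simp add: sum_distrib_right)
next
  case 2
  have "(\<Sum>i=1..n. norm (a i) * norm (b i)) \<le> (\<Sum>i=1..n. (MAX i\<in>{1..n}. norm (a i)) * norm (b i))"
    by (intro sum_mono mult_right_mono le_MAX) auto
  then show ?thesis unfolding 2 lp_norm_1 lp_norm_infinity by (simp add: sum_distrib_left)
next
  case (3 P Q)
  then show ?thesis
    using Holder_inequality_finite_sum[OF 3(3-5), of "{1..n}" "\<lambda>i. norm (a i)" "\<lambda>i. norm (b i)"]
    by (simp add: lp_norm_real)
qed

text \<open>The extremal \<open>b\<close> is a unit vector at a largest entry for \<open>p = 1\<close>, constant for \<open>p = \<infinity>\<close>, and \<open>(\<bar>c\<^sub>i\<bar> / N)\<^sup>Q\<^sup>-\<^sup>1\<close>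
  with \<open>N\<close> the norm of \<open>c\<close> otherwise.\<close>

lemma lp_norm_attained:
  fixes c :: "nat \<Rightarrow> 'k::real_normed_field"
  assumes "1 \<le> p" "1 / p + 1 / q = 1" and n: "1 \<le> n"
  obtains b :: "nat \<Rightarrow> 'k" where "\<And>i. i \<in> {1..n} \<Longrightarrow> norm (b i) \<le> 1" "lp_norm p n b \<le> 1"
    "lp_norm q n c \<le> (\<Sum>i=1..n. norm (c i) * norm (b i))"
  using assms(1,2)
proof (cases rule: conjugate_exponents_cases)
  case 1
  have "(MAX i\<in>{1..n}. norm (c i)) \<in> (\<lambda>i. norm (c i)) ` {1..n}" using n by (intro Max_in) auto
  then obtain i where i: "i \<in> {1..n}" "(MAX i\<in>{1..n}. norm (c i)) = norm (c i)" by blast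
  define b where "b j = (if j = i then 1 else 0 :: 'k)" for j
  have "(\<Sum>j=1..n. norm (b j)) = (\<Sum>j=1..n. if j = i then 1 else 0)" by (intro sum.cong) (auto simp: b_def)
  then have "lp_norm p n b \<le> 1" using i(1) unfolding 1 lp_norm_1 by simp
  moreover have "(\<Sum>j=1..n. norm (c j) * norm (b j)) = (\<Sum>j=1..n. if j = i then norm (c i) else 0)"
    by (intro sum.cong) (auto simp: b_def)
  then have "lp_norm q n c \<le> (\<Sum>j=1..n. norm (c j) * norm (b j))"
    using i unfolding 1 lp_norm_infinity by simp
  ultimately show ?thesis using that[of b] by (simp add: b_def)
next
  case 2
  have "lp_norm p n (\<lambda>_. 1 :: 'k) \<le> 1" using n unfolding 2 lp_norm_infinity by simp
  then show ?thesis using that[of "\<lambda>_. 1"] unfolding 2 lp_norm_1 by simp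
next
  case (3 P Q)
  define V where "V = (\<Sum>i=1..n. norm (c i) powr Q)"
  define N where "N = V powr (1 / Q)"
  have lpc: "lp_norm q n c = N" unfolding 3 N_def V_def using 3 by (intro lp_norm_real) auto
  have V0: "0 \<le> V" by (simp add: V_def sum_nonneg)
  show ?thesis
  proof (cases "V = 0")
    case True
    then have "N = 0" using 3 by (simp add: N_def)
    then show ?thesis using that[of "\<lambda>_. 0"] lpc n by (simp add: lp_norm_zero)
  next
    case False
    then have V: "0 < V" using V0 by simp
    have N: "0 < N" "N powr Q = V" using V 3 by (simp_all add: N_def powr_powr)
    define b where "b i = (of_real ((norm (c i) / N) powr (Q - 1)) :: 'k)" for i
    have nb: "norm (b i) = (norm (c i) / N) powr (Q - 1)" for i by (simp add: b_def)
    have QP: "(Q - 1) * P = Q"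
    proof -
      have "P * Q * (1 / P + 1 / Q) = P * Q" using 3(5) by simp
      then have "Q + P = P * Q" using 3(3,4) by (simp add: distrib_left)
      then show ?thesis by (simp add: algebra_simps)
    qed
    have sum1: "(\<Sum>i=1..n. norm (b i) powr P) = 1"
    proof -
      have "(\<Sum>i=1..n. norm (b i) powr P) = (\<Sum>i=1..n. norm (c i) powr Q / V)"
        using N by (intro sum.cong) (simp_all add: nb powr_powr QP powr_divide)
      also have "\<dots> = V / V" by (simp only: V_def sum_divide_distrib)
      finally show ?thesis using V by simp
    qed
    have le1: "norm (b i) \<le> 1" if i: "i \<in> {1..n}" for i
    proof -
      have "norm (b i) powr P \<le> 1"
        unfolding sum1[symmetric] using i by (intro member_le_sum) auto
      then have "(norm (b i) powr P) powr (1 / P) \<le> 1 powr (1 / P)" using 3 by (intro powr_mono2) auto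
      then show ?thesis using 3 by (simp add: powr_powr)
    qed
    have "lp_norm p n b = (\<Sum>i=1..n. norm (b i) powr P) powr (1 / P)"
      unfolding 3 using 3 by (intro lp_norm_real) auto
    then have "lp_norm p n b \<le> 1" unfolding sum1 by simp
    moreover have "(\<Sum>i=1..n. norm (c i) * norm (b i)) = N"
    proof -
      have cb: "norm (c i) * norm (b i) = norm (c i) powr Q * (N / V)" for i
      proof (cases "c i = 0")
        case False
        then have "norm (c i) powr Q = norm (c i) * norm (c i) powr (Q - 1)"
          by (simp add: powr_diff)
        moreover have "V = N * N powr (Q - 1)" using N by (simp add: powr_diff)
        ultimately show ?thesis using N by (simp add: nb powr_divide)
      qed (use 3 in simp)
      have "(\<Sum>i=1..n. norm (c i) * norm (b i)) = V * (N / V)"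
        unfolding cb by (simp only: V_def sum_distrib_right)
      then show ?thesis using V by simp
    qed
    ultimately show ?thesis using that[of b] le1 lpc by simp
  qed
qed

section \<open>Finite-dimensional spaces\<close>

lemma seminorm_basis_sum_le:
  fixes \<rho> :: "(nat \<Rightarrow> 'a::real_normed_field) \<Rightarrow> real"
  assumes s: "seminorm_on_coord n \<rho>" and "m \<le> n"
  shows "\<rho> (basis_sum m a) \<le> (\<Sum>i=1..m. norm (a i) * \<rho> (basis_vec i))"
  using assms(2)
proof (induction m)
  case 0
  have "(\<lambda>_. 0 :: 'a) \<in> coord_space n" by (simp add: coord_space_def)
  then have "\<rho> (\<lambda>i. c * (\<lambda>_. 0) i) = norm c * \<rho> (\<lambda>_. 0)" for c
    using s unfolding seminorm_on_coord_def by meson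
  from this[of 0] show ?case by (simp add: basis_sum_eq)
next
  case (Suc m)
  have b: "(basis_vec (Suc m) :: nat \<Rightarrow> 'a) \<in> coord_space n" using Suc.prems by (intro basis_vec_in_coord_space) auto
  have c: "(\<lambda>j. a (Suc m) * basis_vec (Suc m) j) \<in> coord_space n" using b by (auto simp: coord_space_def)
  have "basis_sum (Suc m) a = (\<lambda>j. basis_sum m a j + a (Suc m) * basis_vec (Suc m) j)"
    by (simp add: basis_sum_def)
  then have "\<rho> (basis_sum (Suc m) a) \<le> \<rho> (basis_sum m a) + \<rho> (\<lambda>j. a (Suc m) * basis_vec (Suc m) j)"
    using s c basis_sum_in_coord_space[of m n a] Suc.prems by (simp add: seminorm_on_coord_def)
  also have "\<rho> (\<lambda>j. a (Suc m) * basis_vec (Suc m) j) = norm (a (Suc m)) * \<rho> (basis_vec (Suc m))"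
    using s b by (simp add: seminorm_on_coord_def)
  finally show ?case using Suc by simp
qed

lemma seminorm_scale_basis_sum:
  assumes "seminorm_on_coord n \<rho>"
  shows "\<rho> (basis_sum n (\<lambda>i. c * a i)) = norm c * \<rho> (basis_sum n a)"
    and "\<rho> (\<lambda>i. c * basis_sum n a i) = norm c * \<rho> (basis_sum n a)"
proof -
  show 1: "\<rho> (\<lambda>i. c * basis_sum n a i) = norm c * \<rho> (basis_sum n a)"
    using assms basis_sum_in_coord_space[of n n a] by (simp add: seminorm_on_coord_def)
  have "basis_sum n (\<lambda>i. c * a i) = (\<lambda>i. c * basis_sum n a i)" by (auto simp: basis_sum_eq)
  then show "\<rho> (basis_sum n (\<lambda>i. c * a i)) = norm c * \<rho> (basis_sum n a)" using 1 by simp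
qed

lemma asymptotic_pairs_seminorms:
  assumes "(r, \<rho>) \<in> asymptotic_pairs S smul \<Phi> T n"
  shows "seminorm_on_coord n r" "seminorm_on_coord n \<rho>"
  using assms by (auto simp: asymptotic_pairs_def norm_on_coord_def)

lemma asymptotic_pairs_frequently:
  assumes "(r, \<rho>) \<in> asymptotic_pairs S smul \<Phi> T n" "0 < \<delta>"
  shows "frequently (approximates smul T n \<delta> r \<rho>) (tree_filter (sphere_filter S \<Phi>) n)"
  using assms unfolding asymptotic_pairs_def asymptotic_pairs_tree_filter by blast

lemma (in asymptotic_setting) asymptotic_seminorm_vanishes:
  assumes pair: "(r, \<rho>) \<in> asymptotic_pairs S smul \<Phi> T n"
    and T: "\<And>\<epsilon>. 0 < \<epsilon> \<Longrightarrow> eventually (\<lambda>v. norm (T v) < \<epsilon>) G" and i: "i \<in> {1..n}"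
  shows "\<rho> (basis_vec i) = 0"
proof -
  have "0 \<le> \<rho> (basis_vec i)"
    using asymptotic_pairs_seminorms(2)[OF pair] by (simp add: seminorm_on_coord_def basis_vec_in_coord_space[OF i])
  moreover have "\<rho> (basis_vec i) \<le> 0"
  proof (rule field_le_epsilon)
    fix \<epsilon> :: real assume "0 < \<epsilon>"
    then have e: "0 < \<epsilon> / 2" by simp
    obtain vs where vs: "approximates smul T n (\<epsilon> / 2) r \<rho> vs" "length vs = n" "\<forall>v\<in>set vs. norm (T v) < \<epsilon> / 2"
      using frequently_ex[OF frequently_eventually_frequently[OF asymptotic_pairs_frequently[OF pair e]
          eventually_tree_filter_elements[OF T[OF e], of n]]] by blast
    have "norm (T (vs ! (i - 1))) < \<epsilon> / 2" using vs i by auto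
    moreover have "\<bar>norm (T (vs ! (i - 1))) - \<rho> (basis_vec i)\<bar> < \<epsilon> / 2"
    proof -
      have "i - 1 < n" using i by auto
      from approximates_basis_vec[OF vs(1) vector_space_axioms this] show ?thesis using i by simp
    qed
    ultimately show "\<rho> (basis_vec i) \<le> 0 + \<epsilon>" by linarith
  qed
  ultimately show ?thesis by simp
qed

lemma eventually_sphere_filter_sum_small:
  assumes B: "finite B" and \<phi>: "\<And>b. b \<in> B \<Longrightarrow> \<phi> b \<in> \<Phi>" and \<epsilon>: "0 < \<epsilon>"
  shows "eventually (\<lambda>v. (\<Sum>b\<in>B. M b * norm (\<phi> b v)) < \<epsilon>) (sphere_filter S \<Phi>)"
proof -
  have "((\<lambda>v. \<Sum>b\<in>B. M b * norm (\<phi> b v)) \<longlongrightarrow> (\<Sum>b\<in>B. M b * 0)) (sphere_filter S \<Phi>)"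
  proof (intro tendsto_sum tendsto_mult_left)
    fix b assume "b \<in> B"
    then show "((\<lambda>v. norm (\<phi> b v)) \<longlongrightarrow> 0) (sphere_filter S \<Phi>)"
      using eventually_sphere_filter_small[OF \<phi>] by (simp add: tendsto_iff)
  qed
  from order_tendstoD(2)[OF this, of \<epsilon>] show ?thesis using \<epsilon> by simp
qed

text \<open>Weakly null nets are mapped to norm null nets, because the coordinates in \<open>Y\<close> are finitely many
  continuous functionals.\<close>

lemma (in operator_between) finite_dim_range_vanishes:
  assumes fin: "finite_dim scaleY" and pair: "(r, \<rho>) \<in> asymptotic_structure scaleX A n" and i: "i \<in> {1..n}"
  shows "\<rho> (basis_vec i) = 0"
proof -
  interpret X: asymptotic_setting scaleX UNIV "weak_functionals scaleX" "blinfun_apply A"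
    by (rule weak_setting[OF X Y A])
  interpret Y: banach_over scaleY by (rule Y)
  obtain B c where B: "finite B" "\<And>b. b \<in> B \<Longrightarrow> c b \<in> dual scaleY"
    "\<And>y. y = (\<Sum>b\<in>B. scaleY ((c b) \<cdot> y) b)"
    using finite_dim_coordinates[OF Y fin] by metis
  show ?thesis
  proof (rule X.asymptotic_seminorm_vanishes[OF _ _ i])
    show "(r, \<rho>) \<in> asymptotic_pairs UNIV scaleX (weak_functionals scaleX) (blinfun_apply A) n"
      using pair by (simp add: asymptotic_structure_def split: if_splits)
    fix \<epsilon> :: real assume "0 < \<epsilon>"
    then have "eventually (\<lambda>x. (\<Sum>b\<in>B. norm b * norm ((adjoint_op A (c b)) \<cdot> x)) < \<epsilon>) weak_filter"
    proof (intro eventually_sphere_filter_sum_small B(1))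
      fix b assume "b \<in> B"
      then show "blinfun_apply (adjoint_op A (c b)) \<in> weak_functionals scaleX"
        unfolding weak_functionals_def by (intro imageI adjoint_op_in_dual[OF A] B(2))
    qed
    then show "eventually (\<lambda>x. norm (A \<cdot> x) < \<epsilon>) weak_filter"
    proof (rule eventually_mono)
      fix x assume "(\<Sum>b\<in>B. norm b * norm ((adjoint_op A (c b)) \<cdot> x)) < \<epsilon>"
      moreover have "norm (\<Sum>b\<in>B. scaleY ((c b) \<cdot> (A \<cdot> x)) b) \<le>
          (\<Sum>b\<in>B. norm b * norm ((adjoint_op A (c b)) \<cdot> x))"
        by (intro sum_norm_le) (simp add: Y.norm_smul mult.commute)
      ultimately show "norm (A \<cdot> x) < \<epsilon>" using B(3)[of "A \<cdot> x"] by simp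
    qed
  qed
qed

text \<open>The adjoint maps weak*-null nets to norm null nets, because the norm of a functional on \<open>X\<close> is controlled by its
  values at finitely many vectors.\<close>

lemma (in operator_between) finite_dim_domain_vanishes:
  assumes fin: "finite_dim scaleX" and pair: "(r, \<rho>) \<in> weakstar_asymptotic_structure scaleY A n" and i: "i \<in> {1..n}"
  shows "\<rho> (basis_vec i) = 0"
proof -
  interpret D: asymptotic_setting dual_scale "dual scaleY" weakstar_functionals "adjoint_op A"
    by (rule weakstar_setting)
  obtain B c where B: "finite B" "\<And>b. b \<in> B \<Longrightarrow> c b \<in> dual scaleX"
    "\<And>x. x = (\<Sum>b\<in>B. scaleX ((c b) \<cdot> x) b)"
    using finite_dim_coordinates[OF X fin] by metis
  show ?thesis
  proof (rule D.asymptotic_seminorm_vanishes[OF _ _ i])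
    show "(r, \<rho>) \<in> asymptotic_pairs (dual scaleY) dual_scale weakstar_functionals (adjoint_op A) n"
      using pair by (simp add: weakstar_asymptotic_structure_def split: if_splits)
    fix \<epsilon> :: real assume "0 < \<epsilon>"
    then have "eventually (\<lambda>f. (\<Sum>b\<in>B. norm (c b) * norm ((\<lambda>f. f \<cdot> (A \<cdot> b)) f)) < \<epsilon>) weakstar_filter"
      using B(1) by (intro eventually_sphere_filter_sum_small) (auto simp: weakstar_functionals_def)
    with eventually_sphere_filter_unit show "eventually (\<lambda>f. norm (adjoint_op A f) < \<epsilon>) weakstar_filter"
    proof eventually_elim
      case (elim f)
      then have f: "adjoint_op A f \<in> dual scaleX" by (intro adjoint_op_in_dual[OF A]) auto
      have "norm (adjoint_op A f) \<le> (\<Sum>b\<in>B. norm (c b) * norm (f \<cdot> (A \<cdot> b)))"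
      proof (rule norm_blinfun_bound)
        fix x
        have "(adjoint_op A f) \<cdot> x =
            (adjoint_op A f) \<cdot> (\<Sum>b\<in>B. scaleX ((c b) \<cdot> x) b)"
          using B(3)[of x] by simp
        also have "\<dots> = (\<Sum>b\<in>B. (c b) \<cdot> x * f \<cdot> (A \<cdot> b))"
          unfolding blinfun.sum_right dual_apply_scale[OF f] by simp
        also have "norm \<dots> \<le> (\<Sum>b\<in>B. norm (c b) * norm (f \<cdot> (A \<cdot> b)) * norm x)"
        proof (rule sum_norm_le)
          fix b assume "b \<in> B"
          have "norm ((c b) \<cdot> x) * norm (f \<cdot> (A \<cdot> b)) \<le>
              (norm (c b) * norm x) * norm (f \<cdot> (A \<cdot> b))"
            by (intro mult_right_mono norm_blinfun) auto
          then show "norm ((c b) \<cdot> x * f \<cdot> (A \<cdot> b)) \<le>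
              norm (c b) * norm (f \<cdot> (A \<cdot> b)) * norm x"
            by (simp add: norm_mult mult_ac)
        qed
        finally show "norm ((adjoint_op A f) \<cdot> x) \<le>
            (\<Sum>b\<in>B. norm (c b) * norm (f \<cdot> (A \<cdot> b))) * norm x"
          by (simp add: sum_distrib_right)
      qed (auto intro: sum_nonneg)
      then show ?case using elim(2) by simp
    qed
  qed
qed

section \<open>Type and cotype as inequalities with uniform constants\<close>

lemma bounded_uniformly_iff:
  fixes P :: "nat \<Rightarrow> real \<Rightarrow> bool"
  assumes mono: "\<And>n S T. 1 \<le> n \<Longrightarrow> P n S \<Longrightarrow> S \<le> T \<Longrightarrow> P n T"
  shows "(SUP n\<in>{1..}. Inf {ennreal T |T. 0 < T \<and> P n T}) < \<infinity> \<longleftrightarrow> (\<exists>T>0. \<forall>n\<ge>1. P n T)"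
proof
  assume "(SUP n\<in>{1..}. Inf {ennreal T |T. 0 < T \<and> P n T}) < \<infinity>"
  then obtain M where M: "0 \<le> M" "(SUP n\<in>{1..}. Inf {ennreal T |T. 0 < T \<and> P n T}) = ennreal M"
    using that[of "enn2real (SUP n\<in>{1..}. Inf {ennreal T |T. 0 < T \<and> P n T})"] by (simp add: less_top)
  have "P n (M + 1)" if n: "1 \<le> n" for n
  proof -
    have "Inf {ennreal T |T. 0 < T \<and> P n T} \<le> ennreal M"
      unfolding M(2)[symmetric] using n by (intro SUP_upper) auto
    also have "\<dots> < ennreal (M + 1)" using M(1) by (intro ennreal_lessI) auto
    finally obtain T where "0 < T" "P n T" "ennreal T < ennreal (M + 1)" unfolding Inf_less_iff by blast
    then show ?thesis using mono[OF n] by (auto simp: ennreal_less_iff)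
  qed
  then show "\<exists>T>0. \<forall>n\<ge>1. P n T" using M(1) by (intro exI[of _ "M + 1"]) auto
next
  assume "\<exists>T>0. \<forall>n\<ge>1. P n T"
  then obtain T where T: "T > 0" "\<And>n. 1 \<le> n \<Longrightarrow> P n T" by blast
  have "(SUP n\<in>{1..}. Inf {ennreal T |T. 0 < T \<and> P n T}) \<le> ennreal T"
    using T by (intro SUP_least Inf_lower) auto
  then show "(SUP n\<in>{1..}. Inf {ennreal T |T. 0 < T \<and> P n T}) < \<infinity>"
    by (rule le_less_trans) simp
qed

lemma tendsto_zero_iff:
  fixes P :: "nat \<Rightarrow> real \<Rightarrow> bool"
  assumes mono: "\<And>n S T. 1 \<le> n \<Longrightarrow> P n S \<Longrightarrow> S \<le> T \<Longrightarrow> P n T"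
  shows "(\<lambda>n. Inf {ennreal T |T. 0 < T \<and> P n T}) \<longlonglongrightarrow> 0 \<longleftrightarrow> (\<forall>\<epsilon>>0. \<exists>N. \<forall>n\<ge>N. 1 \<le> n \<longrightarrow> P n \<epsilon>)"
proof (intro iffI allI impI)
  fix \<epsilon> :: real
  assume "(\<lambda>n. Inf {ennreal T |T. 0 < T \<and> P n T}) \<longlonglongrightarrow> 0" "0 < \<epsilon>"
  then have "eventually (\<lambda>n. Inf {ennreal T |T. 0 < T \<and> P n T} < ennreal \<epsilon>) sequentially"
    by (intro order_tendstoD(2)) auto
  then obtain N where N: "\<And>n. n \<ge> N \<Longrightarrow> Inf {ennreal T |T. 0 < T \<and> P n T} < ennreal \<epsilon>"
    unfolding eventually_sequentially by blast
  have "P n \<epsilon>" if n: "n \<ge> N" "1 \<le> n" for n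
  proof -
    obtain T where "0 < T" "P n T" "ennreal T < ennreal \<epsilon>" using N[OF n(1)] unfolding Inf_less_iff by blast
    then show ?thesis using mono[OF n(2)] by (auto simp: ennreal_less_iff)
  qed
  then show "\<exists>N. \<forall>n\<ge>N. 1 \<le> n \<longrightarrow> P n \<epsilon>" by blast
next
  assume P: "\<forall>\<epsilon>>0. \<exists>N. \<forall>n\<ge>N. 1 \<le> n \<longrightarrow> P n \<epsilon>"
  show "(\<lambda>n. Inf {ennreal T |T. 0 < T \<and> P n T}) \<longlonglongrightarrow> 0"
  proof (rule order_tendstoI)
    fix a :: ennreal assume "0 < a"
    then obtain e where e: "0 < e" "e < a" using dense by blast
    then obtain \<epsilon> where \<epsilon>: "e = ennreal \<epsilon>" "0 \<le> \<epsilon>" by (cases e) auto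
    then have "0 < \<epsilon>" using e by (simp add: order_less_le)
    then obtain N where N: "\<And>n. n \<ge> N \<Longrightarrow> 1 \<le> n \<Longrightarrow> P n \<epsilon>" using P by blast
    have "Inf {ennreal T |T. 0 < T \<and> P n T} < a" if "n \<ge> max N 1" for n
    proof (rule le_less_trans[OF Inf_lower])
      show "ennreal \<epsilon> \<in> {ennreal T |T. 0 < T \<and> P n T}" using N[of n] that \<open>0 < \<epsilon>\<close> by auto
    qed (use e \<epsilon> in simp)
    then show "eventually (\<lambda>n. Inf {ennreal T |T. 0 < T \<and> P n T} < a) sequentially"
      unfolding eventually_sequentially by blast
  qed simp
qed

lemma weakstar_structure_seminorms:
  assumes "(r, \<rho>) \<in> weakstar_asymptotic_structure scaleY A n"
  shows "seminorm_on_coord n r" "seminorm_on_coord n \<rho>"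
  using assms asymptotic_pairs_seminorms
  by (auto simp: weakstar_asymptotic_structure_def split: if_splits)

lemma structure_seminorms:
  assumes "(r, \<rho>) \<in> asymptotic_structure scaleX A n"
  shows "seminorm_on_coord n r" "seminorm_on_coord n \<rho>"
  using assms asymptotic_pairs_seminorms
  by (auto simp: asymptotic_structure_def split: if_splits)

lemma seminorm_basis_sum_nonneg: "seminorm_on_coord n r \<Longrightarrow> 0 \<le> r (basis_sum n a)"
  by (simp add: seminorm_on_coord_def basis_sum_in_coord_space)

lemma seminorm_basis_vec_nonneg: "seminorm_on_coord n r \<Longrightarrow> i \<in> {1..n} \<Longrightarrow> 0 \<le> r (basis_vec i)"
  unfolding seminorm_on_coord_def using basis_vec_in_coord_space by blast

section \<open>The duality\<close>

lemma coefficient_less: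
  assumes "i \<in> {1..n::nat}"
  shows "norm (a i) < 1 + (\<Sum>i=1..n. norm (a i))"
proof -
  have "norm (a i) \<le> (\<Sum>i=1..n. norm (a i))" by (rule member_le_sum) (use assms in auto)
  then show ?thesis by simp
qed

lemma norm_normalized_coefficient_le:
  fixes a :: "nat \<Rightarrow> 'k::real_normed_field"
  assumes "i \<in> {1..n}"
  shows "norm (of_real (1 / (1 + (\<Sum>i=1..n. norm (a i)))) * a i) \<le> 1"
proof -
  have "0 < 1 + (\<Sum>i=1..n. norm (a i))" by (simp add: add_pos_nonneg sum_nonneg)
  then show ?thesis using coefficient_less[OF assms, of a] by (simp only: norm_mult norm_of_real) simp
qed

text \<open>The restriction to coefficients \<open>a\<close> in the unit cube disappears by homogeneity.\<close>

lemma (in operator_between) weakstar_pair_dominated_all: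
  assumes inf: "\<not> finite_dim scaleX"
    and pair: "(r, \<rho>) \<in> weakstar_asymptotic_structure scaleY A n"
    and b: "\<And>i. i \<in> {1..n} \<Longrightarrow> norm (b i :: 'k) \<le> 1" and \<eta>: "0 < \<eta>"
  obtains r' \<rho>' b' where "(r', \<rho>') \<in> asymptotic_structure scaleX A n" "\<And>i. norm (b' i :: 'k) = norm (b i)"
    "(\<Sum>i=1..n. norm (a i) * norm (b i) * \<rho> (basis_vec i)) \<le> 2 * r (basis_sum n a) * \<rho>' (basis_sum n b') + \<eta>"
proof -
  define M where "M = 1 + (\<Sum>i=1..n. norm (a i))"
  have M: "0 < M" by (simp add: M_def add_pos_nonneg sum_nonneg)
  define a' where "a' i = of_real (1 / M) * a i" for i
  have na': "norm (a' i) = norm (a i) / M" for i unfolding a'_def norm_mult norm_of_real using M by simp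
  have a': "norm (a' i) \<le> 1" if "i \<in> {1..n}" for i
    unfolding a'_def M_def using that by (rule norm_normalized_coefficient_le)
  have \<eta>M: "0 < \<eta> / M" using \<eta> M by simp
  obtain r' \<rho>' b' where *: "(r', \<rho>') \<in> asymptotic_structure scaleX A n" "\<And>i. norm (b' i :: 'k) = norm (b i)"
    "(\<Sum>i=1..n. norm (a' i) * norm (b i) * \<rho> (basis_vec i)) \<le> 2 * r (basis_sum n a') * \<rho>' (basis_sum n b') + \<eta> / M"
    by (rule weakstar_pair_dominated[where a = a' and b = b, OF inf pair a' b \<eta>M]) (assumption, assumption, rule that)
  have "r (basis_sum n a') = norm (of_real (1 / M) :: 'k) * r (basis_sum n a)"
    unfolding a'_def by (rule seminorm_scale_basis_sum(1)[OF weakstar_structure_seminorms(1)[OF pair]])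
  then have "r (basis_sum n a') = r (basis_sum n a) / M" unfolding norm_of_real using M by simp
  moreover have "(\<Sum>i=1..n. norm (a' i) * norm (b i) * \<rho> (basis_vec i)) =
      (\<Sum>i=1..n. norm (a i) * norm (b i) * \<rho> (basis_vec i)) / M"
    unfolding na' by (simp add: sum_divide_distrib)
  ultimately have "(\<Sum>i=1..n. norm (a i) * norm (b i) * \<rho> (basis_vec i)) / M \<le>
      (2 * r (basis_sum n a) * \<rho>' (basis_sum n b') + \<eta>) / M"
    using *(3) by (simp add: add_divide_distrib)
  then have "(\<Sum>i=1..n. norm (a i) * norm (b i) * \<rho> (basis_vec i)) \<le>
      2 * r (basis_sum n a) * \<rho>' (basis_sum n b') + \<eta>"
    using M by (simp add: divide_le_cancel)
  then show ?thesis using that *(1,2) by blast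
qed

lemma (in operator_between) frequently_norming_functional:
  assumes pair: "(r, \<rho>) \<in> asymptotic_structure scaleX A n"
    and b: "\<And>i. i \<in> {1..n} \<Longrightarrow> norm (b i :: 'k) \<le> 1" and \<delta>: "0 < \<delta>"
  shows "frequently (\<lambda>xs. \<exists>g\<in>dual_ball scaleY. length xs = n \<and> (\<forall>x\<in>set xs. norm x = 1) \<and>
      \<rho> (basis_sum n b) - \<delta> \<le> (\<Sum>i<n. norm (b (Suc i)) * norm (g \<cdot> (A \<cdot> (xs ! i)))))
    (tree_filter weak_filter n)"
proof -
  have pair': "(r, \<rho>) \<in> asymptotic_pairs UNIV scaleX (weak_functionals scaleX) (blinfun_apply A) n"
    using pair by (simp add: asymptotic_structure_def split: if_splits)
  show ?thesis
  proof (rule frequently_elim1[OF frequently_eventually_frequently[OF asymptotic_pairs_frequently[OF pair' \<delta>]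
        eventually_tree_filter_elements[OF eventually_sphere_filter_unit]]])
    fix xs assume xs: "approximates scaleX (blinfun_apply A) n \<delta> r \<rho> xs \<and> length xs = n \<and>
      (\<forall>v\<in>set xs. v \<in> UNIV \<and> norm v = 1)"
    then have app: "approximates scaleX (blinfun_apply A) n \<delta> r \<rho> xs" by blast
    have bb: "\<forall>i\<in>{1..n}. norm (b i) \<le> 1" using b by blast
    define v where "v = A \<cdot> (comb scaleX n b xs)"
    have "\<bar>norm v - \<rho> (basis_sum n b)\<bar> < \<delta>"
      using app[unfolded approximates_def, THEN spec, THEN mp, OF bb] unfolding v_def by (rule conjunct2)
    then have v: "\<rho> (basis_sum n b) - \<delta> \<le> norm v" by linarith
    obtain g where g: "g \<in> dual scaleY" "norm g \<le> 1" "norm (g \<cdot> v) = norm v"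
      by (rule norming_functional[OF Y])
    have "v = (\<Sum>i<n. scaleY (b (Suc i)) (A \<cdot> (xs ! i)))"
      using A unfolding v_def comb_lessThan by (simp add: blinfun.sum_right linear_over_def)
    then have "g \<cdot> v = (\<Sum>i<n. b (Suc i) * g \<cdot> (A \<cdot> (xs ! i)))"
      by (simp add: blinfun.sum_right dual_apply_scale[OF g(1)])
    then have "norm v \<le> (\<Sum>i<n. norm (b (Suc i)) * norm (g \<cdot> (A \<cdot> (xs ! i))))"
      unfolding g(3)[symmetric] by (auto intro!: sum_norm_le simp: norm_mult)
    then show "\<exists>g\<in>dual_ball scaleY. length xs = n \<and> (\<forall>x\<in>set xs. norm x = 1) \<and>
      \<rho> (basis_sum n b) - \<delta> \<le> (\<Sum>i<n. norm (b (Suc i)) * norm (g \<cdot> (A \<cdot> (xs ! i))))"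
      using v xs g(1,2) by (intro bexI[of _ g]) (auto simp: dual_ball_def)
  qed
qed

text \<open>The counterpart of \<open>weakstar_pair_dominated_all\<close>: the functional \<open>g\<close> norms the image of \<open>\<Sum> b\<^sub>i x\<^sub>i\<close>, after \<open>b\<close> has
  been scaled into the unit cube.\<close>

lemma (in operator_between) pair_dominated:
  assumes inf: "\<not> finite_dim scaleY"
    and pair: "(r, \<rho>) \<in> asymptotic_structure scaleX A n" and \<eta>: "0 < \<eta>"
  obtains r' \<rho>' l where "(r', \<rho>') \<in> weakstar_asymptotic_structure scaleY A n" "r' (basis_sum n l) \<le> 3"
    "\<rho> (basis_sum n b) \<le> (\<Sum>i=1..n. norm (b i :: 'k) * (norm (l i :: 'k) * \<rho>' (basis_vec i))) + \<eta>"
proof -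
  define M where "M = 1 + (\<Sum>i=1..n. norm (b i))"
  have M: "0 < M" by (simp add: M_def add_pos_nonneg sum_nonneg)
  define b' where "b' i = of_real (1 / M) * b i" for i
  have nb': "norm (b' i) = norm (b i) / M" for i unfolding b'_def norm_mult norm_of_real using M by simp
  have b': "norm (b' i) \<le> 1" if "i \<in> {1..n}" for i
    unfolding b'_def M_def using that by (rule norm_normalized_coefficient_le)
  define \<delta> where "\<delta> = \<eta> / (2 * M)"
  have \<delta>: "0 < \<delta>" using \<eta> M by (simp add: \<delta>_def)
  define Q where "Q xs g \<longleftrightarrow> length xs = n \<and> (\<forall>x\<in>set xs. norm x = 1) \<and>
      \<rho> (basis_sum n b') - \<delta> \<le> (\<Sum>i<n. norm (b' (Suc i)) * norm (g \<cdot> (A \<cdot> (xs ! i))))"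
    for xs and g :: "'y \<Rightarrow>\<^sub>L 'k"
  have "frequently (\<lambda>xs. \<exists>g\<in>dual_ball scaleY. Q xs g) (tree_filter weak_filter n)"
    unfolding Q_def using b' by (intro frequently_norming_functional[OF pair _ \<delta>])
  then obtain r' \<rho>' l xs g where *: "(r', \<rho>') \<in> weakstar_asymptotic_structure scaleY A n" "r' (basis_sum n l) \<le> 3"
    "length xs = n" "Q xs g" "\<And>i. i < n \<Longrightarrow> norm (xs ! i) = 1"
    "\<And>i. i < n \<Longrightarrow> norm (g \<cdot> (A \<cdot> (xs ! i))) \<le>
       norm (l (Suc i) :: 'k) * \<rho>' (basis_vec (Suc i)) + \<delta>"
    by (rule weakstar_pair_from_functionals[OF inf \<delta>]) (rule that)
  have "(\<Sum>i<n. norm (b' (Suc i)) * norm (g \<cdot> (A \<cdot> (xs ! i)))) \<le>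
      (\<Sum>i<n. norm (b' (Suc i)) * (norm (l (Suc i)) * \<rho>' (basis_vec (Suc i)) + \<delta>))"
    using *(6) by (intro sum_mono mult_left_mono) auto
  also have "\<dots> = (\<Sum>i=1..n. norm (b' i) * (norm (l i) * \<rho>' (basis_vec i) + \<delta>))"
    by (simp add: sum.atLeast1_atMost_eq)
  also have "\<dots> = ((\<Sum>i=1..n. norm (b i) * (norm (l i) * \<rho>' (basis_vec i))) + (\<Sum>i=1..n. norm (b i)) * \<delta>) / M"
    unfolding nb' by (simp add: sum.distrib sum_distrib_right distrib_left add_divide_distrib sum_divide_distrib)
  also have "\<dots> \<le> ((\<Sum>i=1..n. norm (b i) * (norm (l i) * \<rho>' (basis_vec i))) + M * \<delta>) / M"
    using M \<delta> by (intro divide_right_mono add_left_mono mult_right_mono) (auto simp: M_def)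
  finally have "\<rho> (basis_sum n b') \<le> ((\<Sum>i=1..n. norm (b i) * (norm (l i) * \<rho>' (basis_vec i))) + M * \<delta>) / M + \<delta>"
    using *(4) unfolding Q_def by linarith
  also have "\<dots> = ((\<Sum>i=1..n. norm (b i) * (norm (l i) * \<rho>' (basis_vec i))) + \<eta>) / M"
    using M by (simp add: \<delta>_def add_divide_distrib)
  also have "\<rho> (basis_sum n b') = norm (of_real (1 / M) :: 'k) * \<rho> (basis_sum n b)"
    unfolding b'_def by (rule seminorm_scale_basis_sum(1)[OF structure_seminorms(2)[OF pair]])
  finally have "\<rho> (basis_sum n b) / M \<le> ((\<Sum>i=1..n. norm (b i) * (norm (l i) * \<rho>' (basis_vec i))) + \<eta>) / M"
    unfolding norm_of_real using M by simp
  then have "\<rho> (basis_sum n b) \<le> (\<Sum>i=1..n. norm (b i) * (norm (l i) * \<rho>' (basis_vec i))) + \<eta>"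
    using M by (simp add: divide_le_cancel)
  then show ?thesis using that *(1,2) by blast
qed

lemma asymptotic_basic_type_iff:
  "asymptotic_basic_type scaleX p A \<longleftrightarrow> (\<exists>T>0. \<forall>n\<ge>1. \<forall>(r, \<rho>) \<in> asymptotic_structure scaleX A n.
     \<forall>a. \<rho> (basis_sum n a) \<le> T * lp_norm p n a)"
  unfolding asymptotic_basic_type_def alpha_def
proof (rule bounded_uniformly_iff)
  fix n :: nat and S T :: real
  assume n: "1 \<le> n" and S: "\<forall>(r, \<rho>)\<in>asymptotic_structure scaleX A n. \<forall>a. \<rho> (basis_sum n a) \<le> S * lp_norm p n a" and "S \<le> T"
  then have "S * lp_norm p n a \<le> T * lp_norm p n a" for a :: "nat \<Rightarrow> 'a" by (intro mult_right_mono lp_norm_nonneg)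
  then show "\<forall>(r, \<rho>)\<in>asymptotic_structure scaleX A n. \<forall>a. \<rho> (basis_sum n a) \<le> T * lp_norm p n a"
    using S by (fastforce intro: order_trans)
qed

lemma weakstar_asymptotic_basic_cotype_iff:
  "weakstar_asymptotic_basic_cotype scaleY q A \<longleftrightarrow> (\<exists>C>0. \<forall>n\<ge>1. \<forall>(r, \<rho>) \<in> weakstar_asymptotic_structure scaleY A n.
     \<forall>a. C * r (basis_sum n a) \<ge> lp_norm q n (\<lambda>i. a i * of_real (\<rho> (basis_vec i))))"
  unfolding weakstar_asymptotic_basic_cotype_def beta_star_def
proof (rule bounded_uniformly_iff)
  fix n :: nat and S T :: real
  assume S: "\<forall>(r, \<rho>)\<in>weakstar_asymptotic_structure scaleY A n. \<forall>a. lp_norm q n (\<lambda>i. a i * of_real (\<rho> (basis_vec i))) \<le> S * r (basis_sum n a)" and "S \<le> T"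
  then have "S * r (basis_sum n a) \<le> T * r (basis_sum n a)" if "(r, \<rho>) \<in> weakstar_asymptotic_structure scaleY A n" for r \<rho> and a :: "nat \<Rightarrow> 'a"
    using weakstar_structure_seminorms(1)[OF that] by (intro mult_right_mono seminorm_basis_sum_nonneg)
  then show "\<forall>(r, \<rho>)\<in>weakstar_asymptotic_structure scaleY A n. \<forall>a. lp_norm q n (\<lambda>i. a i * of_real (\<rho> (basis_vec i))) \<le> T * r (basis_sum n a)"
    using S by (fastforce intro: order_trans)
qed

lemma MAX_norm_nonneg: "1 \<le> n \<Longrightarrow> 0 \<le> (MAX i\<in>{1..n::nat}. norm (a i))"
  using lp_norm_nonneg[of n \<infinity> a] unfolding lp_norm_infinity .

lemma asymptotic_basic_subtype_iff:
  "asymptotic_basic_subtype scaleX A \<longleftrightarrow> (\<forall>\<epsilon>>0. \<exists>N. \<forall>n\<ge>N. 1 \<le> n \<longrightarrow> (\<forall>(r, \<rho>) \<in> asymptotic_structure scaleX A n.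
     \<forall>a. \<rho> (\<lambda>j. 1 / of_nat n * basis_sum n a j) \<le> \<epsilon> * (MAX i\<in>{1..n}. norm (a i))))"
  unfolding asymptotic_basic_subtype_def theta_def
proof (rule tendsto_zero_iff)
  fix n :: nat and S T :: real
  assume n: "1 \<le> n" and S: "\<forall>(r, \<rho>)\<in>asymptotic_structure scaleX A n. \<forall>a.
    \<rho> (\<lambda>j. 1 / of_nat n * basis_sum n a j) \<le> S * (MAX i\<in>{1..n}. norm (a i))" and "S \<le> T"
  then have "S * (MAX i\<in>{1..n}. norm (a i)) \<le> T * (MAX i\<in>{1..n}. norm (a i))" for a :: "nat \<Rightarrow> 'a"
    by (intro mult_right_mono MAX_norm_nonneg)
  then show "\<forall>(r, \<rho>)\<in>asymptotic_structure scaleX A n. \<forall>a.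
    \<rho> (\<lambda>j. 1 / of_nat n * basis_sum n a j) \<le> T * (MAX i\<in>{1..n}. norm (a i))"
    using S by (fastforce intro: order_trans)
qed

lemma weakstar_asymptotic_basic_subcotype_iff:
  "weakstar_asymptotic_basic_subcotype scaleY A \<longleftrightarrow> (\<forall>\<epsilon>>0. \<exists>N. \<forall>n\<ge>N. 1 \<le> n \<longrightarrow>
     (\<forall>(r, \<rho>) \<in> weakstar_asymptotic_structure scaleY A n.
     \<forall>a. \<epsilon> * r (basis_sum n a) \<ge> (MIN i\<in>{1..n}. norm (a i * of_real (\<rho> (basis_vec i))))))"
  unfolding weakstar_asymptotic_basic_subcotype_def upsilon_star_def
proof (rule tendsto_zero_iff)
  fix n :: nat and S T :: real
  assume S: "\<forall>(r, \<rho>)\<in>weakstar_asymptotic_structure scaleY A n. \<forall>a.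
    (MIN i\<in>{1..n}. norm (a i * of_real (\<rho> (basis_vec i)))) \<le> S * r (basis_sum n a)" and "S \<le> T"
  then have "S * r (basis_sum n a) \<le> T * r (basis_sum n a)" if "(r, \<rho>) \<in> weakstar_asymptotic_structure scaleY A n" for r \<rho> and a :: "nat \<Rightarrow> 'a"
    using weakstar_structure_seminorms(1)[OF that] by (intro mult_right_mono seminorm_basis_sum_nonneg)
  then show "\<forall>(r, \<rho>)\<in>weakstar_asymptotic_structure scaleY A n. \<forall>a.
    (MIN i\<in>{1..n}. norm (a i * of_real (\<rho> (basis_vec i)))) \<le> T * r (basis_sum n a)"
    using S by (fastforce intro: order_trans)
qed

lemma (in operator_between) rho_vanishes_if_finite_dim:
  assumes "finite_dim scaleY" "(r, \<rho>) \<in> asymptotic_structure scaleX A n"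
  shows "\<rho> (basis_sum n a) = 0"
proof -
  have "\<rho> (basis_sum n a) \<le> (\<Sum>i=1..n. norm (a i) * \<rho> (basis_vec i))"
    by (rule seminorm_basis_sum_le[OF structure_seminorms(2)[OF assms(2)]]) simp
  also have "\<dots> = 0" using finite_dim_range_vanishes[OF assms] by simp
  finally show ?thesis
    using seminorm_basis_sum_nonneg[OF structure_seminorms(2)[OF assms(2)], of a] by simp
qed

text \<open>The numbers \<open>b\<^sub>i\<close> are chosen such that Hoelder's inequality for \<open>(a\<^sub>i \<rho>(e\<^sub>i))\<close> is attained; the loss is the factor 2 of
  \<open>weakstar_pair_dominated\<close>.\<close>

lemma (in operator_between) type_imp_cotype:
  assumes p: "1 \<le> p" "1 / p + 1 / q = 1" and type: "asymptotic_basic_type scaleX p A"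
  shows "weakstar_asymptotic_basic_cotype scaleY q A"
proof -
  obtain T where T: "T > 0" "\<And>n r \<rho> a. 1 \<le> n \<Longrightarrow> (r, \<rho>) \<in> asymptotic_structure scaleX A n \<Longrightarrow>
      \<rho> (basis_sum n a) \<le> T * lp_norm p n a"
    using type unfolding asymptotic_basic_type_iff by blast
  have "lp_norm q n (\<lambda>i. a i * of_real (\<rho> (basis_vec i))) \<le> 2 * T * r (basis_sum n a)"
    if n: "1 \<le> n" and pair: "(r, \<rho>) \<in> weakstar_asymptotic_structure scaleY A n" for n r \<rho> a
  proof (cases "finite_dim scaleX")
    case True
    have "lp_norm q n (\<lambda>i. a i * of_real (\<rho> (basis_vec i))) = lp_norm q n (\<lambda>_. 0 :: 'k)"
      using finite_dim_domain_vanishes[OF True pair] by (intro lp_norm_cong) simp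
    then show ?thesis
      using T(1) seminorm_basis_sum_nonneg[OF weakstar_structure_seminorms(1)[OF pair], of a] n
      by (simp add: lp_norm_zero)
  next
    case False
    note \<rho>0 = seminorm_basis_vec_nonneg[OF weakstar_structure_seminorms(2)[OF pair]]
    note r0 = seminorm_basis_sum_nonneg[OF weakstar_structure_seminorms(1)[OF pair], of a]
    obtain b :: "nat \<Rightarrow> 'k" where b: "\<And>i. i \<in> {1..n} \<Longrightarrow> norm (b i) \<le> 1" "lp_norm p n b \<le> 1"
      "lp_norm q n (\<lambda>i. a i * of_real (\<rho> (basis_vec i))) \<le> (\<Sum>i=1..n. norm (a i * of_real (\<rho> (basis_vec i))) * norm (b i))"
      by (rule lp_norm_attained[OF p n, of "\<lambda>i. a i * of_real (\<rho> (basis_vec i))"]) (rule that)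
    show ?thesis
    proof (rule field_le_epsilon)
      fix \<eta> :: real assume \<eta>: "0 < \<eta>"
      obtain r' \<rho>' b' where *: "(r', \<rho>') \<in> asymptotic_structure scaleX A n" "\<And>i. norm (b' i :: 'k) = norm (b i)"
        "(\<Sum>i=1..n. norm (a i) * norm (b i) * \<rho> (basis_vec i)) \<le> 2 * r (basis_sum n a) * \<rho>' (basis_sum n b') + \<eta>"
        by (rule weakstar_pair_dominated_all[where a = a and b = b, OF False pair b(1) \<eta>]) (assumption, rule that)
      have "lp_norm p n b' = lp_norm p n b" using *(2) by (intro lp_norm_cong) simp
      then have "\<rho>' (basis_sum n b') \<le> T * 1"
        using T(2)[OF n *(1), of b'] mult_left_mono[OF b(2) less_imp_le[OF T(1)]] by simp
      then have "2 * r (basis_sum n a) * \<rho>' (basis_sum n b') \<le> 2 * r (basis_sum n a) * T"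
        using r0 by (intro mult_left_mono) auto
      moreover have "(\<Sum>i=1..n. norm (a i * of_real (\<rho> (basis_vec i))) * norm (b i)) =
          (\<Sum>i=1..n. norm (a i) * norm (b i) * \<rho> (basis_vec i))"
        using \<rho>0 by (intro sum.cong) (auto simp: norm_mult)
      ultimately show "lp_norm q n (\<lambda>i. a i * of_real (\<rho> (basis_vec i))) \<le> 2 * T * r (basis_sum n a) + \<eta>"
        using b(3) *(3) by (simp add: mult_ac)
    qed
  qed
  then show ?thesis unfolding weakstar_asymptotic_basic_cotype_iff using T(1)
    by (intro exI[of _ "2 * T"]) auto
qed

lemma (in operator_between) cotype_imp_type:
  assumes p: "1 \<le> p" "1 / p + 1 / q = 1" and cotype: "weakstar_asymptotic_basic_cotype scaleY q A"
  shows "asymptotic_basic_type scaleX p A"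
proof -
  obtain C where C: "C > 0" "\<And>n r \<rho> a. 1 \<le> n \<Longrightarrow> (r, \<rho>) \<in> weakstar_asymptotic_structure scaleY A n \<Longrightarrow>
      lp_norm q n (\<lambda>i. a i * of_real (\<rho> (basis_vec i))) \<le> C * r (basis_sum n a)"
    using cotype unfolding weakstar_asymptotic_basic_cotype_iff by blast
  have "\<rho> (basis_sum n a) \<le> 3 * C * lp_norm p n a"
    if n: "1 \<le> n" and pair: "(r, \<rho>) \<in> asymptotic_structure scaleX A n" for n r \<rho> a
  proof (cases "finite_dim scaleY")
    case True
    then show ?thesis using rho_vanishes_if_finite_dim[OF True pair] C(1) lp_norm_nonneg[OF n, of p a] by simp
  next
    case False
    show ?thesis
    proof (rule field_le_epsilon)
      fix \<eta> :: real assume \<eta>: "0 < \<eta>"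
      obtain r' \<rho>' l where *: "(r', \<rho>') \<in> weakstar_asymptotic_structure scaleY A n" "r' (basis_sum n l) \<le> 3"
        "\<rho> (basis_sum n a) \<le> (\<Sum>i=1..n. norm (a i) * (norm (l i :: 'k) * \<rho>' (basis_vec i))) + \<eta>"
        by (rule pair_dominated[where b = a, OF False pair \<eta>]) (rule that)
      note \<rho>0 = seminorm_basis_vec_nonneg[OF weakstar_structure_seminorms(2)[OF *(1)]]
      have "(\<Sum>i=1..n. norm (a i) * (norm (l i) * \<rho>' (basis_vec i))) =
          (\<Sum>i=1..n. norm (a i) * norm (l i * of_real (\<rho>' (basis_vec i))))"
        using \<rho>0 by (intro sum.cong) (auto simp: norm_mult)
      also have "\<dots> \<le> lp_norm p n a * lp_norm q n (\<lambda>i. l i * of_real (\<rho>' (basis_vec i)))"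
        by (rule lp_norm_Holder[OF p n])
      also have "\<dots> \<le> lp_norm p n a * (C * r' (basis_sum n l))"
        using C(2)[OF n *(1)] lp_norm_nonneg[OF n] by (intro mult_left_mono) auto
      also have "\<dots> \<le> lp_norm p n a * (C * 3)"
        using *(2) C(1) lp_norm_nonneg[OF n] by (intro mult_left_mono) auto
      finally show "\<rho> (basis_sum n a) \<le> 3 * C * lp_norm p n a + \<eta>" using *(3) by (simp add: mult_ac)
    qed
  qed
  then show ?thesis unfolding asymptotic_basic_type_iff using C(1)
    by (intro exI[of _ "3 * C"]) auto
qed

text \<open>With \<open>\<bar>b\<^sub>i\<bar> = 1\<close> the minimum of the numbers \<open>\<bar>a\<^sub>i\<bar> \<rho>(e\<^sub>i)\<close> is at most their mean, hence at most \<open>2 r(a) \<rho>'(b' / n)\<close>.\<close>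

lemma (in operator_between) subtype_imp_subcotype:
  assumes "asymptotic_basic_subtype scaleX A"
  shows "weakstar_asymptotic_basic_subcotype scaleY A"
  unfolding weakstar_asymptotic_basic_subcotype_iff
proof (intro allI impI)
  fix \<epsilon> :: real assume \<epsilon>: "0 < \<epsilon>"
  then have "0 < \<epsilon> / 2" by simp
  with assms[unfolded asymptotic_basic_subtype_iff] obtain N where N: "\<And>n r \<rho> a. n \<ge> N \<Longrightarrow> 1 \<le> n \<Longrightarrow>
      (r, \<rho>) \<in> asymptotic_structure scaleX A n \<Longrightarrow>
      \<rho> (\<lambda>j. 1 / of_nat n * basis_sum n a j) \<le> \<epsilon> / 2 * (MAX i\<in>{1..n}. norm (a i))"
    by blast
  have "(MIN i\<in>{1..n}. norm (a i * of_real (\<rho> (basis_vec i)))) \<le> \<epsilon> * r (basis_sum n a)"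
    if nN: "n \<ge> N" and n: "1 \<le> n" and pair: "(r, \<rho>) \<in> weakstar_asymptotic_structure scaleY A n" for n r \<rho> a
  proof -
    define m where "m = (MIN i\<in>{1..n}. norm (a i * of_real (\<rho> (basis_vec i)) :: 'k))"
    have m_le: "m \<le> norm (a i * of_real (\<rho> (basis_vec i)))" if "i \<in> {1..n}" for i
      unfolding m_def using that by (intro Min_le) auto
    note \<rho>0 = seminorm_basis_vec_nonneg[OF weakstar_structure_seminorms(2)[OF pair]]
    note r0 = seminorm_basis_sum_nonneg[OF weakstar_structure_seminorms(1)[OF pair], of a]
    show ?thesis
    proof (cases "finite_dim scaleX")
      case True
      have "m \<le> 0" using m_le[of 1] n finite_dim_domain_vanishes[OF True pair, of 1] by simp
      moreover have "0 \<le> \<epsilon> * r (basis_sum n a)" using r0 \<epsilon> by simp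
      ultimately show ?thesis unfolding m_def by linarith
    next
      case False
      show ?thesis unfolding m_def[symmetric]
      proof (rule field_le_epsilon)
        fix \<eta> :: real assume \<eta>: "0 < \<eta>"
        obtain r' \<rho>' b' where *: "(r', \<rho>') \<in> asymptotic_structure scaleX A n" "\<And>i. norm (b' i :: 'k) = norm (1 :: 'k)"
          "(\<Sum>i=1..n. norm (a i) * norm (1 :: 'k) * \<rho> (basis_vec i)) \<le> 2 * r (basis_sum n a) * \<rho>' (basis_sum n b') + \<eta>"
          by (rule weakstar_pair_dominated_all[where a = a and b = "\<lambda>_. 1", OF False pair _ \<eta>]) (simp, rule that)
        have "real n * m = (\<Sum>i=1..n. m)" by simp
        also have "\<dots> \<le> (\<Sum>i=1..n. norm (a i) * norm (1 :: 'k) * \<rho> (basis_vec i))"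
          using m_le \<rho>0 by (intro sum_mono) (auto simp: norm_mult)
        finally have 1: "real n * m \<le> 2 * r (basis_sum n a) * \<rho>' (basis_sum n b') + \<eta>" using *(3) by linarith
        have "(MAX i\<in>{1..n}. norm (b' i)) = 1" using *(2) n by simp
        then have "\<rho>' (\<lambda>j. 1 / of_nat n * basis_sum n b' j) \<le> \<epsilon> / 2" using N[OF nN n *(1), of b'] by simp
        moreover have "\<rho>' (\<lambda>j. 1 / of_nat n * basis_sum n b' j) = norm (1 / of_nat n :: 'k) * \<rho>' (basis_sum n b')"
          by (rule seminorm_scale_basis_sum(2)[OF structure_seminorms(2)[OF *(1)]])
        moreover have "norm (1 / of_nat n :: 'k) = 1 / real n" by (simp add: norm_divide)
        ultimately have "1 / real n * \<rho>' (basis_sum n b') \<le> \<epsilon> / 2" by (simp only:)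
        then have "\<rho>' (basis_sum n b') \<le> real n * (\<epsilon> / 2)" using n by (simp add: field_simps)
        then have "2 * r (basis_sum n a) * \<rho>' (basis_sum n b') \<le> 2 * r (basis_sum n a) * (real n * (\<epsilon> / 2))"
          using r0 by (intro mult_left_mono) auto
        then have "real n * m \<le> real n * (\<epsilon> * r (basis_sum n a)) + \<eta>" using 1 by (simp add: mult_ac)
        also have "\<dots> \<le> real n * (\<epsilon> * r (basis_sum n a) + \<eta>)"
          using n \<eta> by (simp add: distrib_left)
        finally show "m \<le> \<epsilon> * r (basis_sum n a) + \<eta>" using n by simp
      qed
    qed
  qed
  then show "\<exists>N. \<forall>n\<ge>N. 1 \<le> n \<longrightarrow> (\<forall>(r, \<rho>) \<in> weakstar_asymptotic_structure scaleY A n.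
     \<forall>a. \<epsilon> * r (basis_sum n a) \<ge> (MIN i\<in>{1..n}. norm (a i * of_real (\<rho> (basis_vec i)))))"
    by (intro exI[of _ N]) auto
qed

text \<open>If bounded numbers have a large mean, a fixed proportion of them is large.\<close>

lemma card_large_terms:
  fixes u :: "nat \<Rightarrow> real"
  assumes bd: "\<And>i. i < n \<Longrightarrow> u i \<le> K" and sum: "\<epsilon> * real n < (\<Sum>i<n. u i)" and \<epsilon>: "0 \<le> \<epsilon>"
  shows "\<epsilon> / 2 * real n < real (card {i \<in> {..<n}. \<epsilon> / 2 \<le> u i}) * K"
proof -
  define I where "I = {i \<in> {..<n}. \<epsilon> / 2 \<le> u i}"
  have "(\<Sum>i<n. u i) = (\<Sum>i\<in>I. u i) + (\<Sum>i\<in>{..<n} - I. u i)"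
    using sum.subset_diff[of I "{..<n}" u] by (auto simp: I_def add.commute)
  also have "(\<Sum>i\<in>I. u i) \<le> real (card I) * K" using bd by (intro sum_bounded_above) (auto simp: I_def)
  also have "(\<Sum>i\<in>{..<n} - I. u i) \<le> real (card ({..<n} - I)) * (\<epsilon> / 2)"
    by (intro sum_bounded_above) (auto simp: I_def)
  also have "\<dots> \<le> real n * (\<epsilon> / 2)"
    using \<epsilon> card_mono[of "{..<n}" "{..<n} - I"] by (intro mult_right_mono) auto
  finally have "(\<Sum>i<n. u i) \<le> real (card I) * K + real n * (\<epsilon> / 2)" by simp
  then have "\<epsilon> / 2 * real n < real (card I) * K" using sum by (simp add: algebra_simps)
  then show ?thesis by (simp only: I_def)
qed

text \<open>A bound for the minimum does not control a sum directly, and the norms \<open>r\<close> are monotone but not unconditional, so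
  coordinates cannot be dropped in the weak* structure. They are dropped on the side of \<open>X\<close> instead: if the
  mean of \<open>\<bar>g (A x\<^sub>i)\<bar>\<close> exceeds \<open>\<epsilon>\<close>, then \<open>\<bar>g (A x\<^sub>i)\<bar> \<ge> \<epsilon> / 2\<close> on a set \<open>I\<close> whose size grows linearly in \<open>n\<close>. Frequently
  it is the same set \<open>I\<close>, and the subsequences indexed by \<open>I\<close> come from a tree of height \<open>card I\<close>, to which
  \<open>weakstar_pair_from_functionals\<close> applies.\<close>

lemma (in operator_between) subcotype_imp_subtype:
  assumes "weakstar_asymptotic_basic_subcotype scaleY A"
  shows "asymptotic_basic_subtype scaleX A"
  unfolding asymptotic_basic_subtype_iff
proof (intro allI impI)
  fix \<epsilon> :: real assume \<epsilon>: "0 < \<epsilon>"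
  then have "0 < \<epsilon> / 24" by simp
  with assms[unfolded weakstar_asymptotic_basic_subcotype_iff] obtain M where M: "\<And>n r \<rho> a. n \<ge> M \<Longrightarrow> 1 \<le> n \<Longrightarrow>
      (r, \<rho>) \<in> weakstar_asymptotic_structure scaleY A n \<Longrightarrow>
      (MIN i\<in>{1..n}. norm (a i * of_real (\<rho> (basis_vec i)))) \<le> \<epsilon> / 24 * r (basis_sum n a)"
    by blast
  \<comment> \<open>From this height on, the set of large coordinates has more than \<open>M\<close> elements.\<close>
  define N where "N = nat \<lceil>2 * (real M + 1) * norm A / \<epsilon>\<rceil>"
  have "\<rho> (\<lambda>j. 1 / of_nat n * basis_sum n a j) \<le> \<epsilon> * (MAX i\<in>{1..n}. norm (a i))"
    if nN: "n \<ge> N" and n: "1 \<le> n" and pair: "(r, \<rho>) \<in> asymptotic_structure scaleX A n" for n r \<rho> a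
  proof (rule ccontr)
    define K where "K = (MAX i\<in>{1..n}. norm (a i))"
    assume "\<not> \<rho> (\<lambda>j. 1 / of_nat n * basis_sum n a j) \<le> \<epsilon> * (MAX i\<in>{1..n}. norm (a i))"
    then have big: "\<epsilon> * K < \<rho> (\<lambda>j. 1 / of_nat n * basis_sum n a j)" by (simp add: K_def)
    have "\<rho> (\<lambda>j. 1 / of_nat n * basis_sum n a j) = norm (1 / of_nat n :: 'k) * \<rho> (basis_sum n a)"
      by (rule seminorm_scale_basis_sum(2)[OF structure_seminorms(2)[OF pair]])
    moreover have "norm (1 / of_nat n :: 'k) = 1 / real n" by (simp add: norm_divide)
    ultimately have "\<epsilon> * K < 1 / real n * \<rho> (basis_sum n a)" using big by (simp only:)
    then have big2: "\<epsilon> * K * real n < \<rho> (basis_sum n a)" using n by (simp add: field_simps)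
    have aK: "norm (a i) \<le> K" if "i \<in> {1..n}" for i unfolding K_def using that by (rule le_MAX)
    have K0: "0 \<le> K" unfolding K_def by (rule MAX_norm_nonneg[OF n])
    have infY: "\<not> finite_dim scaleY"
    proof
      assume "finite_dim scaleY"
      from rho_vanishes_if_finite_dim[OF this pair] big2 have "\<epsilon> * K * real n < 0" by simp
      then show False using \<epsilon> K0 by (simp add: mult_less_0_iff)
    qed
    have "K \<noteq> 0"
    proof
      assume "K = 0"
      then have "norm (a i) = 0" if "i \<in> {1..n}" for i using aK[OF that] by simp
      then have "(\<Sum>i=1..n. norm (a i) * \<rho> (basis_vec i)) = 0" by simp
      then have "\<rho> (basis_sum n a) \<le> 0"
        using seminorm_basis_sum_le[OF structure_seminorms(2)[OF pair] order_refl, of a] by simp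
      then show False using big2 \<open>K = 0\<close> by simp
    qed
    then have K: "0 < K" using K0 by simp
    define b where "b i = of_real (1 / K) * a i" for i
    have b: "norm (b i) \<le> 1" if "i \<in> {1..n}" for i
      unfolding b_def norm_mult norm_of_real using aK[OF that] K by simp
    have "\<rho> (basis_sum n b) = norm (of_real (1 / K) :: 'k) * \<rho> (basis_sum n a)"
      unfolding b_def by (rule seminorm_scale_basis_sum(1)[OF structure_seminorms(2)[OF pair]])
    then have \<rho>b: "\<rho> (basis_sum n b) = \<rho> (basis_sum n a) / K" unfolding norm_of_real using K by simp
    have big3: "\<epsilon> * real n < \<rho> (basis_sum n b)"
      unfolding \<rho>b using big2 K by (simp add: pos_less_divide_eq mult_ac)
    define \<delta> where "\<delta> = (\<rho> (basis_sum n b) - \<epsilon> * real n) / 2"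
    have \<delta>: "0 < \<delta>" "\<epsilon> * real n < \<rho> (basis_sum n b) - \<delta>" using big3 by (simp_all add: \<delta>_def field_simps)
      have "frequently (\<lambda>xs. \<exists>I\<in>Pow {..<n}. M + 1 \<le> card I \<and> (\<exists>g\<in>dual_ball scaleY. \<forall>x\<in>set (nths xs I).
        \<epsilon> / 2 \<le> norm (g \<cdot> (A \<cdot> x)))) (tree_filter weak_filter n)"
    proof (rule frequently_elim1[OF frequently_norming_functional[OF pair b \<delta>(1)]])
      fix xs assume "\<exists>g\<in>dual_ball scaleY. length xs = n \<and> (\<forall>x\<in>set xs. norm x = 1) \<and>
        \<rho> (basis_sum n b) - \<delta> \<le> (\<Sum>i<n. norm (b (Suc i)) * norm (g \<cdot> (A \<cdot> (xs ! i))))"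
      then obtain g where g: "g \<in> dual_ball scaleY" and xs: "length xs = n" "\<forall>x\<in>set xs. norm x = 1"
        and sum: "\<rho> (basis_sum n b) - \<delta> \<le> (\<Sum>i<n. norm (b (Suc i)) * norm (g \<cdot> (A \<cdot> (xs ! i))))"
        by blast
      define u where "u i = norm (g \<cdot> (A \<cdot> (xs ! i)))" for i
      have "(\<Sum>i<n. norm (b (Suc i)) * u i) \<le> (\<Sum>i<n. 1 * u i)"
        using b by (intro sum_mono mult_right_mono) (auto simp: u_def)
      then have su: "\<epsilon> * real n < (\<Sum>i<n. u i)" using sum \<delta>(2) by (simp add: u_def)
      have uA: "u i \<le> norm A" if "i < n" for i
      proof -
        have "u i \<le> norm g * norm (A \<cdot> (xs ! i))" unfolding u_def by (rule norm_blinfun)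
        also have "\<dots> \<le> 1 * (norm A * norm (xs ! i))"
          using g by (intro mult_mono norm_blinfun) (auto simp: dual_ball_def)
        finally show ?thesis using xs that by simp
      qed
      define I where "I = {i \<in> {..<n}. \<epsilon> / 2 \<le> u i}"
      have cI: "\<epsilon> / 2 * real n < real (card I) * norm A"
        unfolding I_def by (rule card_large_terms[OF uA su]) (use \<epsilon> in auto)
      have "2 * (real M + 1) * norm A / \<epsilon> \<le> real n"
        using nN unfolding N_def by linarith
      then have "(real M + 1) * norm A \<le> \<epsilon> / 2 * real n" using \<epsilon> by (simp add: field_simps)
      then have "(real M + 1) * norm A < real (card I) * norm A" using cI by linarith
      then have "real M + 1 < real (card I)" by (rule mult_right_less_imp_less) simp
      then have "M + 1 \<le> card I" by linarith
      moreover have "\<epsilon> / 2 \<le> norm (g \<cdot> (A \<cdot> x))" if "x \<in> set (nths xs I)" for x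
        using that by (auto simp: set_nths I_def u_def)
      moreover have "I \<in> Pow {..<n}" by (auto simp: I_def)
      ultimately show "\<exists>I\<in>Pow {..<n}. M + 1 \<le> card I \<and> (\<exists>g\<in>dual_ball scaleY. \<forall>x\<in>set (nths xs I).
        \<epsilon> / 2 \<le> norm (g \<cdot> (A \<cdot> x)))" using g by blast
    qed
    from frequently_bex_finite[OF _ this] obtain I where I: "I \<subseteq> {..<n}" and
      "frequently (\<lambda>xs. M + 1 \<le> card I \<and> (\<exists>g\<in>dual_ball scaleY. \<forall>x\<in>set (nths xs I).
        \<epsilon> / 2 \<le> norm (g \<cdot> (A \<cdot> x)))) (tree_filter weak_filter n)"
      by auto
    then have cI: "M + 1 \<le> card I" and fr: "frequently (\<lambda>xs. \<exists>g\<in>dual_ball scaleY. \<forall>x\<in>set (nths xs I).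
        \<epsilon> / 2 \<le> norm (g \<cdot> (A \<cdot> x))) (tree_filter weak_filter n)"
      by (auto dest: frequently_ex elim: frequently_elim1)
    define m where "m = card I"
    have m: "M \<le> m" "1 \<le> m" using cI by (auto simp: m_def)
    have "I \<inter> {..<n} = I" using I by blast
    then have fr_m: "frequently (\<lambda>xs. \<exists>g\<in>dual_ball scaleY. \<forall>x\<in>set xs.
        \<epsilon> / 2 \<le> norm (g \<cdot> (A \<cdot> x))) (tree_filter weak_filter m)"
      using frequently_tree_filter_nths[OF fr] by (simp add: m_def)
    have \<epsilon>4: "0 < \<epsilon> / 4" using \<epsilon> by simp
    define Q where "Q xs g \<longleftrightarrow> (\<forall>x\<in>set xs. \<epsilon> / 2 \<le> norm (g \<cdot> (A \<cdot> x)))"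
      for xs and g :: "'y \<Rightarrow>\<^sub>L 'k"
    have "frequently (\<lambda>xs. \<exists>g\<in>dual_ball scaleY. Q xs g) (tree_filter weak_filter m)" unfolding Q_def by (rule fr_m)
    then obtain r' \<rho>' l xs g where *: "(r', \<rho>') \<in> weakstar_asymptotic_structure scaleY A m" "r' (basis_sum m l) \<le> 3"
      "length xs = m" "Q xs g" "\<And>i. i < m \<Longrightarrow> norm (xs ! i) = 1"
      "\<And>i. i < m \<Longrightarrow> norm (g \<cdot> (A \<cdot> (xs ! i))) \<le>
         norm (l (Suc i) :: 'k) * \<rho>' (basis_vec (Suc i)) + \<epsilon> / 4"
      by (rule weakstar_pair_from_functionals[OF infY \<epsilon>4]) (rule that)
    have "\<epsilon> / 4 \<le> norm (l i * of_real (\<rho>' (basis_vec i)))" if i: "i \<in> {1..m}" for i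
    proof -
      have i': "i - 1 < m" "Suc (i - 1) = i" using i by auto
      then have "\<epsilon> / 2 \<le> norm (g \<cdot> (A \<cdot> (xs ! (i - 1))))" using *(3,4) by (simp add: Q_def)
      then have "\<epsilon> / 4 \<le> norm (l i) * \<rho>' (basis_vec i)" using *(6)[OF i'(1)] unfolding i'(2) by linarith
      then show ?thesis
        using seminorm_basis_vec_nonneg[OF weakstar_structure_seminorms(2)[OF *(1)] i] by (simp add: norm_mult)
    qed
    then have "\<epsilon> / 4 \<le> (MIN i\<in>{1..m}. norm (l i * of_real (\<rho>' (basis_vec i))))"
      using m(2) by (intro Min.boundedI) auto
    also have "\<dots> \<le> \<epsilon> / 24 * r' (basis_sum m l)" by (rule M[OF m *(1)])
    also have "\<dots> \<le> \<epsilon> / 24 * 3" using *(2) \<epsilon> by (intro mult_left_mono) auto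
    finally show False using \<epsilon> by simp
  qed
  then show "\<exists>N. \<forall>n\<ge>N. 1 \<le> n \<longrightarrow> (\<forall>(r, \<rho>) \<in> asymptotic_structure scaleX A n.
     \<forall>a. \<rho> (\<lambda>j. 1 / of_nat n * basis_sum n a j) \<le> \<epsilon> * (MAX i\<in>{1..n}. norm (a i)))"
    by (intro exI[of _ N]) auto
qed

theorem theorem1p4:
  fixes scaleX :: "'k::real_or_complex \<Rightarrow> 'x::banach \<Rightarrow> 'x"
    and scaleY :: "'k \<Rightarrow> 'y::banach \<Rightarrow> 'y"
    and A :: "'x \<Rightarrow>\<^sub>L 'y"
  assumes "banach_over scaleX" and "banach_over scaleY"
    and "linear_over scaleX scaleY A"
  shows "(asymptotic_basic_subtype scaleX A \<longleftrightarrow> weakstar_asymptotic_basic_subcotype scaleY A) \<and>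
    (\<forall>p q :: ennreal. 1 \<le> p \<longrightarrow> 1 / p + 1 / q = 1 \<longrightarrow>
       (asymptotic_basic_type scaleX p A \<longleftrightarrow> weakstar_asymptotic_basic_cotype scaleY q A))"
proof -
  interpret operator_between scaleX scaleY A using assms by (rule operator_between.intro)
  show ?thesis
    using subtype_imp_subcotype subcotype_imp_subtype type_imp_cotype cotype_imp_type by blast
qed

end
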